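(* Let $n=1$, let $x_1,\dots,x_m\in\mathbb R^3$ be distinct, let $\Pi=\{\mathbb C^m,\Gamma_0,\Gamma_1\}$ be the boundary triplet for $H^*$ described in the context, and let $\alpha=(\alpha_1,\dots,\alpha_m)$, $\alpha_k\in\mathbb R$. Then the domain of the Schrödinger operator $H^{(3)}_{\alpha,X}$ is $$\operatorname{dom}(H^{(3)}_{\alpha,X})=\operatorname{dom}(H^* )\upharpoonright\ker(\Gamma_1-B_\alpha\Gamma_0)=\{f\in\operatorname{dom}(H^* ):\Gamma_1f=B_\alpha\Gamma_0f\},\qquad B_\alpha=\operatorname{diag}(\alpha_1,\dots,\alpha_m).$$
   Context: $X=\{x_1,\dots,x_m\}$, $r_j=|x-x_j|$, $H=-\Delta$ in $L^2(\mathbb R^3)$ with $\operatorname{dom}(H)=\{f\in W_2^2(\mathbb R^3): f(x_j)=0,\ j=1,\dots,m\}$. Every $f\in\operatorname{dom}(H^* )$ is uniquely $f=\sum_{j=1}^m(\xi_{0j}e^{-r_j}/r_j+\xi_{1j}e^{-r_j})+f_H$ with $\xi_{0j},\xi_{1j}\in\mathbb C$, $f_H\in\operatorname{dom}(H)$. The boundary triplet is $\mathcal H=\mathbb C^m$, $\Gamma_0f=4\pi\{\lim_{x\to x_j}f(x)|x-x_j|\}_{j=1}^m=4\pi\{\xi_{0j}\}_{j=1}^m$, $\Gamma_1f=\{\lim_{x\to x_j}(f(x)-\xi_{0j}/|x-x_j|)\}_{j=1}^m$. $H^{(3)}_{\alpha,X}$ is the self-adjoint operator in $L^2(\mathbb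 R^3)$ (Albeverio–Gesztesy–Høegh-Krohn–Holden) realizing $-\Delta+\sum_{j=1}^m\alpha_j\delta(\cdot-x_j)$, $\alpha_j\in\mathbb R$, defined through its resolvent: for $z\in\rho(H^{(3)}_{\alpha,X})\setminus[0,\infty)$, $$(H^{(3)}_{\alpha,X}-z)^{-1}f=(-\Delta-z)^{-1}f+\sum_{j,k=1}^m\bigl[\Gamma_{\alpha,X}(z)^{-1}\bigr]_{jk}\Bigl(\int_{\mathbb R^3}G_{\sqrt z}(y-x_k)f(y)\,dy\Bigr)G_{\sqrt z}(\cdot-x_j),$$ where $\operatorname{Im}\sqrt z>0$, $-\Delta$ has domain $W_2^2(\mathbb R^3)$, $G_{\sqrt z}(x)=\frac{e^{i\sqrt z|x|}}{4\pi|x|}$, and $\Gamma_{\alpha,X}(z)=\bigl((\alpha_j-\frac{i\sqrt z}{4\pi})\delta_{jk}-\widetilde G_{\sqrt z}(x_j-x_k)\bigr)_{j,k=1}^m$ with $\widetilde G_{\sqrt z}(x)=G_{\sqrt z}(x)$ for $x\ne0$ and $\widetilde G_{\sqrt z}(0)=0$. *)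

theory Defs
  imports "HOL-Analysis.Analysis"
begin

section \<open>The Hilbert space of square integrable functions\<close>

text \<open>
  Elements of the Hilbert space are represented by functions rather than by classes modulo
  equality almost everywhere.  All sets of functions and all operator graphs that occur below are
  saturated under equality almost everywhere, so equality of such sets is the same as
  equality of the corresponding sets of classes.
\<close>

type_synonym wave = "real^3 \<Rightarrow> complex"

definition L2 :: "wave set" where
  "L2 = {f. f \<in> borel_measurable lebesgue \<and> integrable lebesgue (\<lambda>y. (cmod (f y))\<^sup>2)}"

definition L2_inner :: "wave \<Rightarrow> wave \<Rightarrow> complex" where
  "L2_inner f g = (LINT y|lebesgue. f y * cnj (g y))"

definition L2_norm :: "wave \<Rightarrow> real" where
  "L2_norm f = sqrt (LINT y|lebesgue. (cmod (f y))\<^sup>2)"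


section \<open>Unbounded operators\<close>

text \<open>An operator is given by its graph; its domain is the \<^const>\<open>Domain\<close> of the graph.\<close>

type_synonym operator = "(wave \<times> wave) set"

definition densely_defined :: "operator \<Rightarrow> bool" where
  "densely_defined T \<longleftrightarrow> (\<forall>h\<in>L2. \<forall>e>0. \<exists>f\<in>Domain T \<inter> L2. L2_norm (\<lambda>y. h y - f y) < e)"

definition adjoint_op :: "operator \<Rightarrow> operator" where
  "adjoint_op T = {(f, g). f \<in> L2 \<and> g \<in> L2 \<and> (\<forall>(u, v)\<in>T. L2_inner v f = L2_inner u g)}"

text \<open>
  Linearity, saturation under equality almost everywhere, and (by density of the domain)
  single-valuedness modulo equality almost everywhere are consequences of \<open>T = T\<^sup>*\<close>.
\<close>

definition self_adjoint :: "operator \<Rightarrow> bool" where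
  "self_adjoint T \<longleftrightarrow> densely_defined T \<and> adjoint_op T = T"

text \<open>The graph of the inverse of \<open>T - z\<close>: all pairs \<open>(h, f)\<close> with \<open>(T - z) f = h\<close>.\<close>

definition resolvent :: "operator \<Rightarrow> complex \<Rightarrow> operator" where
  "resolvent T z = {(h, f). h \<in> L2 \<and> (\<exists>g. (f, g) \<in> T \<and> (AE y in lebesgue. h y = g y - z * f y))}"

text \<open>
  For a linear \<open>T\<close> the norm bound contains the injectivity of \<open>T - z\<close> (take \<open>h = 0\<close>).
\<close>

definition resolvent_set :: "operator \<Rightarrow> complex set" where
  "resolvent_set T = {z. (\<forall>h\<in>L2. \<exists>f. (h, f) \<in> resolvent T z) \<and>
     (\<exists>C. \<forall>(h, f)\<in>resolvent T z. L2_norm f \<le> C * L2_norm h)}"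


section \<open>The Sobolev space and the Laplacian\<close>

definition partial :: "3 \<Rightarrow> wave \<Rightarrow> wave" where
  "partial i f = (\<lambda>y. frechet_derivative f (at y) (axis i 1))"

primrec C_k :: "nat \<Rightarrow> wave \<Rightarrow> bool" where
  "C_k 0 f \<longleftrightarrow> continuous_on UNIV f"
| "C_k (Suc k) f \<longleftrightarrow> (\<forall>y. f differentiable (at y)) \<and> (\<forall>i. C_k k (partial i f))"

definition test_function :: "wave \<Rightarrow> bool" where
  "test_function \<phi> \<longleftrightarrow> (\<forall>k. C_k k \<phi>) \<and> compact (closure {y. \<phi> y \<noteq> 0})"

definition weak_partial :: "3 \<Rightarrow> wave \<Rightarrow> wave \<Rightarrow> bool" where
  "weak_partial i f g \<longleftrightarrow> f \<in> L2 \<and> g \<in> L2 \<and>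
     (\<forall>\<phi>. test_function \<phi> \<longrightarrow>
        (LINT y|lebesgue. f y * partial i \<phi> y) = - (LINT y|lebesgue. g y * \<phi> y))"

text \<open>
  \<open>sobolev k\<close> is \<open>W\<^sub>2\<^sup>k(\<real>\<^sup>3)\<close>: all weak derivatives of order at most \<open>k\<close> lie in \<open>L\<^sup>2\<close>.
\<close>

primrec sobolev :: "nat \<Rightarrow> wave set" where
  "sobolev 0 = L2"
| "sobolev (Suc k) = {f \<in> L2. \<forall>i. \<exists>g \<in> sobolev k. weak_partial i f g}"

definition neg_laplacian :: operator where
  "neg_laplacian = {(f, g). f \<in> sobolev 2 \<and> g \<in> L2 \<and>
     (\<exists>d dd. (\<forall>i. weak_partial i f (d i) \<and> weak_partial i (d i) (dd i)) \<and>
             (AE y in lebesgue. g y = - (\<Sum>i\<in>UNIV. dd i y)))}"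


section \<open>The minimal operator and the boundary maps\<close>

text \<open>
  The centres are a map \<open>x\<close> from a finite index type.  The point values \<open>f (x j)\<close> of
  \<open>f \<in> W\<^sub>2\<^sup>2(\<real>\<^sup>3)\<close> are those of its continuous representative.
\<close>

definition H_min :: "('m::finite \<Rightarrow> real^3) \<Rightarrow> operator" where
  "H_min x = {(f, g) \<in> neg_laplacian.
     \<exists>c. continuous_on UNIV c \<and> (AE y in lebesgue. f y = c y) \<and> (\<forall>j. c (x j) = 0)}"

text \<open>
  The limit of a class modulo equality almost everywhere: null sets are disregarded, so that the
  result does not depend on the representative.
\<close>

definition lim_at :: "real^3 \<Rightarrow> wave \<Rightarrow> complex" where
  "lim_at a f = Lim (inf (at a) (ae_filter lebesgue)) f"

definition \<xi>0 :: "('m::finite \<Rightarrow> real^3) \<Rightarrow> wave \<Rightarrow> 'm \<Rightarrow> complex" where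
  "\<xi>0 x f j = lim_at (x j) (\<lambda>y. f y * complex_of_real (norm (y - x j)))"

definition \<Gamma>0 :: "('m::finite \<Rightarrow> real^3) \<Rightarrow> wave \<Rightarrow> complex^'m" where
  "\<Gamma>0 x f = (\<chi> j. 4 * complex_of_real pi * \<xi>0 x f j)"

definition \<Gamma>1 :: "('m::finite \<Rightarrow> real^3) \<Rightarrow> wave \<Rightarrow> complex^'m" where
  "\<Gamma>1 x f = (\<chi> j. lim_at (x j) (\<lambda>y. f y - \<xi>0 x f j / complex_of_real (norm (y - x j))))"

definition diag_mat :: "real^'m \<Rightarrow> complex^'m^'m" where
  "diag_mat \<alpha> = (\<chi> j k. if j = k then complex_of_real (\<alpha> $ j) else 0)"


section \<open>The Schr\<ouml>dinger operator with point interactions\<close>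

text \<open>
  The square root of \<open>z\<close> with positive imaginary part, for \<open>z\<close> outside \<open>[0,\<infinity>)\<close>: there
  \<^term>\<open>csqrt (- z)\<close> has positive real part.
\<close>

definition sqrt_up :: "complex \<Rightarrow> complex" where
  "sqrt_up z = \<i> * csqrt (- z)"

definition green :: "complex \<Rightarrow> wave" where
  "green k y = exp (\<i> * k * complex_of_real (norm y)) / complex_of_real (4 * pi * norm y)"

definition green_tilde :: "complex \<Rightarrow> wave" where
  "green_tilde k y = (if y = 0 then 0 else green k y)"

definition \<Gamma>_mat :: "('m::finite \<Rightarrow> real^3) \<Rightarrow> real^'m \<Rightarrow> complex \<Rightarrow> complex^'m^'m" where
  "\<Gamma>_mat x \<alpha> z = (\<chi> j k.
     (if j = k then complex_of_real (\<alpha> $ j) - \<i> * sqrt_up z / complex_of_real (4 * pi) else 0)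
     - green_tilde (sqrt_up z) (x j - x k))"

text \<open>
  \<open>point_interaction x \<alpha> T\<close>: \<open>T\<close> is the self-adjoint operator realizing
  \<open>-\<Delta> + \<Sum>\<^sub>j \<alpha>\<^sub>j \<delta>(\<cdot> - x\<^sub>j)\<close>, characterized by its resolvent.  Both sides of the resolvent
  formula are graphs of operators on \<open>L\<^sup>2\<close>; \<open>u\<^sub>0\<close> is the free resolvent applied to \<open>f\<close>.
\<close>

definition point_interaction :: "('m::finite \<Rightarrow> real^3) \<Rightarrow> real^'m \<Rightarrow> operator \<Rightarrow> bool" where
  "point_interaction x \<alpha> T \<longleftrightarrow> self_adjoint T \<and>
     (\<forall>z \<in> resolvent_set T - complex_of_real ` {0..}.
        invertible (\<Gamma>_mat x \<alpha> z) \<and>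
        resolvent T z = {(f, u). f \<in> L2 \<and> u \<in> L2 \<and>
          (\<exists>u\<^sub>0. (f, u\<^sub>0) \<in> resolvent neg_laplacian z \<and>
             (AE y in lebesgue. u y = u\<^sub>0 y +
                (\<Sum>j\<in>UNIV. \<Sum>k\<in>UNIV. matrix_inv (\<Gamma>_mat x \<alpha> z) $ j $ k *
                   (LINT w|lebesgue. green (sqrt_up z) (w - x k) * f w) *
                   green (sqrt_up z) (y - x j))))})"

end

theory Submission
  imports Defs "HOL-Real_Asymp.Real_Asymp"
begin

text \<open>
  Fix \<open>z\<close> outside \<open>[0,\<infinity>)\<close> and write \<open>G\<^sub>j\<close> for the Green function of \<open>-\<Delta> - z\<close> with pole \<open>x\<^sub>j\<close>.
  Both sides of the claim are described by decompositions \<open>f = u + \<Sum>\<^sub>j c\<^sub>j G\<^sub>j\<close> with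
  \<open>u = (-\<Delta> - z)\<^sup>-\<^sup>1 h\<close> (the predicate \<open>green_form\<close>), and they impose the same condition on \<open>c\<close>.

  The first ingredient is that \<open>u\<close> has the continuous representative
  \<open>a \<mapsto> \<integral> G(w - a) h(w) dw\<close> (\<open>free_resolvent_green_potential\<close>).  Granted this, the boundary values
  of \<open>f\<close> can be read off: \<open>\<Gamma>\<^sub>0 f = c\<close>, because \<open>G\<^sub>j\<close> behaves like \<open>1/(4\<pi>|x - x\<^sub>j|)\<close> at its pole, and
  \<open>\<Gamma>\<^sub>1 f = (u(x\<^sub>j))\<^sub>j + (B\<^sub>\<alpha> - \<Gamma>\<^bsub>\<alpha>,X\<^esub>(z)) c\<close> (\<open>green_form_boundary_values\<close>).  So \<open>\<Gamma>\<^sub>1 f = B\<^sub>\<alpha> \<Gamma>\<^sub>0 f\<close> says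
  exactly \<open>\<Gamma>\<^bsub>\<alpha>,X\<^esub>(z) c = (u(x\<^sub>j))\<^sub>j\<close>.  The resolvent formula, on the other hand, describes the domain of
  \<open>T\<close> as the set of all \<open>f\<close> of this form with \<open>c = \<Gamma>\<^bsub>\<alpha>,X\<^esub>(z)\<^sup>-\<^sup>1 (u(x\<^sub>j))\<^sub>j\<close>, which is the same condition
  (\<open>point_interaction_domain_iff\<close>).

  It remains to see that the domain of the adjoint of \<open>H\<close> consists of all \<open>f\<close> of this form.
  The free resolvent is symmetric because the Green function is even (\<open>free_resolvent_symmetric\<close>), and the
  condition \<open>u(x\<^sub>j) = 0\<close> is orthogonality of \<open>(-\<Delta> - z) u\<close> to a Green function with pole \<open>x\<^sub>j\<close>.
  Hence the orthogonal complement of the range of \<open>H - cnj z\<close> is spanned by the \<open>G\<^sub>j\<close>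
  (\<open>green_form_in_adjoint\<close>, \<open>adjoint_green_form\<close>).  This uses that \<open>-\<Delta> - z\<close> and \<open>-\<Delta> - cnj z\<close> map \<open>W\<^sub>2\<^sup>2\<close> onto \<open>L\<^sup>2\<close>.
  For a point of the resolvent set of \<open>T\<close> such surjectivity is contained in the resolvent formula.  Hence the choice
  \<open>z = \<i>\<close>: both \<open>\<plusminus>\<i>\<close> lie in the resolvent set of every self-adjoint operator
  (\<open>imaginary_unit_in_resolvent_set\<close>).

  The analytic core is the representation of \<open>u \<in> W\<^sub>2\<^sup>2\<close> by the Green function
  (\<open>green_representation\<close>).  With \<open>\<kappa>\<^sup>2 = -z\<close> and \<open>s = sqrt(r\<^sup>2 + \<epsilon>\<^sup>2)\<close> in place of \<open>r\<close>, the function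
  \<open>exp(-\<kappa> s)/s\<close> is smooth, and applying \<open>-\<Delta> + \<kappa>\<^sup>2\<close> to it yields an explicit approximate identity of
  total mass close to \<open>4\<pi>\<close>.  Multiplied by a smooth cutoff it is a test function, so
  that the weak derivatives of \<open>u\<close> may be paired with it; the cutoff is removed by dominated convergence
  (\<open>helmholtz_regularised\<close>), and \<open>\<epsilon> \<rightarrow> 0\<close> is carried out after integration over boxes.
\<close>

section \<open>Square integrable functions\<close>

lemma L2_measurable: "f \<in> L2 \<Longrightarrow> f \<in> borel_measurable lebesgue"
  by (simp add: L2_def)

lemma L2_integrable_sq: "f \<in> L2 \<Longrightarrow> integrable lebesgue (\<lambda>y. (cmod (f y))\<^sup>2)"
  by (simp add: L2_def)

lemma two_mult_le_squares: "a * b \<le> a\<^sup>2 + b\<^sup>2" if "a \<ge> 0" "b \<ge> 0" for a b :: real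
proof -
  have "0 \<le> (a - b)\<^sup>2 + a * b"
    using that by simp
  thus ?thesis
    by (simp add: power2_eq_square algebra_simps)
qed

lemma L2_mult_integrable:
  assumes "f \<in> L2" "g \<in> L2"
  shows "integrable lebesgue (\<lambda>y. f y * g y)"
proof (rule Bochner_Integration.integrable_bound)
  show "integrable lebesgue (\<lambda>y. (cmod (f y))\<^sup>2 + (cmod (g y))\<^sup>2)"
    using assms by (intro Bochner_Integration.integrable_add L2_integrable_sq)
  show "(\<lambda>y. f y * g y) \<in> borel_measurable lebesgue"
    using assms[THEN L2_measurable] by measurable
  show "AE y in lebesgue. norm (f y * g y) \<le> norm ((cmod (f y))\<^sup>2 + (cmod (g y))\<^sup>2)"
    using two_mult_le_squares[of "cmod (f _)" "cmod (g _)"] by (simp add: norm_mult)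
qed

lemma L2_cnj: "f \<in> L2 \<Longrightarrow> (\<lambda>y. cnj (f y)) \<in> L2"
  unfolding L2_def by (auto intro!: borel_measurable_continuous_onI continuous_intros
      measurable_compose[of f lebesgue borel cnj borel])

lemma L2_inner_integrable:
  "f \<in> L2 \<Longrightarrow> g \<in> L2 \<Longrightarrow> integrable lebesgue (\<lambda>y. f y * cnj (g y))"
  by (intro L2_mult_integrable L2_cnj)

lemma L2_zero: "(\<lambda>y. 0) \<in> L2"
  by (simp add: L2_def)

lemma L2_cmult: "f \<in> L2 \<Longrightarrow> (\<lambda>y. c * f y) \<in> L2"
  by (auto simp: L2_def norm_mult power_mult_distrib simp del: integrable_mult_right_iff
      intro!: borel_measurable_times integrable_mult_right)

lemma L2_add:
  assumes "f \<in> L2" "g \<in> L2"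
  shows "(\<lambda>y. f y + g y) \<in> L2"
proof -
  have "integrable lebesgue (\<lambda>y. (cmod (f y + g y))\<^sup>2)"
  proof (rule Bochner_Integration.integrable_bound)
    show "integrable lebesgue (\<lambda>y. 2 * (cmod (f y))\<^sup>2 + 2 * (cmod (g y))\<^sup>2)"
      using assms by (intro Bochner_Integration.integrable_add integrable_mult_right L2_integrable_sq)
    show "(\<lambda>y. (cmod (f y + g y))\<^sup>2) \<in> borel_measurable lebesgue"
      using assms[THEN L2_measurable] by measurable
    have "(cmod (a + b))\<^sup>2 \<le> 2 * (cmod a)\<^sup>2 + 2 * (cmod b)\<^sup>2" for a b
    proof -
      have "(cmod (a + b))\<^sup>2 \<le> (cmod a + cmod b)\<^sup>2"
        by (simp add: norm_triangle_ineq power_mono)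
      also have "\<dots> \<le> 2 * (cmod a)\<^sup>2 + 2 * (cmod b)\<^sup>2"
        using sum_squares_bound[of "cmod a" "cmod b"] by (simp add: power2_sum)
      finally show ?thesis .
    qed
    thus "AE y in lebesgue. norm ((cmod (f y + g y))\<^sup>2)
        \<le> norm (2 * (cmod (f y))\<^sup>2 + 2 * (cmod (g y))\<^sup>2)"
      by simp
  qed
  thus ?thesis
    using assms[THEN L2_measurable] by (auto simp: L2_def)
qed

lemma L2_diff: "f \<in> L2 \<Longrightarrow> g \<in> L2 \<Longrightarrow> (\<lambda>y. f y - g y) \<in> L2"
  using L2_add[of f "\<lambda>y. (-1) * g y"] L2_cmult[of g "-1"] by simp

lemma L2_sum: "(\<And>j. j \<in> S \<Longrightarrow> f j \<in> L2) \<Longrightarrow> (\<lambda>y. \<Sum>j\<in>S. f j y) \<in> L2"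
  by (induction S rule: infinite_finite_induct) (auto intro: L2_add L2_zero)

lemma L2_norm_sq: "(L2_norm f)\<^sup>2 = (LINT y|lebesgue. (cmod (f y))\<^sup>2)"
  by (simp add: L2_norm_def)

lemma L2_norm_nonneg: "0 \<le> L2_norm f"
  by (simp add: L2_norm_def)

lemma L2_inner_self: "L2_inner f f = of_real ((L2_norm f)\<^sup>2)"
  unfolding L2_norm_sq L2_inner_def
  by (simp flip: integral_complex_of_real complex_norm_square)

lemma L2_inner_commute: "L2_inner g f = cnj (L2_inner f g)"
  unfolding L2_inner_def by (subst Bochner_Integration.integral_cnj [symmetric]) (simp add: mult.commute)

lemma L2_inner_add_left:
  "f \<in> L2 \<Longrightarrow> g \<in> L2 \<Longrightarrow> h \<in> L2 \<Longrightarrow> L2_inner (\<lambda>y. f y + g y) h = L2_inner f h + L2_inner g h"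
  unfolding L2_inner_def distrib_right
  by (intro Bochner_Integration.integral_add L2_inner_integrable)

lemma L2_inner_diff_left:
  "f \<in> L2 \<Longrightarrow> g \<in> L2 \<Longrightarrow> h \<in> L2 \<Longrightarrow> L2_inner (\<lambda>y. f y - g y) h = L2_inner f h - L2_inner g h"
  unfolding L2_inner_def left_diff_distrib
  by (intro Bochner_Integration.integral_diff L2_inner_integrable)

lemma L2_inner_cmult_left: "L2_inner (\<lambda>y. c * f y) g = c * L2_inner f g"
  unfolding L2_inner_def by (simp add: mult.assoc)

lemma L2_inner_add_right:
  "f \<in> L2 \<Longrightarrow> g \<in> L2 \<Longrightarrow> h \<in> L2 \<Longrightarrow> L2_inner f (\<lambda>y. g y + h y) = L2_inner f g + L2_inner f h"
  by (simp add: L2_inner_commute[of f] L2_inner_add_left)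

lemma L2_inner_diff_right:
  "f \<in> L2 \<Longrightarrow> g \<in> L2 \<Longrightarrow> h \<in> L2 \<Longrightarrow> L2_inner f (\<lambda>y. g y - h y) = L2_inner f g - L2_inner f h"
  by (simp add: L2_inner_commute[of f] L2_inner_diff_left)

lemma L2_inner_cmult_right: "L2_inner f (\<lambda>y. c * g y) = cnj c * L2_inner f g"
  by (simp add: L2_inner_commute[of f] L2_inner_cmult_left)

lemma L2_inner_sum_right:
  "h \<in> L2 \<Longrightarrow> (\<And>j. j \<in> S \<Longrightarrow> f j \<in> L2) \<Longrightarrow> L2_inner h (\<lambda>y. \<Sum>j\<in>S. f j y) = (\<Sum>j\<in>S. L2_inner h (f j))"
  by (induction S rule: infinite_finite_induct)
     (auto simp: L2_inner_add_right L2_sum, simp_all add: L2_inner_def)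

lemma L2_inner_cong_AE:
  assumes "AE y in lebesgue. f y = f' y" "AE y in lebesgue. g y = g' y"
    and "f \<in> L2" "f' \<in> L2" "g \<in> L2" "g' \<in> L2"
  shows "L2_inner f g = L2_inner f' g'"
  unfolding L2_inner_def
  by (rule integral_cong_AE)
     (use assms L2_inner_integrable in \<open>auto intro: borel_measurable_integrable\<close>)

lemma L2_norm_sq_add:
  assumes "f \<in> L2" "g \<in> L2"
  shows "(L2_norm (\<lambda>y. f y + g y))\<^sup>2 = (L2_norm f)\<^sup>2 + (L2_norm g)\<^sup>2 + 2 * Re (L2_inner f g)"
proof -
  have "of_real ((L2_norm (\<lambda>y. f y + g y))\<^sup>2)
      = of_real ((L2_norm f)\<^sup>2) + of_real ((L2_norm g)\<^sup>2) + (L2_inner f g + cnj (L2_inner f g))"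
    using assms by (simp only: L2_inner_self [symmetric] L2_inner_commute[of g f, symmetric])
      (simp add: L2_inner_add_left L2_inner_add_right L2_add algebra_simps)
  from arg_cong[OF this, of Re] show ?thesis
    by simp
qed

lemma L2_norm_cmult_sq: "(L2_norm (\<lambda>y. c * f y))\<^sup>2 = (cmod c)\<^sup>2 * (L2_norm f)\<^sup>2"
  by (simp add: L2_norm_sq norm_mult power_mult_distrib)

lemma L2_norm_sq_diff:
  assumes "f \<in> L2" "g \<in> L2"
  shows "(L2_norm (\<lambda>y. f y - g y))\<^sup>2 = (L2_norm f)\<^sup>2 + (L2_norm g)\<^sup>2 - 2 * Re (L2_inner f g)"
  using L2_norm_sq_add[OF assms(1) L2_cmult[OF assms(2), of "-1"]] L2_norm_cmult_sq[of "-1" g]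
    L2_inner_cmult_right[of f "-1" g] by simp

lemma L2_norm_eq_0_AE:
  assumes "f \<in> L2" "L2_norm f = 0"
  shows "AE y in lebesgue. f y = 0"
proof -
  have "(LINT y|lebesgue. (cmod (f y))\<^sup>2) = 0"
    using assms(2) by (simp flip: L2_norm_sq)
  hence "AE y in lebesgue. (cmod (f y))\<^sup>2 = 0"
    using integral_nonneg_eq_0_iff_AE[OF L2_integrable_sq[OF assms(1)]] by simp
  thus ?thesis by simp
qed

text \<open>
  Pythagoras for the orthogonal projection of \<open>f\<close> to the line spanned by \<open>g\<close>; for a null function \<open>g\<close> both divisions give zero.
\<close>

lemma L2_norm_sq_residue:
  assumes "f \<in> L2" "g \<in> L2"
  shows "(L2_norm (\<lambda>y. f y - L2_inner f g / of_real ((L2_norm g)\<^sup>2) * g y))\<^sup>2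
    = (L2_norm f)\<^sup>2 - (cmod (L2_inner f g))\<^sup>2 / (L2_norm g)\<^sup>2"
proof -
  define s where "s = L2_inner f g"
  define q where "q = (L2_norm g)\<^sup>2"
  have "Re (cnj (s / of_real q) * s) = (cmod s)\<^sup>2 / q"
    unfolding cmod_power2 by (simp add: power2_eq_square add_divide_distrib)
  moreover have "(cmod (s / of_real q))\<^sup>2 * q = (cmod s)\<^sup>2 / q"
    by (simp add: norm_divide power_divide power2_eq_square)
  moreover have "(L2_norm (\<lambda>y. f y - s / of_real q * g y))\<^sup>2
      = (L2_norm f)\<^sup>2 + (cmod (s / of_real q))\<^sup>2 * q - 2 * Re (cnj (s / of_real q) * s)"
    unfolding L2_norm_sq_diff[OF assms(1) L2_cmult[OF assms(2)]] L2_norm_cmult_sq L2_inner_cmult_right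
    by (simp add: s_def q_def)
  ultimately show ?thesis unfolding s_def[symmetric] q_def[symmetric] by linarith
qed

lemma L2_Cauchy_Schwarz:
  assumes "f \<in> L2" "g \<in> L2"
  shows "(cmod (L2_inner f g))\<^sup>2 \<le> (L2_norm f)\<^sup>2 * (L2_norm g)\<^sup>2"
proof (cases "L2_norm g = 0")
  case True
  have "L2_inner f g = L2_inner f (\<lambda>y. 0)"
    using assms L2_norm_eq_0_AE[OF assms(2) True] by (intro L2_inner_cong_AE) (auto simp: L2_zero)
  thus ?thesis by (simp add: L2_inner_def)
next
  case False
  have "0 \<le> (L2_norm f)\<^sup>2 - (cmod (L2_inner f g))\<^sup>2 / (L2_norm g)\<^sup>2"
    unfolding L2_norm_sq_residue[OF assms, symmetric] by simp
  thus ?thesis using False by (simp add: field_simps)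
qed

text \<open>
  The Riesz--Fischer theorem.  Along a subsequence whose consecutive differences \<open>D\<^sub>k\<close> satisfy
  \<open>\<parallel>D\<^sub>k\<parallel>\<^sup>2 < 16\<^sup>-\<^sup>k\<close>, the function \<open>\<Sum>\<^sub>k 4\<^sup>k |D\<^sub>k|\<^sup>2\<close> is integrable, so \<open>|D\<^sub>k| \<le> 2\<^sup>-\<^sup>k\<close> eventually at almost
  every point and the subsequence converges almost everywhere.  Fatou's lemma turns the pointwise limit
  into a limit in the mean.
\<close>

lemma L2_complete:
  assumes F: "\<And>n. F n \<in> L2"
    and Cauchy: "\<And>e. e > 0 \<Longrightarrow> \<exists>M. \<forall>m\<ge>M. \<forall>n\<ge>M. (L2_norm (\<lambda>y. F m y - F n y))\<^sup>2 < e"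
  shows "\<exists>f\<in>L2. (\<lambda>n. (L2_norm (\<lambda>y. F n y - f y))\<^sup>2) \<longlonglongrightarrow> 0"
proof -
  note [measurable] = L2_measurable[OF F]
  have ennN: "(\<integral>\<^sup>+y. ennreal ((cmod (g y))\<^sup>2) \<partial>lebesgue) = ennreal ((L2_norm g)\<^sup>2)" if "g \<in> L2" for g
    unfolding L2_norm_sq by (rule nn_integral_eq_integral) (use that in \<open>auto simp: L2_integrable_sq\<close>)
  have "\<exists>M. \<forall>k::nat. \<forall>m\<ge>M k. \<forall>n\<ge>M k. (L2_norm (\<lambda>y. F m y - F n y))\<^sup>2 < (1/16)^k"
    using Cauchy by (intro choice) simp
  then obtain M where M: "\<And>k m n. m \<ge> M k \<Longrightarrow> n \<ge> M k \<Longrightarrow> (L2_norm (\<lambda>y. F m y - F n y))\<^sup>2 < (1/16::real)^k"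
    by blast
  \<comment> \<open>The summand \<open>k\<close> makes \<open>r\<close> unbounded; the sum dominates each \<open>M i\<close> with \<open>i \<le> k\<close>.\<close>
  define r where "r k = (\<Sum>i\<le>k. M i) + k" for k
  have r_ge: "r k \<ge> M k" "r (Suc k) \<ge> M k" "r k \<ge> k" for k
    using member_le_sum[of k "{..k}" M] by (auto simp: r_def)
  define D where "D k y = F (r (Suc k)) y - F (r k) y" for k y
  have DL2: "D k \<in> L2" for k
    unfolding D_def by (intro L2_diff F)
  have [measurable]: "D k \<in> borel_measurable lebesgue" for k
    using DL2 by (rule L2_measurable)
  have "(\<integral>\<^sup>+y. (\<Sum>k. ennreal (4 ^ k * (cmod (D k y))\<^sup>2)) \<partial>lebesgue)
      = (\<Sum>k. \<integral>\<^sup>+y. ennreal (4 ^ k * (cmod (D k y))\<^sup>2) \<partial>lebesgue)"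
    by (rule nn_integral_suminf) measurable
  also have "\<dots> = (\<Sum>k. ennreal (4 ^ k * (L2_norm (D k))\<^sup>2))"
    by (intro suminf_cong) (simp add: ennreal_mult nn_integral_cmult ennN[OF DL2])
  also have "\<dots> \<le> (\<Sum>k. ennreal ((1/4) ^ k))"
  proof (intro suminf_le ennreal_leI)
    fix k :: nat
    have "4 ^ k * (L2_norm (D k))\<^sup>2 \<le> 4 ^ k * (1/16) ^ k"
      unfolding D_def by (intro mult_left_mono less_imp_le M r_ge) auto
    also have "\<dots> = (1/4::real) ^ k"
      by (simp flip: power_mult_distrib)
    finally show "4 ^ k * (L2_norm (D k))\<^sup>2 \<le> (1/4) ^ k" .
  qed auto
  also have "\<dots> = ennreal (\<Sum>k. (1/4) ^ k)"
    by (intro suminf_ennreal2) (auto intro: summable_geometric)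
  finally have "(\<integral>\<^sup>+y. (\<Sum>k. ennreal (4 ^ k * (cmod (D k y))\<^sup>2)) \<partial>lebesgue) \<noteq> \<infinity>"
    by (auto simp: top_unique)
  hence "AE y in lebesgue. (\<Sum>k. ennreal (4 ^ k * (cmod (D k y))\<^sup>2)) \<noteq> \<infinity>"
    by (intro nn_integral_PInf_AE) auto
  hence conv: "AE y in lebesgue. convergent (\<lambda>k. F (r k) y)"
  proof eventually_elim
    case (elim y)
    have "summable (\<lambda>k. 4 ^ k * (cmod (D k y))\<^sup>2)"
      using elim by (intro summable_suminf_not_top) auto
    hence "(\<lambda>k. 4 ^ k * (cmod (D k y))\<^sup>2) \<longlonglongrightarrow> 0"
      by (rule summable_LIMSEQ_zero)
    hence "eventually (\<lambda>k. 4 ^ k * (cmod (D k y))\<^sup>2 < 1) sequentially"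
      by (rule order_tendstoD) simp
    hence "eventually (\<lambda>k. norm (D k y) \<le> (1/2) ^ k) sequentially"
    proof eventually_elim
      case (elim k)
      have "(2 ^ k * cmod (D k y))\<^sup>2 < 1"
        using elim by (simp add: power_mult_distrib flip: power_mult)
          (simp add: power_mult mult.commute[of k])
      hence "2 ^ k * cmod (D k y) < 1"
        by (simp add: power_less_one_iff abs_square_less_1)
      thus ?case
        by (simp add: field_simps)
    qed
    hence "summable (\<lambda>k. D k y)"
      by (rule summable_comparison_test_ev) (auto intro: summable_geometric)
    hence "convergent (\<lambda>k. F (r k) y - F (r 0) y)"
      unfolding summable_iff_convergent D_def using sum_lessThan_telescope[of "\<lambda>k. F (r k) y"] by simp
    from convergent_add[OF this convergent_const[of "F (r 0) y"]] show ?case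
      by simp
  qed
  define f where "f y = lim (\<lambda>k. F (r k) y)" for y
  have [measurable]: "f \<in> borel_measurable lebesgue"
    unfolding f_def by measurable
  have lim: "AE y in lebesgue. (\<lambda>k. F (r k) y) \<longlonglongrightarrow> f y"
    using conv by eventually_elim (simp add: f_def convergent_LIMSEQ_iff)
  have bound: "(\<integral>\<^sup>+y. ennreal ((cmod (F n y - f y))\<^sup>2) \<partial>lebesgue) \<le> ennreal e"
    if e: "e > 0" and M: "\<forall>m\<ge>M. \<forall>n\<ge>M. (L2_norm (\<lambda>y. F m y - F n y))\<^sup>2 < e" and "n \<ge> M" for n e M
  proof -
    have "(\<integral>\<^sup>+y. ennreal ((cmod (F n y - f y))\<^sup>2) \<partial>lebesgue)
        = (\<integral>\<^sup>+y. liminf (\<lambda>k. ennreal ((cmod (F n y - F (r k) y))\<^sup>2)) \<partial>lebesgue)"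
    proof (rule nn_integral_cong_AE, use lim in eventually_elim)
      case (elim y)
      have "(\<lambda>k. ennreal ((cmod (F n y - F (r k) y))\<^sup>2)) \<longlonglongrightarrow> ennreal ((cmod (F n y - f y))\<^sup>2)"
        by (intro tendsto_ennrealI tendsto_intros elim)
      from lim_imp_Liminf[OF _ this] show ?case
        by simp
    qed
    also have "\<dots> \<le> liminf (\<lambda>k. \<integral>\<^sup>+y. ennreal ((cmod (F n y - F (r k) y))\<^sup>2) \<partial>lebesgue)"
      by (rule nn_integral_liminf) measurable
    also have "\<dots> \<le> ennreal e"
    proof (rule Liminf_le)
      show "eventually (\<lambda>k. (\<integral>\<^sup>+y. ennreal ((cmod (F n y - F (r k) y))\<^sup>2) \<partial>lebesgue) \<le> ennreal e) sequentially"
        using eventually_ge_at_top[of M]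
      proof eventually_elim
        case (elim k)
        have "r k \<ge> M" using elim r_ge(3)[of k] by linarith
        hence "(L2_norm (\<lambda>y. F n y - F (r k) y))\<^sup>2 \<le> e"
          using M that(3) by (auto intro: less_imp_le)
        thus ?case
          by (subst ennN) (auto intro: L2_diff F ennreal_leI)
      qed
    qed simp
    finally show ?thesis .
  qed
  have diffL2: "(\<lambda>y. F n y - f y) \<in> L2"
    if e: "e > 0" and M: "\<forall>m\<ge>M. \<forall>n\<ge>M. (L2_norm (\<lambda>y. F m y - F n y))\<^sup>2 < e" and "n \<ge> M" for n e M
  proof -
    have "integrable lebesgue (\<lambda>y. (cmod (F n y - f y))\<^sup>2)"
      by (rule integrableI_bounded) (use bound[OF that] in \<open>auto simp: less_top[symmetric] top_unique\<close>)
    thus ?thesis by (auto simp: L2_def)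
  qed
  have fL2: "f \<in> L2"
  proof -
    obtain M where M: "\<forall>m\<ge>M. \<forall>n\<ge>M. (L2_norm (\<lambda>y. F m y - F n y))\<^sup>2 < 1"
      using Cauchy[of 1] by auto
    have "(\<lambda>y. F M y - (F M y - f y)) \<in> L2"
      by (intro L2_diff[OF F diffL2[of 1 M M]]) (use M in auto)
    thus ?thesis by simp
  qed
  moreover have "(\<lambda>n. (L2_norm (\<lambda>y. F n y - f y))\<^sup>2) \<longlonglongrightarrow> 0"
  proof (rule LIMSEQ_I)
    fix e :: real assume "e > 0"
    then obtain M where M: "\<forall>m\<ge>M. \<forall>n\<ge>M. (L2_norm (\<lambda>y. F m y - F n y))\<^sup>2 < e/2"
      using Cauchy[of "e/2"] by auto
    have "norm ((L2_norm (\<lambda>y. F n y - f y))\<^sup>2 - 0) < e" if "n \<ge> M" for n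
    proof -
      have "(L2_norm (\<lambda>y. F n y - f y))\<^sup>2 \<le> e/2"
        using bound[OF _ M that] \<open>e > 0\<close> ennN[OF L2_diff[OF F fL2]] by simp
      thus ?thesis using \<open>e > 0\<close> by simp
    qed
    thus "\<exists>no. \<forall>n\<ge>no. norm ((L2_norm (\<lambda>y. F n y - f y))\<^sup>2 - 0) < e" by blast
  qed
  ultimately show ?thesis by blast
qed

section \<open>Nonreal points belong to the resolvent set of a self-adjoint operator\<close>

lemma adjoint_opD:
  assumes "(f, g) \<in> adjoint_op T"
  shows "f \<in> L2" "g \<in> L2" "\<And>u v. (u, v) \<in> T \<Longrightarrow> L2_inner v f = L2_inner u g"
  using assms by (auto simp: adjoint_op_def)

lemma adjoint_opI:
  assumes "f \<in> L2" "g \<in> L2" "\<And>u v. (u, v) \<in> T \<Longrightarrow> L2_inner v f = L2_inner u g"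
  shows "(f, g) \<in> adjoint_op T"
  using assms by (auto simp: adjoint_op_def)

lemma adjoint_op_lincomb:
  assumes "T \<subseteq> L2 \<times> L2" "(f, g) \<in> adjoint_op T" "(f', g') \<in> adjoint_op T"
  shows "((\<lambda>y. a * f y + b * f' y), (\<lambda>y. a * g y + b * g' y)) \<in> adjoint_op T"
proof (rule adjoint_opI)
  show "(\<lambda>y. a * f y + b * f' y) \<in> L2" "(\<lambda>y. a * g y + b * g' y) \<in> L2"
    using assms by (auto intro!: L2_add L2_cmult dest: adjoint_opD)
  fix u v assume uv: "(u, v) \<in> T"
  show "L2_inner v (\<lambda>y. a * f y + b * f' y) = L2_inner u (\<lambda>y. a * g y + b * g' y)"
    using uv assms(1) adjoint_opD[OF assms(2)] adjoint_opD[OF assms(3)]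
    by (subst (1 2) L2_inner_add_right) (auto intro!: L2_cmult simp: L2_inner_cmult_right)
qed

lemma L2_inner_limit:
  assumes "\<And>n. F n \<in> L2" "f \<in> L2" "u \<in> L2" "(\<lambda>n. (L2_norm (\<lambda>y. F n y - f y))\<^sup>2) \<longlonglongrightarrow> 0"
  shows "(\<lambda>n. L2_inner u (F n)) \<longlonglongrightarrow> L2_inner u f"
proof -
  have "(\<lambda>n. (cmod (L2_inner u (F n) - L2_inner u f))\<^sup>2) \<longlonglongrightarrow> 0"
  proof (rule tendsto_sandwich[OF _ _ tendsto_const])
    show "(\<lambda>n. (L2_norm u)\<^sup>2 * (L2_norm (\<lambda>y. F n y - f y))\<^sup>2) \<longlonglongrightarrow> 0"
      using tendsto_mult_left[OF assms(4), of "(L2_norm u)\<^sup>2"] by simp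
    show "\<forall>\<^sub>F n in sequentially. (cmod (L2_inner u (F n) - L2_inner u f))\<^sup>2
        \<le> (L2_norm u)\<^sup>2 * (L2_norm (\<lambda>y. F n y - f y))\<^sup>2"
      using L2_Cauchy_Schwarz[OF assms(3) L2_diff[OF assms(1,2)]] assms
      by (simp add: L2_inner_diff_right)
  qed simp
  hence "(\<lambda>n. cmod (L2_inner u (F n) - L2_inner u f)) \<longlonglongrightarrow> 0"
    using tendsto_real_sqrt by fastforce
  thus ?thesis
    using LIM_zero_cancel tendsto_norm_zero_iff by blast
qed

lemma adjoint_op_closed:
  assumes "T \<subseteq> L2 \<times> L2" and FG: "\<And>n. (F n, G n) \<in> adjoint_op T" and "f \<in> L2" "g \<in> L2"
    and "(\<lambda>n. (L2_norm (\<lambda>y. F n y - f y))\<^sup>2) \<longlonglongrightarrow> 0" "(\<lambda>n. (L2_norm (\<lambda>y. G n y - g y))\<^sup>2) \<longlonglongrightarrow> 0"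
  shows "(f, g) \<in> adjoint_op T"
proof (rule adjoint_opI)
  fix u v assume uv: "(u, v) \<in> T"
  have "(\<lambda>n. L2_inner v (F n)) \<longlonglongrightarrow> L2_inner v f" "(\<lambda>n. L2_inner u (G n)) \<longlonglongrightarrow> L2_inner u g"
    using assms uv by (auto intro!: L2_inner_limit dest: adjoint_opD)
  moreover have "L2_inner v (F n) = L2_inner u (G n)" for n
    using adjoint_opD(3)[OF FG uv] .
  ultimately show "L2_inner v f = L2_inner u g"
    using LIMSEQ_unique by auto
qed (use assms in auto)

text \<open>
  In a minimal-distance argument, optimality of \<open>e\<close> along the complex line spanned by \<open>w\<close>
  is orthogonality.
\<close>

lemma L2_minimal_orthogonal:
  assumes "e \<in> L2" "w \<in> L2" and min: "\<And>c. (L2_norm e)\<^sup>2 \<le> (L2_norm (\<lambda>y. e y - c * w y))\<^sup>2"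
  shows "L2_inner w e = 0"
proof -
  have "(L2_norm e)\<^sup>2 \<le> (L2_norm e)\<^sup>2 - (cmod (L2_inner e w))\<^sup>2 / (L2_norm w)\<^sup>2"
    using min[of "L2_inner e w / of_real ((L2_norm w)\<^sup>2)"] unfolding L2_norm_sq_residue[OF assms(1,2)] .
  hence "(cmod (L2_inner e w))\<^sup>2 \<le> 0"
    using L2_Cauchy_Schwarz[OF assms(1,2)] by (cases "L2_norm w = 0") (auto simp: divide_le_0_iff)
  thus ?thesis
    by (simp add: L2_inner_commute[of w e])
qed

locale selfadjoint_op =
  fixes T :: operator
  assumes adj: "adjoint_op T = T"
begin

lemma subset_L2: "T \<subseteq> L2 \<times> L2"
  using adj by (auto simp: adjoint_op_def)

lemma inL2: "(f, g) \<in> T \<Longrightarrow> f \<in> L2 \<and> g \<in> L2"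
  using subset_L2 by auto

lemma lincomb: "(f, g) \<in> T \<Longrightarrow> (f', g') \<in> T \<Longrightarrow>
    ((\<lambda>y. a * f y + b * f' y), (\<lambda>y. a * g y + b * g' y)) \<in> T"
  using adjoint_op_lincomb[OF subset_L2, unfolded adj] by blast

lemma symmetric: "(u, v) \<in> T \<Longrightarrow> (f, g) \<in> T \<Longrightarrow> L2_inner v f = L2_inner u g"
  using adjoint_opD(3)[of f g T] adj by auto

text \<open>For \<open>z = \<plusminus>\<i>\<close> the cross term of \<open>\<parallel>g - z f\<parallel>\<^sup>2\<close> vanishes by symmetry.\<close>

lemma norm_sq_shift:
  assumes "(f, g) \<in> T" "z = \<i> \<or> z = -\<i>"
  shows "(L2_norm (\<lambda>y. g y - z * f y))\<^sup>2 = (L2_norm g)\<^sup>2 + (L2_norm f)\<^sup>2"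
proof -
  have "cnj (L2_inner g f) = L2_inner g f"
    using symmetric[OF assms(1,1)] L2_inner_commute[of f g] by simp
  hence "Im (L2_inner g f) = 0"
    by (metis Reals_cnj_iff complex_is_Real_iff)
  thus ?thesis
    using inL2[OF assms(1)] assms(2)
    by (auto simp: L2_norm_sq_diff L2_cmult L2_norm_cmult_sq L2_inner_cmult_right)
qed

text \<open>
  The range of \<open>T - z\<close> is closed by the identity above, so \<open>h\<close> has a nearest point \<open>g - z f\<close> in it.  The
  error is orthogonal to the range, hence an eigenvector of \<open>T\<^sup>* = T\<close> for \<open>cnj z\<close>, and a symmetric operator has no
  nonreal eigenvalue.
\<close>

lemma surjective_shift:
  assumes z: "z = \<i> \<or> z = -\<i>" and h: "h \<in> L2"
  shows "\<exists>f g. (f, g) \<in> T \<and> (AE y in lebesgue. h y = g y - z * f y)"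
proof -
  define N where "N p = (L2_norm (\<lambda>y. h y - (snd p y - z * fst p y)))\<^sup>2" for p :: "wave \<times> wave"
  define d where "d = (INF p\<in>T. N p)"
  have N0: "N p \<ge> 0" for p by (simp add: N_def)
  have "((\<lambda>y. 0), (\<lambda>y. 0)) \<in> adjoint_op T"
    by (rule adjoint_opI) (auto simp: L2_zero L2_inner_def)
  hence Tne: "T \<noteq> {}" using adj by auto
  have bdd: "bdd_below (N ` T)" using N0 by (auto intro!: bdd_belowI)
  have dle: "d \<le> N p" if "p \<in> T" for p
    unfolding d_def using bdd that by (rule cINF_lower)
  have "\<exists>p\<in>T. N p < d + 1 / real (Suc n)" for n
    using cINF_less_iff[OF Tne bdd, of "d + 1 / real (Suc n)"] by (auto simp: d_def)
  then obtain P where P: "\<And>n. P n \<in> T" "\<And>n. N (P n) < d + 1 / real (Suc n)"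
    by metis
  define F where "F n = fst (P n)" for n
  define G where "G n = snd (P n)" for n
  have FG: "(F n, G n) \<in> T" for n using P by (simp add: F_def G_def)
  have L: "F n \<in> L2" "G n \<in> L2" for n using inL2[OF FG] by auto
  define e where "e n = (\<lambda>y. h y - (G n y - z * F n y))" for n
  have eL: "e n \<in> L2" for n unfolding e_def by (intro L2_diff L2_cmult h L)
  have Ne: "(L2_norm (e n))\<^sup>2 < d + 1 / real (Suc n)" for n
    using P(2)[of n] by (simp add: N_def e_def F_def G_def)
  \<comment> \<open>The parallelogram identity: the midpoint of two nearly optimal points is no better than \<open>d\<close>.\<close>
  have par: "(L2_norm (\<lambda>y. F m y - F n y))\<^sup>2 + (L2_norm (\<lambda>y. G m y - G n y))\<^sup>2
      \<le> 2 / real (Suc m) + 2 / real (Suc n)" for m n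
  proof -
    have Td: "((\<lambda>y. F m y - F n y), (\<lambda>y. G m y - G n y)) \<in> T"
      using lincomb[OF FG[of m] FG[of n], of 1 "-1"] by simp
    have Tm: "((\<lambda>y. F m y / 2 + F n y / 2), (\<lambda>y. G m y / 2 + G n y / 2)) \<in> T"
      using lincomb[OF FG[of m] FG[of n], of "1/2" "1/2"] by simp
    have "(L2_norm (\<lambda>y. G m y - G n y))\<^sup>2 + (L2_norm (\<lambda>y. F m y - F n y))\<^sup>2
       = (L2_norm (\<lambda>y. (G m y - G n y) - z * (F m y - F n y)))\<^sup>2"
      using norm_sq_shift[OF Td z] by simp
    also have "(\<lambda>y. (G m y - G n y) - z * (F m y - F n y)) = (\<lambda>y. e n y - e m y)"
      by (auto simp: e_def algebra_simps)
    also have "(L2_norm (\<lambda>y. e n y - e m y))\<^sup>2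
        = 2 * (L2_norm (e n))\<^sup>2 + 2 * (L2_norm (e m))\<^sup>2 - (L2_norm (\<lambda>y. e n y + e m y))\<^sup>2"
      using eL by (simp add: L2_norm_sq_diff L2_norm_sq_add)
    also have "(\<lambda>y. e n y + e m y)
        = (\<lambda>y. 2 * (h y - ((G m y / 2 + G n y / 2) - z * (F m y / 2 + F n y / 2))))"
      by (auto simp: e_def algebra_simps)
    also have "(L2_norm \<dots>)\<^sup>2 = 4 * N ((\<lambda>y. F m y / 2 + F n y / 2), (\<lambda>y. G m y / 2 + G n y / 2))"
      by (subst L2_norm_cmult_sq) (simp add: N_def)
    finally show ?thesis
      using Ne[of m] Ne[of n] dle[OF Tm] by simp
  qed
  have Cauchy: "\<exists>M. \<forall>m\<ge>M. \<forall>n\<ge>M. (L2_norm (\<lambda>y. A m y - A n y))\<^sup>2 < \<epsilon>"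
    if "\<epsilon> > 0" and A: "A = F \<or> A = G" for A :: "nat \<Rightarrow> wave" and \<epsilon> :: real
  proof -
    obtain M :: nat where M: "4 / \<epsilon> < real M"
      using reals_Archimedean2 by blast
    have "(L2_norm (\<lambda>y. A m y - A n y))\<^sup>2 < \<epsilon>" if "m \<ge> M" "n \<ge> M" for m n
    proof -
      have *: "2 / real (Suc k) < \<epsilon> / 2" if "k \<ge> M" for k
      proof -
        have "4 / \<epsilon> < real (Suc k)" using M that by linarith
        thus ?thesis using \<open>\<epsilon> > 0\<close> by (simp add: field_simps)
      qed
      have "(L2_norm (\<lambda>y. A m y - A n y))\<^sup>2 \<le> 2 / real (Suc m) + 2 / real (Suc n)"
        using A par[of m n] zero_le_power2[of "L2_norm (\<lambda>y. F m y - F n y)"]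
          zero_le_power2[of "L2_norm (\<lambda>y. G m y - G n y)"]
        by (elim disjE; simp only:; linarith)
      thus ?thesis using *[OF \<open>m \<ge> M\<close>] *[OF \<open>n \<ge> M\<close>] by linarith
    qed
    thus ?thesis by blast
  qed
  obtain f where f: "f \<in> L2" "(\<lambda>n. (L2_norm (\<lambda>y. F n y - f y))\<^sup>2) \<longlonglongrightarrow> 0"
    using L2_complete[of F, OF L(1) Cauchy] by blast
  obtain g where g: "g \<in> L2" "(\<lambda>n. (L2_norm (\<lambda>y. G n y - g y))\<^sup>2) \<longlonglongrightarrow> 0"
    using L2_complete[of G, OF L(2) Cauchy] by blast
  have fg: "(f, g) \<in> T"
    using adjoint_op_closed[OF subset_L2, unfolded adj, OF FG f(1) g(1) f(2) g(2)] .
  define r where "r = (\<lambda>y. h y - (g y - z * f y))"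
  have rL: "r \<in> L2" unfolding r_def by (intro L2_diff L2_cmult h f g)
  have Nr: "(L2_norm r)\<^sup>2 \<le> d"
  proof -
    have lim: "(\<lambda>n. L2_inner w (e n)) \<longlonglongrightarrow> L2_inner w r" if "w \<in> L2" for w
    proof -
      have "(\<lambda>n. L2_inner w (F n)) \<longlonglongrightarrow> L2_inner w f" "(\<lambda>n. L2_inner w (G n)) \<longlonglongrightarrow> L2_inner w g"
        using f g L that by (auto intro!: L2_inner_limit)
      hence "(\<lambda>n. L2_inner w h - (L2_inner w (G n) - cnj z * L2_inner w (F n)))
          \<longlonglongrightarrow> L2_inner w h - (L2_inner w g - cnj z * L2_inner w f)"
        by (intro tendsto_intros)
      thus ?thesis
        using that h f g L by (simp add: e_def r_def L2_inner_diff_right L2_inner_cmult_right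
            L2_diff L2_cmult)
    qed
    \<comment> \<open>Weak lower semicontinuity of the norm.\<close>
    have "(\<lambda>n. (cmod (L2_inner r (e n)))\<^sup>2) \<longlonglongrightarrow> (cmod (L2_inner r r))\<^sup>2"
      by (intro tendsto_intros lim rL)
    moreover have "(\<lambda>n. (L2_norm r)\<^sup>2 * (d + 1 / real (Suc n))) \<longlonglongrightarrow> (L2_norm r)\<^sup>2 * (d + 0)"
      by (intro tendsto_intros LIMSEQ_Suc lim_1_over_n)
    moreover have "(cmod (L2_inner r (e n)))\<^sup>2 \<le> (L2_norm r)\<^sup>2 * (d + 1 / real (Suc n))" for n
      using L2_Cauchy_Schwarz[OF rL eL[of n]] mult_left_mono[OF less_imp_le[OF Ne[of n]], of "(L2_norm r)\<^sup>2"]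
      by simp
    ultimately have "(cmod (L2_inner r r))\<^sup>2 \<le> (L2_norm r)\<^sup>2 * (d + 0)"
      by (blast intro: LIMSEQ_le)
    hence "(L2_norm r)\<^sup>2 * (L2_norm r)\<^sup>2 \<le> (L2_norm r)\<^sup>2 * d"
      by (simp only: L2_inner_self norm_of_real) (simp add: power2_eq_square [of "(L2_norm r)\<^sup>2"])
    moreover have "d \<ge> 0"
      unfolding d_def using Tne N0 by (intro cINF_greatest)
    ultimately show ?thesis
      using mult_left_le_imp_le[of "(L2_norm r)\<^sup>2" "(L2_norm r)\<^sup>2" d]
      by (cases "L2_norm r = 0") auto
  qed
  have orth: "L2_inner (\<lambda>y. v y - z * u y) r = 0" if uv: "(u, v) \<in> T" for u v
  proof (rule L2_minimal_orthogonal[OF rL])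
    show "(\<lambda>y. v y - z * u y) \<in> L2" using inL2[OF uv] by (auto intro: L2_diff L2_cmult)
    fix c
    have "((\<lambda>y. f y + c * u y), (\<lambda>y. g y + c * v y)) \<in> T"
      using lincomb[OF fg uv, of 1 c] by simp
    from dle[OF this] have "d \<le> (L2_norm (\<lambda>y. h y - ((g y + c * v y) - z * (f y + c * u y))))\<^sup>2"
      by (simp add: N_def)
    also have "(\<lambda>y. h y - ((g y + c * v y) - z * (f y + c * u y))) = (\<lambda>y. r y - c * (v y - z * u y))"
      by (auto simp: r_def algebra_simps)
    finally show "(L2_norm r)\<^sup>2 \<le> (L2_norm (\<lambda>y. r y - c * (v y - z * u y)))\<^sup>2"
      using Nr by linarith
  qed
  \<comment> \<open>So the residue is an eigenvector of \<open>T\<^sup>* = T\<close> for the nonreal number \<open>cnj z\<close>.\<close>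
  have "(r, (\<lambda>y. cnj z * r y)) \<in> adjoint_op T"
  proof (rule adjoint_opI)
    fix u v assume uv: "(u, v) \<in> T"
    show "L2_inner v r = L2_inner u (\<lambda>y. cnj z * r y)"
      using orth[OF uv] inL2[OF uv] rL
      by (simp add: L2_inner_diff_left L2_inner_cmult_left L2_inner_cmult_right L2_cmult)
  qed (use rL in \<open>auto intro: L2_cmult\<close>)
  hence "(r, (\<lambda>y. cnj z * r y)) \<in> T" by (simp add: adj)
  from symmetric[OF this this] have "cnj z * L2_inner r r = z * L2_inner r r"
    by (simp add: L2_inner_cmult_left L2_inner_cmult_right)
  hence "L2_norm r = 0"
    using z by (auto simp: L2_inner_self complex_eq_iff)
  hence "AE y in lebesgue. r y = 0"
    by (rule L2_norm_eq_0_AE[OF rL])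
  hence "AE y in lebesgue. h y = g y - z * f y"
    by eventually_elim (simp add: r_def)
  thus ?thesis using fg by blast
qed

lemma imaginary_unit_in_resolvent_set:
  assumes z: "z = \<i> \<or> z = -\<i>"
  shows "z \<in> resolvent_set T"
proof -
  have "\<exists>f. (h, f) \<in> resolvent T z" if "h \<in> L2" for h
    using surjective_shift[OF z that] that by (auto simp: resolvent_def)
  moreover have "L2_norm f \<le> 1 * L2_norm h" if hf: "(h, f) \<in> resolvent T z" for h f
  proof -
    obtain g where g: "h \<in> L2" "(f, g) \<in> T" "AE y in lebesgue. h y = g y - z * f y"
      using hf unfolding resolvent_def by blast
    have L: "(\<lambda>y. g y - z * f y) \<in> L2" using inL2[OF g(2)] by (auto intro: L2_diff L2_cmult)
    have "of_real ((L2_norm h)\<^sup>2) = (of_real ((L2_norm (\<lambda>y. g y - z * f y))\<^sup>2) :: complex)"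
      unfolding L2_inner_self [symmetric] using g L by (intro L2_inner_cong_AE) auto
    hence "(L2_norm h)\<^sup>2 = (L2_norm (\<lambda>y. g y - z * f y))\<^sup>2"
      using of_real_eq_iff by blast
    also have "\<dots> \<ge> (L2_norm f)\<^sup>2"
      using norm_sq_shift[OF g(2) z] by simp
    finally show ?thesis
      using L2_norm_nonneg[of h] by (simp add: power2_le_iff_abs_le)
  qed
  ultimately show ?thesis
    by (auto simp: resolvent_set_def intro!: exI[of _ 1])
qed

end

section \<open>Integration over three-dimensional space\<close>

subsection \<open>Lebesgue measurable functions and Borel representatives\<close>

lemma lebesgue_borel_representative:
  fixes f :: wave
  assumes "f \<in> borel_measurable lebesgue"
  obtains f' where "f' \<in> borel_measurable borel" "AE y in lborel. f y = f' y"
proof -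
  have "(\<lambda>y. Re (f y)) \<in> borel_measurable lebesgue" "(\<lambda>y. Im (f y)) \<in> borel_measurable lebesgue"
    using assms by measurable
  from this[THEN completion_ex_borel_measurable_real]
  obtain a b where ab: "a \<in> borel_measurable lborel" "b \<in> borel_measurable lborel"
    "AE y in lborel. Re (f y) = a y" "AE y in lborel. Im (f y) = b y"
    by (elim bexE)
  show ?thesis
  proof (rule that)
    show "(\<lambda>y. Complex (a y) (b y)) \<in> borel_measurable borel"
      using ab by (simp add: Complex_eq)
    show "AE y in lborel. f y = Complex (a y) (b y)"
      using ab(3,4) by eventually_elim (simp add: complex_eq_iff)
  qed
qed

lemma L2_borel_iff:
  assumes "f \<in> borel_measurable borel"
  shows "f \<in> L2 \<longleftrightarrow> integrable lborel (\<lambda>y. (cmod (f y))\<^sup>2)"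
proof -
  have "f \<in> borel_measurable lebesgue"
    using assms by (intro measurable_completion) simp
  moreover have "integrable lebesgue (\<lambda>y. (cmod (f y))\<^sup>2) \<longleftrightarrow> integrable lborel (\<lambda>y. (cmod (f y))\<^sup>2)"
    using assms by (intro integrable_completion) measurable
  ultimately show ?thesis
    by (simp add: L2_def)
qed

lemma L2_borel_representative:
  assumes "f \<in> L2"
  obtains f' where "f' \<in> borel_measurable borel" "f' \<in> L2" "AE y in lebesgue. f y = f' y"
proof -
  obtain f' where f': "f' \<in> borel_measurable borel" "AE y in lborel. f y = f' y"
    using lebesgue_borel_representative[OF L2_measurable[OF assms]] by blast
  have ae: "AE y in lebesgue. f y = f' y" using f'(2) by (rule AE_completion)
  have m: "f' \<in> borel_measurable lebesgue"
    using f'(1) by (intro measurable_completion) simp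
  have "integrable lebesgue (\<lambda>y. (cmod (f' y))\<^sup>2)"
    by (rule integrable_cong_AE_imp[OF L2_integrable_sq[OF assms]])
       (use m ae in \<open>auto elim: eventually_mono intro!: borel_measurable_power measurable_compose[OF _ borel_measurable_norm]\<close>)
  thus ?thesis using f' m ae by (intro that) (auto simp: L2_def)
qed

lemma integral_borel_representative:
  fixes k :: wave
  assumes "k \<in> borel_measurable borel" "q \<in> L2" "q' \<in> borel_measurable borel" "AE y in lebesgue. q y = q' y"
  shows "(LINT y|lebesgue. k y * q y) = (LINT y|lborel. k y * q' y)"
proof -
  note [measurable] = assms(1,3)
  have lm: "f \<in> borel_measurable lebesgue" if "f \<in> borel_measurable borel" for f :: wave
    using that by (intro measurable_completion) simp
  have "(LINT y|lebesgue. k y * q y) = (LINT y|lebesgue. k y * q' y)"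
    using assms(4) by (intro integral_cong_AE borel_measurable_times lm[OF assms(1)] lm[OF assms(3)] L2_measurable[OF assms(2)])
      (auto elim: eventually_mono)
  also have "\<dots> = (LINT y|lborel. k y * q' y)" by (rule integral_completion) measurable
  finally show ?thesis .
qed

subsection \<open>Translations\<close>

lemma lborel_integral_translate:
  fixes f :: "real^3 \<Rightarrow> 'b::{banach, second_countable_topology}"
  assumes "f \<in> borel_measurable borel"
  shows "(LINT y|lborel. f (y - c)) = (LINT y|lborel. f y)"
    and "integrable lborel (\<lambda>y. f (y - c)) \<longleftrightarrow> integrable lborel f"
proof -
  have *: "distr lborel borel (\<lambda>y::real^3. y - c) = lborel"
    using lborel_distr_plus[of "-c"] by (simp add: add.commute[of "-c"] cong: distr_cong)
  show "(LINT y|lborel. f (y - c)) = (LINT y|lborel. f y)"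
    by (subst (2) *[symmetric], subst integral_distr) (use assms in auto)
  show "integrable lborel (\<lambda>y. f (y - c)) \<longleftrightarrow> integrable lborel f"
    by (subst (2) *[symmetric], subst integrable_distr_eq) (use assms in auto)
qed

lemma lborel_integral_reflect:
  fixes f :: "real^3 \<Rightarrow> 'b::{banach, second_countable_topology}"
  assumes "f \<in> borel_measurable borel"
  shows "(LINT y|lborel. f (c - y)) = (LINT y|lborel. f y)"
    and "integrable lborel (\<lambda>y. f (c - y)) \<longleftrightarrow> integrable lborel f"
proof -
  have *: "distr lborel borel (\<lambda>y::real^3. c - y) = lborel"
    using lborel_affine[of "-1" c] by (simp add: density_1)
  show "(LINT y|lborel. f (c - y)) = (LINT y|lborel. f y)"
    by (subst (2) *[symmetric], subst integral_distr) (use assms in auto)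
  show "integrable lborel (\<lambda>y. f (c - y)) \<longleftrightarrow> integrable lborel f"
    by (subst (2) *[symmetric], subst integrable_distr_eq) (use assms in auto)
qed

lemma lborel_integral_scale:
  fixes f :: "real^3 \<Rightarrow> 'b::{banach, second_countable_topology}"
  assumes [measurable]: "f \<in> borel_measurable borel" and "e > 0"
  shows "(LINT y|lborel. f y) = (LINT t|lborel. e ^ 3 *\<^sub>R f (c + e *\<^sub>R t))"
  by (subst lborel_affine[of e c])
     (use \<open>e > 0\<close> in \<open>simp_all add: integral_density integral_distr\<close>)

lemma L2_translate:
  assumes "f \<in> borel_measurable borel" "f \<in> L2"
  shows "(\<lambda>y. f (y - c)) \<in> L2" "L2_norm (\<lambda>y. f (y - c)) = L2_norm f"
proof -
  have m: "(\<lambda>y. f (y - c)) \<in> borel_measurable borel" "(\<lambda>y. (cmod (f y))\<^sup>2) \<in> borel_measurable borel"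
    using assms(1) by measurable
  show L: "(\<lambda>y. f (y - c)) \<in> L2"
    using assms(2) lborel_integral_translate(2)[OF m(2), of c]
    by (simp add: L2_borel_iff[OF m(1)] L2_borel_iff[OF assms(1)])
  have "(LINT y|lebesgue. (cmod (f (y - c)))\<^sup>2) = (LINT y|lborel. (cmod (f (y - c)))\<^sup>2)"
    by (rule integral_completion) (use m(1) in measurable)
  also have "\<dots> = (LINT y|lborel. (cmod (f y))\<^sup>2)"
    by (rule lborel_integral_translate(1)[OF m(2)])
  also have "\<dots> = (LINT y|lebesgue. (cmod (f y))\<^sup>2)"
    by (rule integral_completion [symmetric]) (use m(2) in simp)
  finally show "L2_norm (\<lambda>y. f (y - c)) = L2_norm f"
    by (simp add: L2_norm_def)
qed

subsection \<open>Polar coordinates\<close>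

text \<open>
  Both measures give the ray up to \<open>r\<close> the volume \<open>4\<pi>r\<^sup>3/3\<close> of the ball of radius \<open>r\<close>.
\<close>

lemma distr_norm_lborel:
  "distr (lborel :: (real^3) measure) borel norm
     = density lborel (\<lambda>r. ennreal (4 * pi * r\<^sup>2) * indicator {0..} r)" (is "?M = ?N")
proof (rule measure_eqI_generator_eq)
  show "Int_stable (range (atMost :: real \<Rightarrow> _))"
    by (auto simp: Int_stable_def min_def)
  show "sets ?M = sigma_sets UNIV (range atMost)" "sets ?N = sigma_sets UNIV (range atMost)"
    by (simp_all add: borel_eq_atMost sets_borel)
  show "range (\<lambda>i. {..real i}) \<subseteq> range atMost" by auto
  show "(\<Union>i. {..real i}) = UNIV" using real_arch_simple by blast
  have eM: "emeasure ?M {..r} = ennreal (4 / 3 * pi * r ^ 3) * indicator {0..} r" for r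
  proof -
    have "emeasure ?M {..r} = emeasure lborel (norm -` {..r} :: (real^3) set)"
      by (subst emeasure_distr) auto
    also have "(norm -` {..r} :: (real^3) set) = (if r \<ge> 0 then cball 0 r else {})"
      by (auto simp: dist_norm intro: order_trans[OF norm_ge_zero])
    also have "emeasure lborel (if r \<ge> 0 then cball 0 r else {} :: (real^3) set)
        = ennreal (4 / 3 * pi * r ^ 3) * indicator {0..} r"
      by (simp add: emeasure_cball eval_unit_ball_vol field_simps power3_eq_cube)
    finally show ?thesis .
  qed
  show "emeasure ?M {..real i} \<noteq> \<infinity>" for i
    unfolding eM by (auto simp: ennreal_mult_eq_top_iff split: split_indicator)
  fix X :: "real set" assume "X \<in> range atMost"
  then obtain r where X: "X = {..r}" by auto
  have "emeasure ?N {..r} = (\<integral>\<^sup>+x. ennreal (4 * pi * x\<^sup>2) * indicator {0..} x * indicator {..r} x \<partial>lborel)"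
    by (subst emeasure_density) auto
  also have "\<dots> = (\<integral>\<^sup>+x. ennreal (4 * pi * x\<^sup>2) * indicator {0..r} x \<partial>lborel)"
    by (intro nn_integral_cong) (auto split: split_indicator)
  also have "\<dots> = ennreal (4 / 3 * pi * r ^ 3) * indicator {0..} r"
  proof (cases "r \<ge> 0")
    case True
    have "(\<integral>\<^sup>+x. ennreal (4 * pi * x\<^sup>2) * indicator {0..r} x \<partial>lborel)
        = ennreal (4 / 3 * pi * r ^ 3 - 4 / 3 * pi * 0 ^ 3)"
      by (rule nn_integral_FTC_Icc)
         (use True in \<open>auto intro!: derivative_eq_intros simp flip: has_real_derivative_iff_has_vector_derivative\<close>)
    thus ?thesis using True by simp
  qed auto
  finally show "emeasure ?M X = emeasure ?N X"
    unfolding X eM by simp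
qed auto

lemma nn_integral_radial:
  assumes [measurable]: "F \<in> borel_measurable borel"
  shows "(\<integral>\<^sup>+y. F (norm y) \<partial>(lborel :: (real^3) measure))
    = (\<integral>\<^sup>+r. ennreal (4 * pi * r\<^sup>2) * F r * indicator {0..} r \<partial>lborel)"
proof -
  have "(\<integral>\<^sup>+y. F (norm y) \<partial>(lborel :: (real^3) measure)) = (\<integral>\<^sup>+r. F r \<partial>distr (lborel :: (real^3) measure) borel norm)"
    by (subst nn_integral_distr) auto
  also have "\<dots> = (\<integral>\<^sup>+r. ennreal (4 * pi * r\<^sup>2) * indicator {0..} r * F r \<partial>lborel)"
    unfolding distr_norm_lborel by (subst nn_integral_density) auto
  finally show ?thesis
    by (simp add: mult_ac)
qed

text \<open>
  The factor \<open>r\<^sup>2\<close> of the volume element cancels the singularity.  All Green functions below are compared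
  with this function.
\<close>

lemma integrable_exp_over_square:
  assumes "c > 0"
  shows "integrable lborel (\<lambda>y::real^3. exp (- c * norm y) / (norm y)\<^sup>2)"
proof (rule integrableI_bounded)
  have "(\<integral>\<^sup>+y. ennreal (norm (exp (- c * norm y) / (norm y)\<^sup>2)) \<partial>(lborel :: (real^3) measure))
      = (\<integral>\<^sup>+r. ennreal (4 * pi * r\<^sup>2) * ennreal (exp (- c * r) / r\<^sup>2) * indicator {0..} r \<partial>lborel)"
    by (subst nn_integral_radial [symmetric]) auto
  also have "\<dots> \<le> (\<integral>\<^sup>+r. ennreal (4 * pi * exp (- c * r)) * indicator {0..} r \<partial>lborel)"
    by (intro nn_integral_mono) (auto simp flip: ennreal_mult split: split_indicator)
  also have "\<dots> = ennreal (0 - (- (4 * pi / c) * exp (- c * 0)))"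
  proof (rule nn_integral_FTC_atLeast)
    show "((\<lambda>r. - (4 * pi / c) * exp (- c * r)) \<longlongrightarrow> 0) at_top"
      using assms by real_asymp
  qed (use assms in \<open>auto intro!: derivative_eq_intros\<close>)
  finally show "(\<integral>\<^sup>+y. ennreal (norm (exp (- c * norm y) / (norm y)\<^sup>2)) \<partial>(lborel :: (real^3) measure)) < \<infinity>"
    by (rule le_less_trans) simp
qed measurable

text \<open>
  The function \<open>3/(4\<pi>) (1 + |y|\<^sup>2)\<^bsup>-5/2\<^esup>\<close> is a probability density; it is the shape of the
  approximate identity that a regularised Green function produces.
\<close>

lemma integral_inverse_sqrt_power5:
  "has_bochner_integral lborel (\<lambda>y::real^3. 1 / sqrt (1 + (norm y)\<^sup>2) ^ 5) (4 / 3 * pi)"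
proof (rule has_bochner_integral_nn_integral)
  have [simp]: "1 + r\<^sup>2 \<noteq> 0" "1 + r\<^sup>2 > 0" "\<not> 1 + r\<^sup>2 < 0" for r :: real
    using zero_le_power2[of r] by linarith+
  have "(\<integral>\<^sup>+y. ennreal (1 / sqrt (1 + (norm y)\<^sup>2) ^ 5) \<partial>(lborel :: (real^3) measure))
      = (\<integral>\<^sup>+r. ennreal (4 * pi * r\<^sup>2) * ennreal (1 / sqrt (1 + r\<^sup>2) ^ 5) * indicator {0..} r \<partial>lborel)"
    by (subst nn_integral_radial [symmetric]) auto
  also have "\<dots> = (\<integral>\<^sup>+r. ennreal (4 * pi * r\<^sup>2 / sqrt (1 + r\<^sup>2) ^ 5) * indicator {0..} r \<partial>lborel)"
    by (intro nn_integral_cong) (auto simp flip: ennreal_mult split: split_indicator)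
  also have "\<dots> = ennreal (4 / 3 * pi - 4 / 3 * pi * (0 / sqrt (1 + 0\<^sup>2)) ^ 3)"
  proof (rule nn_integral_FTC_atLeast)
    \<comment> \<open>\<open>(r/sqrt(1 + r\<^sup>2))\<^sup>3\<close> is an antiderivative of \<open>3 r\<^sup>2 (1 + r\<^sup>2)\<^bsup>-5/2\<^esup>\<close>.\<close>
    show "((\<lambda>r. 4 / 3 * pi * (r / sqrt (1 + r\<^sup>2)) ^ 3) \<longlongrightarrow> 4 / 3 * pi) at_top"
      by real_asymp
    fix r :: real
    define s where "s = sqrt (1 + r\<^sup>2)"
    have s: "s > 0" "s\<^sup>2 = 1 + r\<^sup>2" by (simp_all add: s_def)
    have "((\<lambda>r. r / sqrt (1 + r\<^sup>2)) has_real_derivative (s - r * (r / s)) / s\<^sup>2) (at r)"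
      unfolding s_def by (auto intro!: derivative_eq_intros simp: field_simps)
    also have "(s - r * (r / s)) / s\<^sup>2 = 1 / s ^ 3"
    proof -
      have "s * s - r * r = 1" using s(2) by (simp add: power2_eq_square)
      thus ?thesis using s(1) by (simp add: field_simps power2_eq_square power3_eq_cube)
    qed
    finally have d: "((\<lambda>r. r / sqrt (1 + r\<^sup>2)) has_real_derivative 1 / s ^ 3) (at r)" .
    show "((\<lambda>r. 4 / 3 * pi * (r / sqrt (1 + r\<^sup>2)) ^ 3) has_real_derivative
        4 * pi * r\<^sup>2 / sqrt (1 + r\<^sup>2) ^ 5) (at r)"
      by (rule DERIV_cong[OF DERIV_cmult[OF DERIV_power[OF d]]], unfold s_def [symmetric])
         (use s(1) in \<open>simp add: field_simps eval_nat_numeral\<close>)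
  qed auto
  finally show "(\<integral>\<^sup>+y. ennreal (1 / sqrt (1 + (norm y)\<^sup>2) ^ 5) \<partial>(lborel :: (real^3) measure)) = ennreal (4 / 3 * pi)"
    by simp
qed auto

subsection \<open>Functions with vanishing integral over all boxes\<close>

text \<open>
  The boxes generate the Borel sets and are closed under intersection, so Dynkin's lemma carries
  the vanishing over to all Borel sets; the total integral enters when passing to complements.
\<close>

lemma AE_zero_of_integrable_boxes:
  fixes F :: "real^3 \<Rightarrow> complex"
  assumes F: "integrable lborel F" and zero: "\<And>a b. set_lebesgue_integral lborel (box a b) F = 0"
    and total: "(LINT y|lborel. F y) = 0"
  shows "AE y in lborel. F y = 0"
proof (rule sigma_finite_measure.density_zero[OF sigma_finite_lborel F])
  have int: "set_integrable lborel A F" if "A \<in> sets borel" for A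
    using F that unfolding set_integrable_def by (intro integrable_mult_indicator) auto
  fix A :: "(real^3) set" assume "A \<in> sets lborel"
  hence A: "A \<in> sigma_sets UNIV (range (\<lambda>(a, b). box a b))"
    by (simp add: borel_eq_box)
  have "Int_stable (range (\<lambda>(a, b). box a b :: (real^3) set))"
    by (auto simp: Int_stable_def box_Int_box)
  moreover have "range (\<lambda>(a, b). box a b :: (real^3) set) \<subseteq> Pow UNIV" by simp
  ultimately show "set_lebesgue_integral lborel A F = 0"
    using A
  proof (induction rule: sigma_sets_induct_disjoint)
    case (compl A)
    have A: "A \<in> sets borel" using compl by (simp add: borel_eq_box)
    have "set_lebesgue_integral lborel (A \<union> (UNIV - A)) F
        = set_lebesgue_integral lborel A F + set_lebesgue_integral lborel (UNIV - A) F"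
      using A by (intro set_integral_Un int) auto
    thus ?case
      using compl total by (simp add: set_lebesgue_integral_def)
  next
    case (union A)
    have A: "A i \<in> sets borel" for i using union by (auto simp: borel_eq_box)
    have "set_lebesgue_integral lborel (\<Union>i. A i) F = (\<Sum>i. set_lebesgue_integral lborel (A i) F)"
      using union(1) A by (intro lebesgue_integral_countable_add int) (auto simp: disjoint_family_on_def)
    thus ?case using union by simp
  qed (use zero in \<open>auto simp: set_lebesgue_integral_def\<close>)
qed

lemma AE_zero_of_boxes:
  fixes F :: "real^3 \<Rightarrow> complex"
  assumes F: "\<And>a b. set_integrable lborel (box a b) F"
    and zero: "\<And>a b. set_lebesgue_integral lborel (box a b) F = 0"
  shows "AE y in lborel. F y = 0"
proof -
  define B :: "nat \<Rightarrow> (real^3) set" where "B n = box (- (real n *\<^sub>R One)) (real n *\<^sub>R One)" for n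
  have "AE y in lborel. indicator (B n) y *\<^sub>R F y = 0" for n
  proof (rule AE_zero_of_integrable_boxes)
    show "integrable lborel (\<lambda>y. indicator (B n) y *\<^sub>R F y)"
      using F unfolding B_def set_integrable_def by blast
    show "(LINT y|lborel. indicator (B n) y *\<^sub>R F y) = 0"
      using zero unfolding B_def set_lebesgue_integral_def by blast
    fix a b :: "real^3"
    have "set_lebesgue_integral lborel (box a b) (\<lambda>y. indicator (B n) y *\<^sub>R F y)
        = set_lebesgue_integral lborel (box a b \<inter> B n) F"
      by (simp add: set_lebesgue_integral_def indicator_inter_arith)
    thus "set_lebesgue_integral lborel (box a b) (\<lambda>y. indicator (B n) y *\<^sub>R F y) = 0"
      by (simp add: B_def box_Int_box zero)
  qed
  hence "AE y in lborel. \<forall>n. indicator (B n) y *\<^sub>R F y = 0"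
    by (subst AE_all_countable) blast
  thus ?thesis
  proof eventually_elim
    case (elim y)
    obtain n :: nat where n: "norm y < real n" using reals_Archimedean2 by blast
    have "\<bar>y \<bullet> i\<bar> < real n" if "i \<in> Basis" for i
      using Basis_le_norm[OF that, of y] n by linarith
    hence "y \<in> B n" by (force simp: B_def mem_box abs_less_iff)
    thus ?case using elim[rule_format, of n] by simp
  qed
qed

subsection \<open>Convolution kernels\<close>

text \<open>
  Since \<open>|p q| \<le> |p|\<^sup>2 + |q|\<^sup>2\<close>, the integrand is dominated by \<open>|K(y - a)| |p(a)|\<^sup>2 + |K(y - a)| |q(y)|\<^sup>2\<close>, and
  in either term the kernel can be integrated out first, by translation invariance.
\<close>

lemma integrable_kernel:
  fixes p q K :: wave
  assumes [measurable]: "p \<in> borel_measurable borel" "q \<in> borel_measurable borel" "K \<in> borel_measurable borel"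
    and p: "integrable lborel (\<lambda>y. (cmod (p y))\<^sup>2)" and q: "integrable lborel (\<lambda>y. (cmod (q y))\<^sup>2)"
    and K: "integrable lborel K"
  shows "integrable (lborel \<Otimes>\<^sub>M lborel) (\<lambda>(a, y). K (y - a) * p a * q y)"
proof -
  have "integrable (lborel \<Otimes>\<^sub>M lborel) (\<lambda>(a, y). cmod (K (y - a)) * (cmod (p a))\<^sup>2)"
  proof (rule lborel_pair.Fubini_integrable)
    have *: "(LINT y|lborel. norm (cmod (K (y - a)) * (cmod (p a))\<^sup>2)) = (LINT y|lborel. cmod (K y)) * (cmod (p a))\<^sup>2" for a
      using lborel_integral_translate(1)[of "\<lambda>y. cmod (K y)" a] by simp
    show "integrable lborel (\<lambda>a. LINT y|lborel. norm (case (a, y) of (a, y) \<Rightarrow> cmod (K (y - a)) * (cmod (p a))\<^sup>2))"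
      unfolding prod.case * using p by simp
    show "AE a in lborel. integrable lborel (\<lambda>y. case (a, y) of (a, y) \<Rightarrow> cmod (K (y - a)) * (cmod (p a))\<^sup>2)"
      using K lborel_integral_translate(2)[of "\<lambda>y. cmod (K y)"] by auto
  qed measurable
  moreover have "integrable (lborel \<Otimes>\<^sub>M lborel) (\<lambda>(y, a). cmod (K (y - a)) * (cmod (q y))\<^sup>2)"
  proof (rule lborel_pair.Fubini_integrable)
    have *: "(LINT a|lborel. norm (cmod (K (y - a)) * (cmod (q y))\<^sup>2)) = (LINT y|lborel. cmod (K y)) * (cmod (q y))\<^sup>2" for y
      using lborel_integral_reflect(1)[of "\<lambda>y. cmod (K y)" y] by simp
    show "integrable lborel (\<lambda>y. LINT a|lborel. norm (case (y, a) of (y, a) \<Rightarrow> cmod (K (y - a)) * (cmod (q y))\<^sup>2))"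
      unfolding prod.case * using q by simp
    show "AE y in lborel. integrable lborel (\<lambda>a. case (y, a) of (y, a) \<Rightarrow> cmod (K (y - a)) * (cmod (q y))\<^sup>2)"
      using K lborel_integral_reflect(2)[of "\<lambda>y. cmod (K y)"] by auto
  qed measurable
  hence "integrable (lborel \<Otimes>\<^sub>M lborel) (\<lambda>(a, y). cmod (K (y - a)) * (cmod (q y))\<^sup>2)"
    using lborel_pair.integrable_product_swap[of "\<lambda>(y, a). cmod (K (y - a)) * (cmod (q y))\<^sup>2"] by simp
  ultimately have "integrable (lborel \<Otimes>\<^sub>M lborel)
      (\<lambda>z. (\<lambda>(a, y). cmod (K (y - a)) * (cmod (p a))\<^sup>2) z + (\<lambda>(a, y). cmod (K (y - a)) * (cmod (q y))\<^sup>2) z)"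
    by (rule Bochner_Integration.integrable_add)
  thus ?thesis
  proof (rule Bochner_Integration.integrable_bound)
    have "cmod (K (y - a) * p a * q y) \<le> cmod (K (y - a)) * (cmod (p a))\<^sup>2 + cmod (K (y - a)) * (cmod (q y))\<^sup>2"
      for a y
      using mult_left_mono[OF two_mult_le_squares[of "cmod (p a)" "cmod (q y)"], of "cmod (K (y - a))"]
      by (simp add: norm_mult algebra_simps)
    thus "AE z in lborel \<Otimes>\<^sub>M lborel. norm (case z of (a, y) \<Rightarrow> K (y - a) * p a * q y)
        \<le> norm ((\<lambda>(a, y). cmod (K (y - a)) * (cmod (p a))\<^sup>2) z + (\<lambda>(a, y). cmod (K (y - a)) * (cmod (q y))\<^sup>2) z)"
      by (auto intro!: always_eventually simp: add_nonneg_nonneg)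
  qed measurable
qed

lemma kernel_Fubini:
  fixes p q K :: wave
  assumes [measurable]: "K \<in> borel_measurable borel" and K: "integrable lborel K" and pL: "p \<in> L2" and qL: "q \<in> L2"
  shows "(LINT a|lebesgue. p a * (LINT y|lebesgue. K (y - a) * q y))
       = (LINT y|lebesgue. q y * (LINT a|lebesgue. K (y - a) * p a))"
proof -
  obtain p' where p': "p' \<in> borel_measurable borel" "p' \<in> L2" "AE y in lebesgue. p y = p' y"
    using L2_borel_representative[OF pL] .
  obtain q' where q': "q' \<in> borel_measurable borel" "q' \<in> L2" "AE y in lebesgue. q y = q' y"
    using L2_borel_representative[OF qL] .
  note [measurable] = p'(1) q'(1)
  have inner1: "(LINT y|lebesgue. K (y - a) * q y) = (LINT y|lborel. K (y - a) * q' y)" for a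
    by (rule integral_borel_representative[OF _ qL q'(1,3)]) measurable
  have inner2: "(LINT a|lebesgue. K (y - a) * p a) = (LINT a|lborel. K (y - a) * p' a)" for y
    by (rule integral_borel_representative[OF _ pL p'(1,3)]) measurable
  have m1: "(\<lambda>a. LINT y|lborel. K (y - a) * q' y) \<in> borel_measurable borel"
    and m2: "(\<lambda>y. LINT a|lborel. K (y - a) * p' a) \<in> borel_measurable borel"
    by (measurable)
  have int: "integrable (lborel \<Otimes>\<^sub>M lborel) (\<lambda>(a, y). K (y - a) * p' a * q' y)"
    using p' q' K by (intro integrable_kernel) (auto simp: L2_borel_iff)
  have "(LINT a|lebesgue. p a * (LINT y|lebesgue. K (y - a) * q y))
      = (LINT a|lborel. (LINT y|lborel. K (y - a) * q' y) * p' a)"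
    unfolding inner1 mult.commute[of "p _"] by (rule integral_borel_representative[OF m1 pL p'(1,3)])
  also have "\<dots> = (LINT a|lborel. LINT y|lborel. K (y - a) * p' a * q' y)"
    by (simp flip: integral_mult_right_zero add: mult_ac)
  also have "\<dots> = (LINT y|lborel. LINT a|lborel. K (y - a) * p' a * q' y)"
    by (rule lborel_pair.Fubini_integral[OF int, symmetric])
  also have "\<dots> = (LINT y|lborel. (LINT a|lborel. K (y - a) * p' a) * q' y)"
    by (simp flip: integral_mult_right_zero add: mult_ac)
  also have "\<dots> = (LINT y|lebesgue. q y * (LINT a|lebesgue. K (y - a) * p a))"
    unfolding inner2 mult.commute[of "q _"] by (rule integral_borel_representative[OF m2 qL q'(1,3), symmetric])
  finally show ?thesis .
qed

section \<open>Test functions\<close>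

subsection \<open>Partial derivatives\<close>

lemma frechet_derivative_mult_complex:
  fixes f g :: wave
  assumes "f differentiable (at y)" "g differentiable (at y)"
  shows "frechet_derivative (\<lambda>y. f y * g y) (at y) h
    = f y * frechet_derivative g (at y) h + frechet_derivative f (at y) h * g y"
  using has_derivative_mult[OF assms[THEN frechet_derivative_works[THEN iffD1]]]
  by (simp flip: frechet_derivative_at)

lemma partial_mult:
  assumes "\<And>y. f differentiable (at y)" "\<And>y. g differentiable (at y)"
  shows "partial i (\<lambda>y. f y * g y) = (\<lambda>y. f y * partial i g y + partial i f y * g y)"
  using assms by (simp add: partial_def frechet_derivative_mult_complex)

lemma partial_add:
  assumes "\<And>y. f differentiable (at y)" "\<And>y. g differentiable (at y)"
  shows "partial i (\<lambda>y. f y + g y) = (\<lambda>y. partial i f y + partial i g y)"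
  unfolding partial_def
  by (intro ext, subst frechet_derivative_at[OF has_derivative_add, symmetric])
     (use assms in \<open>auto simp flip: frechet_derivative_works\<close>)

lemma partial_eqI:
  assumes "\<And>y. (f has_derivative f' y) (at y)"
  shows "partial i f = (\<lambda>y. f' y (axis i 1))"
  using frechet_derivative_at[OF assms] by (simp add: partial_def)

lemma partial_const: "partial i (\<lambda>y. c) = (\<lambda>y. 0)"
  by (subst partial_eqI[where f' = "\<lambda>_ _. 0"]) auto

lemma has_derivative_coordinate:
  "((\<lambda>y::real^3. complex_of_real (y $ j - c)) has_derivative (\<lambda>h. complex_of_real (h $ j))) (at y)"
  by (auto intro!: derivative_eq_intros bounded_linear_imp_has_derivative
      bounded_linear_compose[OF bounded_linear_of_real] bounded_linear_vec_nth simp: fun_diff_def)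

lemma partial_coordinate:
  "partial i (\<lambda>y. complex_of_real (y $ j - c)) = (\<lambda>y. of_bool (i = j))"
  by (subst partial_eqI[OF has_derivative_coordinate]) (auto simp: axis_def)

subsection \<open>Functions with continuous partial derivatives of high order\<close>

lemma C_k_imp_continuous: "C_k k f \<Longrightarrow> continuous_on UNIV f"
  by (cases k) (auto intro!: continuous_at_imp_continuous_on differentiable_imp_continuous_within)

lemma C_k_Suc_imp: "C_k (Suc k) f \<Longrightarrow> C_k k f"
proof (induction k arbitrary: f)
  case 0
  thus ?case by (auto intro!: continuous_at_imp_continuous_on differentiable_imp_continuous_within)
next
  case (Suc k)
  thus ?case by simp
qed

lemma C_k_const: "C_k k (\<lambda>y. c)"
  by (induction k arbitrary: c) (auto simp: partial_const)

lemma C_k_add: "C_k k f \<Longrightarrow> C_k k g \<Longrightarrow> C_k k (\<lambda>y. f y + g y)"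
proof (induction k arbitrary: f g)
  case 0
  thus ?case by (auto intro: continuous_on_add)
next
  case (Suc k)
  thus ?case by (auto simp: partial_add intro!: differentiable_add)
qed

lemma C_k_mult: "C_k k f \<Longrightarrow> C_k k g \<Longrightarrow> C_k k (\<lambda>y. f y * g y)"
proof (induction k arbitrary: f g)
  case 0
  thus ?case by (auto intro: continuous_on_mult)
next
  case (Suc k)
  have "C_k k f" "C_k k g" using Suc.prems by (blast intro: C_k_Suc_imp)+
  with Suc show ?case
    by (auto simp: partial_mult intro!: differentiable_mult C_k_add)
qed

lemma C_k_coordinate: "C_k k (\<lambda>y. complex_of_real (y $ j - c))"
proof (cases k)
  case 0
  thus ?thesis by (auto intro!: continuous_intros)
next
  case (Suc l)
  thus ?thesis
    unfolding Suc C_k.simps partial_coordinate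
    by (blast intro: differentiableI has_derivative_coordinate C_k_const)
qed

lemma partial_zero_outside_closure:
  assumes "y \<notin> closure {y. f y \<noteq> 0}"
  shows "partial i f y = 0"
proof -
  have "(f has_derivative (\<lambda>_. 0)) (at y)"
  proof (rule has_derivative_transform_within_open[where f = "\<lambda>_. 0"])
    show "open (- closure {y. f y \<noteq> 0})" by auto
    show "0 = f x" if "x \<in> - closure {y. f y \<noteq> 0}" for x
      using that closure_subset[of "{y. f y \<noteq> 0}"] by auto
  qed (use assms in auto)
  thus ?thesis
    using frechet_derivative_at[of f "\<lambda>_. 0" y] by (simp add: partial_def fun_eq_iff)
qed

lemma test_function_partial:
  assumes "test_function \<phi>"
  shows "test_function (partial i \<phi>)"
proof -
  have "C_k k (partial i \<phi>)" for k
    using assms C_k.simps(2)[of k \<phi>] by (auto simp: test_function_def)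
  moreover have "closure {y. partial i \<phi> y \<noteq> 0} \<subseteq> closure {y. \<phi> y \<noteq> 0}"
    using partial_zero_outside_closure[of _ \<phi> i] by (intro closure_minimal) auto
  hence "compact (closure {y. partial i \<phi> y \<noteq> 0})"
    using assms compact_closure bounded_subset unfolding test_function_def
    by (metis closure_closure compact_eq_bounded_closed closed_closure)
  ultimately show ?thesis by (simp add: test_function_def)
qed

lemma test_function_L2:
  assumes "test_function \<psi>"
  shows "\<psi> \<in> L2"
proof -
  let ?K = "closure {y. \<psi> y \<noteq> 0}"
  have c: "continuous_on UNIV \<psi>" and K: "compact ?K"
    using assms C_k_imp_continuous[of 0 \<psi>] by (auto simp: test_function_def)
  have m: "\<psi> \<in> borel_measurable borel" using c by (rule borel_measurable_continuous_onI)
  have "integrable lborel (\<lambda>y. indicator ?K y *\<^sub>R (cmod (\<psi> y))\<^sup>2)"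
    by (intro borel_integrable_compact K continuous_intros continuous_on_subset[OF c]) auto
  also have "(\<lambda>y. indicator ?K y *\<^sub>R (cmod (\<psi> y))\<^sup>2) = (\<lambda>y. (cmod (\<psi> y))\<^sup>2)"
    using closure_subset[of "{y. \<psi> y \<noteq> 0}"] by (auto simp: indicator_def fun_eq_iff)
  finally show ?thesis using m by (simp add: L2_borel_iff)
qed

text \<open>
  The defining identity of weak derivatives, used twice; \<open>partial i \<phi>\<close> is again a test function.
\<close>

lemma neg_laplacian_test:
  assumes "(u, g) \<in> neg_laplacian" "test_function \<phi>"
  shows "(LINT y|lebesgue. u y * (\<Sum>i\<in>UNIV. partial i (partial i \<phi>) y)) = - (LINT y|lebesgue. g y * \<phi> y)"
proof -
  obtain d dd where d: "\<And>i. weak_partial i u (d i)" "\<And>i. weak_partial i (d i) (dd i)"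
    and g: "AE y in lebesgue. g y = - (\<Sum>i\<in>UNIV. dd i y)" and gL: "g \<in> L2"
    using assms(1) by (auto simp: neg_laplacian_def)
  have ddL: "dd i \<in> L2" for i using d(2) by (auto simp: weak_partial_def)
  have uL: "u \<in> L2" using d(1) by (auto simp: weak_partial_def)
  have "(LINT y|lebesgue. u y * partial i (partial i \<phi>) y) = (LINT y|lebesgue. dd i y * \<phi> y)" for i
    using d(1)[of i] d(2)[of i] assms(2) test_function_partial[OF assms(2), of i]
    by (simp add: weak_partial_def)
  hence "(LINT y|lebesgue. u y * (\<Sum>i\<in>UNIV. partial i (partial i \<phi>) y)) = (\<Sum>i\<in>UNIV. LINT y|lebesgue. dd i y * \<phi> y)"
    unfolding sum_distrib_left
    by (subst Bochner_Integration.integral_sum)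
       (auto intro!: L2_mult_integrable uL test_function_L2 test_function_partial assms)
  also have "\<dots> = (LINT y|lebesgue. (\<Sum>i\<in>UNIV. dd i y) * \<phi> y)"
    unfolding sum_distrib_right
    by (subst Bochner_Integration.integral_sum) (auto intro!: L2_mult_integrable ddL test_function_L2 assms)
  also have "\<dots> = (LINT y|lebesgue. - (g y * \<phi> y))"
    by (rule integral_cong_AE)
       (use g in \<open>auto intro!: borel_measurable_integrable L2_mult_integrable L2_sum ddL gL test_function_L2[OF assms(2)] elim!: eventually_mono\<close>)
  finally show ?thesis by simp
qed

subsection \<open>Radial functions\<close>

abbreviation sqdist :: "real^3 \<Rightarrow> real^3 \<Rightarrow> real" where
  "sqdist y a \<equiv> (norm (y - a))\<^sup>2"

lemma has_derivative_norm_sq_shift: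
  "((\<lambda>y::real^3. sqdist y a) has_derivative (\<lambda>h. 2 * ((y - a) \<bullet> h))) (at y)"
  unfolding power2_norm_eq_inner
  by (auto intro!: derivative_eq_intros simp: inner_commute)

lemma has_derivative_radial:
  fixes F :: "real \<Rightarrow> complex"
  assumes "(F has_vector_derivative F') (at (sqdist y a))"
  shows "((\<lambda>y::real^3. F (sqdist y a)) has_derivative (\<lambda>h. (2 * ((y - a) \<bullet> h)) *\<^sub>R F')) (at y)"
  using has_derivative_compose[OF has_derivative_norm_sq_shift[of a y]
      assms[unfolded has_vector_derivative_def]] by simp

lemma partial_radial:
  fixes F F' :: "real \<Rightarrow> complex"
  assumes "\<And>t. t \<ge> 0 \<Longrightarrow> (F has_vector_derivative F' t) (at t)"
  shows "partial i (\<lambda>y. F (sqdist y a))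
    = (\<lambda>y. (2 * complex_of_real (y $ i - a $ i)) * F' (sqdist y a))"
  by (subst partial_eqI[OF has_derivative_radial[OF assms]])
     (auto simp: inner_axis scaleR_conv_of_real)

lemma laplacian_radial:
  fixes F F' F'' :: "real \<Rightarrow> complex"
  assumes F: "\<And>t. t \<ge> 0 \<Longrightarrow> (F has_vector_derivative F' t) (at t)"
    and F': "\<And>t. t \<ge> 0 \<Longrightarrow> (F' has_vector_derivative F'' t) (at t)"
  defines "q \<equiv> \<lambda>y a. (norm (y - a :: real^3))\<^sup>2"
  shows "(\<Sum>i\<in>UNIV. partial i (partial i (\<lambda>y. F (q y a))) y) = 6 * F' (q y a) + 4 * of_real (q y a) * F'' (q y a)"
proof -
  have *: "partial i (partial i (\<lambda>y. F (q y a))) y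
      = 2 * F' (q y a) + 4 * of_real ((y $ i - a $ i)\<^sup>2) * F'' (q y a)" for i
  proof -
    have d1: "(\<lambda>y. 2 * complex_of_real (y $ i - a $ i)) differentiable (at y)" for y :: "real^3"
      by (intro differentiable_mult differentiable_const differentiableI[OF has_derivative_coordinate])
    have d2: "(\<lambda>y. F' (q y a)) differentiable (at y)" for y
      unfolding q_def by (rule differentiableI[OF has_derivative_radial[OF F']]) simp
    have c: "partial i (\<lambda>y. 2 * complex_of_real (y $ i - a $ i)) = (\<lambda>y. 2)"
      by (subst partial_mult[OF differentiable_const differentiableI[OF has_derivative_coordinate]],
          subst partial_coordinate, subst partial_const) simp
    have "partial i (partial i (\<lambda>y. F (q y a))) y
        = (2 * complex_of_real (y $ i - a $ i)) * ((2 * complex_of_real (y $ i - a $ i)) * F'' (q y a)) + 2 * F' (q y a)"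
      unfolding q_def
      by (subst partial_radial[OF F], assumption,
          subst partial_mult[OF d1 d2[unfolded q_def]], subst partial_radial[OF F'], assumption, subst c, rule refl)
    thus ?thesis by (simp add: power2_eq_square algebra_simps)
  qed
  have "(\<Sum>i\<in>UNIV. (y $ i - a $ i)\<^sup>2) = q y a"
    by (simp add: q_def norm_vec_def L2_set_def sum_nonneg)
  hence "(\<Sum>i\<in>UNIV. complex_of_real ((y $ i - a $ i)\<^sup>2)) = of_real (q y a)"
    by (metis of_real_sum)
  thus ?thesis
    unfolding * by (simp add: sum.distrib flip: sum_distrib_left sum_distrib_right)
qed

text \<open>
  Each partial derivative of \<open>F n (|y - a|\<^sup>2)\<close> is a coordinate times a linear combination of later members of the
  family, so the induction on the order of smoothness closes.
\<close>

lemma C_k_radial: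
  fixes F :: "nat \<Rightarrow> real \<Rightarrow> complex"
  assumes F: "\<And>n t. t \<ge> 0 \<Longrightarrow> (F n has_vector_derivative (\<alpha> n * F (n + 1) t + \<beta> n * F (n + 2) t)) (at t)"
  shows "C_k k (\<lambda>y. F n (sqdist y a))"
proof (induction k arbitrary: n)
  case 0
  have "continuous (at y) (\<lambda>y. F n (sqdist y a))" for y
    by (rule has_derivative_continuous[OF has_derivative_radial[OF F]]) simp
  thus ?case by (auto intro: continuous_at_imp_continuous_on)
next
  case (Suc k)
  have "(\<lambda>y. F n (sqdist y a)) differentiable (at y)" for y
    by (rule differentiableI[OF has_derivative_radial[OF F]]) simp
  moreover have "C_k k (partial i (\<lambda>y. F n (sqdist y a)))" for i
    by (subst partial_radial[OF F], assumption)
       (intro C_k_mult C_k_add C_k_const C_k_coordinate Suc.IH)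
  ultimately show ?case by simp
qed

subsection \<open>A smooth cutoff\<close>

text \<open>
  The exponent \<open>n\<close> makes the family closed under differentiation up to linear combinations.  The member
  \<open>n = 0\<close> is the usual smooth bump, supported in the half-line up to \<open>1\<close> and with value \<open>exp (- 1)\<close> at \<open>0\<close>.
\<close>

definition cutoff :: "nat \<Rightarrow> real \<Rightarrow> real" where
  "cutoff n t = (if t < 1 then exp (- 1 / (1 - t)) / (1 - t) ^ n else 0)"

lemma cutoff_tendsto_0: "(cutoff n \<longlongrightarrow> 0) (at_left 1)"
proof -
  have "((\<lambda>x::real. x ^ n / exp x) \<longlongrightarrow> 0) at_top"
    by (rule tendsto_power_div_exp_0)
  moreover have "filterlim (\<lambda>t::real. 1 / (1 - t)) at_top (at_left 1)"
    by real_asymp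
  ultimately have "((\<lambda>t::real. (1 / (1 - t)) ^ n / exp (1 / (1 - t))) \<longlongrightarrow> 0) (at_left 1)"
    by (rule filterlim_compose)
  moreover have "eventually (\<lambda>t. (1 / (1 - t)) ^ n / exp (1 / (1 - t)) = cutoff n t) (at_left (1::real))"
    by (auto simp: eventually_at_filter cutoff_def power_divide exp_minus divide_simps)
  ultimately show ?thesis
    by (rule Lim_transform_eventually)
qed

lemma cutoff_derivative:
  "(cutoff n has_real_derivative (real n * cutoff (n + 1) t - cutoff (n + 2) t)) (at t)"
proof -
  consider "t < 1" | "t > 1" | "t = 1" by linarith
  thus ?thesis
  proof cases
    case 1
    define s where "s = 1 - t"
    have s: "s > 0" using 1 by (simp add: s_def)
    have "((\<lambda>t. exp (- 1 / (1 - t)) / (1 - t) ^ n) has_real_derivative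
        (exp (- 1 / s) * (- 1 / s\<^sup>2) * s ^ n - exp (- 1 / s) * (real n * s ^ (n - 1) * (- 1))) / (s ^ n * s ^ n)) (at t)"
      unfolding s_def using 1 by (auto intro!: derivative_eq_intros simp: power2_eq_square)
    also have "(exp (- 1 / s) * (- 1 / s\<^sup>2) * s ^ n - exp (- 1 / s) * (real n * s ^ (n - 1) * (- 1))) / (s ^ n * s ^ n)
        = real n * cutoff (n + 1) t - cutoff (n + 2) t"
      using 1 s by (cases n) (simp_all add: cutoff_def s_def[symmetric] field_simps power2_eq_square)
    finally show ?thesis
      by (rule has_field_derivative_transform_within_open[where S = "{..<1}"]) (use 1 in \<open>auto simp: cutoff_def\<close>)
  next
    case 2
    have "(cutoff n has_real_derivative 0) (at t)"
      by (rule has_field_derivative_transform_within_open[where f = "\<lambda>_. 0" and S = "{1<..}"])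
         (use 2 in \<open>auto simp: cutoff_def\<close>)
    thus ?thesis using 2 by (simp add: cutoff_def)
  next
    case 3
    \<comment> \<open>To the left of \<open>1\<close> the difference quotient is \<open>- cutoff (n + 1)\<close>.\<close>
    have "((\<lambda>y. (cutoff n y - cutoff n 1) / (y - 1)) \<longlongrightarrow> 0) (at 1)"
    proof (rule filterlim_split_at)
      have "((\<lambda>y. - cutoff (n + 1) y) \<longlongrightarrow> - 0) (at_left 1)"
        by (intro tendsto_minus cutoff_tendsto_0)
      moreover have "eventually (\<lambda>y. - cutoff (n + 1) y = (cutoff n y - cutoff n 1) / (y - 1)) (at_left 1)"
        by (auto simp: eventually_at_filter cutoff_def divide_simps) (auto simp: algebra_simps)
      ultimately show "((\<lambda>y. (cutoff n y - cutoff n 1) / (y - 1)) \<longlongrightarrow> 0) (at_left 1)"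
        using Lim_transform_eventually by fastforce
      show "((\<lambda>y. (cutoff n y - cutoff n 1) / (y - 1)) \<longlongrightarrow> 0) (at_right 1)"
        by (rule tendsto_eventually) (auto simp: eventually_at_filter cutoff_def)
    qed
    thus ?thesis using 3 by (simp add: has_field_derivative_iff cutoff_def)
  qed
qed

lemma cutoff_bounded: "\<exists>C\<ge>0. \<forall>t\<ge>0. \<bar>cutoff n t\<bar> \<le> C"
proof -
  have "continuous_on {0..1} (cutoff n)"
    by (intro continuous_at_imp_continuous_on ballI DERIV_isCont[OF cutoff_derivative])
  hence "bounded (cutoff n ` {0..1})"
    by (intro compact_imp_bounded compact_continuous_image) auto
  then obtain C where C: "\<And>t. t \<in> {0..1} \<Longrightarrow> \<bar>cutoff n t\<bar> \<le> C"
    unfolding bounded_iff by (metis imageI real_norm_def)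
  have "\<bar>cutoff n t\<bar> \<le> C" if "t \<ge> 0" for t
    using C[of t] C[of 1] that by (cases "t \<le> 1") (auto simp: cutoff_def)
  moreover have "C \<ge> 0" using C[of 0] by simp
  ultimately show ?thesis by blast
qed

section \<open>The regularised Green function\<close>

text \<open>
  With \<open>s = sqrt (t + e\<^sup>2)\<close> and \<open>t\<close> a squared distance this is \<open>exp (- \<kappa> s) / s\<^sup>n\<close>.  The member \<open>n = 1\<close>
  is the Yukawa potential (\<open>4\<pi>\<close> times the Green function of \<open>-\<Delta> + \<kappa>\<^sup>2\<close>) with its singularity smoothed
  at scale \<open>e\<close>; the members with \<open>n > 1\<close> appear in its derivatives with respect to \<open>t\<close>.
\<close>

definition yukawa :: "complex \<Rightarrow> real \<Rightarrow> nat \<Rightarrow> real \<Rightarrow> complex" where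
  "yukawa \<kappa> e n t = exp (- \<kappa> * of_real (sqrt (t + e\<^sup>2))) / of_real (sqrt (t + e\<^sup>2)) ^ n"

text \<open>
  This is what \<open>-\<Delta> + \<kappa>\<^sup>2\<close> makes of the smoothed Yukawa potential, as a function of the squared
  distance to its centre.
\<close>

definition delta_kernel :: "complex \<Rightarrow> real \<Rightarrow> real \<Rightarrow> complex" where
  "delta_kernel \<kappa> e t = of_real (e\<^sup>2) * (\<kappa>\<^sup>2 * yukawa \<kappa> e 3 t + 3 * \<kappa> * yukawa \<kappa> e 4 t + 3 * yukawa \<kappa> e 5 t)"

lemma yukawa_measurable [measurable]: "yukawa \<kappa> e n \<in> borel_measurable borel"
  unfolding yukawa_def by measurable

lemma delta_kernel_measurable [measurable]: "delta_kernel \<kappa> e \<in> borel_measurable borel"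
  unfolding delta_kernel_def by measurable

lemma yukawa_derivative:
  assumes "e > 0" "t \<ge> 0"
  shows "(yukawa \<kappa> e n has_vector_derivative
           (- (\<kappa> / 2)) * yukawa \<kappa> e (n + 1) t + (- (of_nat n / 2)) * yukawa \<kappa> e (n + 2) t) (at t)"
proof -
  define s where "s = sqrt (t + e\<^sup>2)"
  have te: "t + e\<^sup>2 > 0" using assms by (simp add: add_nonneg_pos)
  have s: "s > 0" using te by (simp add: s_def)
  have d1: "((\<lambda>t. sqrt (t + e\<^sup>2)) has_vector_derivative 1 / (2 * s)) (at t)"
    unfolding s_def has_real_derivative_iff_has_vector_derivative [symmetric]
    using te by (auto intro!: derivative_eq_intros simp: field_simps)
  have "((\<lambda>w. exp (- \<kappa> * w) / w ^ n) has_field_derivative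
      (exp (- \<kappa> * of_real s) * (- \<kappa>) * of_real s ^ n - exp (- \<kappa> * of_real s) * (of_nat n * of_real s ^ (n - 1)))
        / (of_real s ^ n * of_real s ^ n)) (at (of_real s))"
    using s by (auto intro!: derivative_eq_intros)
  also have "(exp (- \<kappa> * of_real s) * (- \<kappa>) * of_real s ^ n - exp (- \<kappa> * of_real s) * (of_nat n * of_real s ^ (n - 1)))
        / (of_real s ^ n * of_real s ^ n)
      = exp (- \<kappa> * of_real s) * (- \<kappa> / of_real s ^ n - of_nat n / of_real s ^ (n + 1))"
    using s by (cases n) (simp_all add: field_simps)
  finally have d2: "((\<lambda>x. exp (- \<kappa> * of_real x) / of_real x ^ n) has_vector_derivative
      exp (- \<kappa> * of_real s) * (- \<kappa> / of_real s ^ n - of_nat n / of_real s ^ (n + 1))) (at s)"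
    by (rule has_vector_derivative_real_field)
  have "((\<lambda>x. exp (- \<kappa> * of_real x) / of_real x ^ n) \<circ> (\<lambda>t. sqrt (t + e\<^sup>2)) has_vector_derivative
      (1 / (2 * s)) *\<^sub>R (exp (- \<kappa> * of_real s) * (- \<kappa> / of_real s ^ n - of_nat n / of_real s ^ (n + 1)))) (at t)"
    using vector_diff_chain_at[OF d1, of "\<lambda>x. exp (- \<kappa> * of_real x) / of_real x ^ n"] d2 by (simp add: s_def)
  also have "(\<lambda>x. exp (- \<kappa> * of_real x) / of_real x ^ n) \<circ> (\<lambda>t. sqrt (t + e\<^sup>2)) = yukawa \<kappa> e n"
    by (auto simp: yukawa_def)
  also have "(1 / (2 * s)) *\<^sub>R (exp (- \<kappa> * of_real s) * (- \<kappa> / of_real s ^ n - of_nat n / of_real s ^ (n + 1)))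
      = (- (\<kappa> / 2)) * yukawa \<kappa> e (n + 1) t + (- (of_nat n / 2)) * yukawa \<kappa> e (n + 2) t"
    using s by (simp add: yukawa_def s_def[symmetric] scaleR_conv_of_real field_simps)
  finally show ?thesis .
qed

lemma linear_le_exp: "x \<le> (1 / c) * exp (c * x)" if "c > 0" for c x :: real
proof -
  have "c * x \<le> exp (c * x)" using exp_ge_add_one_self[of "c * x"] by linarith
  thus ?thesis using that by (simp add: field_simps)
qed

lemma square_le_exp:
  fixes c x :: real
  assumes "c > 0" "x \<ge> 0"
  shows "x\<^sup>2 \<le> (2 / c)\<^sup>2 * exp (c * x)"
proof -
  have "x\<^sup>2 \<le> ((2 / c) * exp (c / 2 * x))\<^sup>2"
    using linear_le_exp[of "c / 2" x] assms by (intro power_mono) auto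
  also have "\<dots> = (2 / c)\<^sup>2 * exp (c * x)"
    by (simp add: power_mult_distrib power_divide flip: exp_double)
  finally show ?thesis .
qed

lemma norm_yukawa:
  assumes "e > 0" "t \<ge> 0"
  shows "cmod (yukawa \<kappa> e n t) = exp (- Re \<kappa> * sqrt (t + e\<^sup>2)) / sqrt (t + e\<^sup>2) ^ n"
  using assms by (simp add: yukawa_def norm_divide norm_power)

text \<open>
  Half of the exponential decay rate is given away in order to absorb the factor \<open>1 + t\<close>.
\<close>

lemma yukawa_decay:
  assumes \<kappa>: "Re \<kappa> > 0" and e: "e > 0"
  shows "\<exists>C\<ge>0. \<forall>t\<ge>0. (1 + t) * cmod (yukawa \<kappa> e n t) \<le> C * exp (- (Re \<kappa> / 2) * sqrt t)"
proof -
  define \<mu> where "\<mu> = Re \<kappa>"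
  define C where "C = (1 + (4 / \<mu>)\<^sup>2) / e ^ n"
  have \<mu>: "\<mu> > 0" using \<kappa> by (simp add: \<mu>_def)
  have "(1 + t) * cmod (yukawa \<kappa> e n t) \<le> C * exp (- (\<mu> / 2) * sqrt t)" if t: "t \<ge> 0" for t
  proof -
    define s where "s = sqrt (t + e\<^sup>2)"
    have s: "s \<ge> e" "s \<ge> sqrt t" "s\<^sup>2 = t + e\<^sup>2"
      using t e by (auto simp: s_def intro: real_le_rsqrt)
    have s0: "s > 0" using s e by linarith
    have "s\<^sup>2 \<le> (4 / \<mu>)\<^sup>2 * exp (\<mu> * s / 2)"
      using square_le_exp[of "\<mu> / 2" s] \<mu> s0 by simp
    moreover have "1 \<le> exp (\<mu> * s / 2)" using \<mu> s0 by simp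
    ultimately have "1 + t \<le> (1 + (4 / \<mu>)\<^sup>2) * exp (\<mu> * s / 2)"
      using s(3) zero_le_power2[of e] unfolding distrib_right by linarith
    hence "(1 + t) * exp (- \<mu> * s) \<le> (1 + (4 / \<mu>)\<^sup>2) * exp (\<mu> * s / 2) * exp (- \<mu> * s)"
      by (rule mult_right_mono) simp
    also have "\<dots> = (1 + (4 / \<mu>)\<^sup>2) * exp (- (\<mu> / 2) * s)"
      by (simp add: exp_add [symmetric] mult.assoc)
    also have "\<dots> \<le> (1 + (4 / \<mu>)\<^sup>2) * exp (- (\<mu> / 2) * sqrt t)"
      using \<mu> s by (intro mult_left_mono) auto
    finally have 1: "(1 + t) * exp (- \<mu> * s) \<le> (1 + (4 / \<mu>)\<^sup>2) * exp (- (\<mu> / 2) * sqrt t)" .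
    have "(1 + t) * cmod (yukawa \<kappa> e n t) = (1 + t) * exp (- \<mu> * s) / s ^ n"
      using norm_yukawa[OF e t, of \<kappa> n] by (simp add: \<mu>_def s_def)
    also have "\<dots> \<le> (1 + (4 / \<mu>)\<^sup>2) * exp (- (\<mu> / 2) * sqrt t) / e ^ n"
      using 1 s e t by (intro frac_le power_mono) auto
    finally show ?thesis by (simp add: C_def)
  qed
  moreover have "C \<ge> 0" using e by (simp add: C_def)
  ultimately show ?thesis unfolding \<mu>_def by blast
qed

subsection \<open>Pairing square integrable functions with decaying radial functions\<close>

lemma exp_decay_L2:
  assumes "c > 0"
  shows "(\<lambda>y. complex_of_real (exp (- c * norm (y - a)))) \<in> L2"
proof -
  have "integrable lborel (\<lambda>y::real^3. (cmod (complex_of_real (exp (- c * norm y))))\<^sup>2)"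
  proof (rule Bochner_Integration.integrable_bound)
    show "integrable lborel (\<lambda>y::real^3. (2 / c)\<^sup>2 * (exp (- c * norm y) / (norm y)\<^sup>2))"
      by (intro integrable_mult_right integrable_exp_over_square assms)
    have "exp (- c * r) ^ 2 \<le> (2 / c)\<^sup>2 * (exp (- c * r) / r\<^sup>2)" if r: "r > 0" for r :: real
    proof -
      have "r\<^sup>2 * exp (- c * r) \<le> (2 / c)\<^sup>2 * exp (c * r) * exp (- c * r)"
        using square_le_exp[OF assms, of r] r by (intro mult_right_mono) auto
      also have "\<dots> = (2 / c)\<^sup>2" by (simp add: mult.assoc flip: exp_add)
      finally have "exp (- c * r) / r\<^sup>2 * (r\<^sup>2 * exp (- c * r)) \<le> exp (- c * r) / r\<^sup>2 * (2 / c)\<^sup>2"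
        by (intro mult_left_mono) auto
      thus ?thesis using r by (simp add: power2_eq_square mult_ac)
    qed
    moreover have "AE y in lborel. (y::real^3) \<noteq> 0" by (rule AE_lborel_singleton)
    ultimately show "AE y in lborel. norm ((cmod (complex_of_real (exp (- c * norm (y::real^3)))))\<^sup>2)
        \<le> norm ((2 / c)\<^sup>2 * (exp (- c * norm y) / (norm y)\<^sup>2))"
      by (auto elim!: eventually_mono)
  qed measurable
  hence "(\<lambda>y. complex_of_real (exp (- c * norm (y::real^3)))) \<in> L2"
    by (subst L2_borel_iff) auto
  thus ?thesis
    by (intro L2_translate(1)[of "\<lambda>y. complex_of_real (exp (- c * norm y))"]) auto
qed

lemma radial_L2:
  fixes \<Psi> :: "real \<Rightarrow> complex"
  assumes [measurable]: "\<Psi> \<in> borel_measurable borel" and "c > 0"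
    and "\<And>t. t \<ge> 0 \<Longrightarrow> cmod (\<Psi> t) \<le> C * exp (- c * sqrt t)"
  shows "(\<lambda>y. \<Psi> (sqdist y a)) \<in> L2"
proof -
  have "integrable lborel (\<lambda>y. (cmod (of_real C * complex_of_real (exp (- c * norm (y - a)))))\<^sup>2)"
    by (subst L2_borel_iff [symmetric]) (use L2_cmult[OF exp_decay_L2[OF \<open>c > 0\<close>]] in auto)
  hence "integrable lborel (\<lambda>y. (cmod (\<Psi> (sqdist y a)))\<^sup>2)"
  proof (rule Bochner_Integration.integrable_bound)
    have "(cmod (\<Psi> (sqdist y a)))\<^sup>2 \<le> (C * exp (- c * norm (y - a)))\<^sup>2" for y
      using assms(3)[of "sqdist y a"] by (intro power_mono) auto
    thus "AE y in lborel. norm ((cmod (\<Psi> (sqdist y a)))\<^sup>2)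
        \<le> norm ((cmod (of_real C * complex_of_real (exp (- c * norm (y - a)))))\<^sup>2)"
      by (simp add: norm_mult power_mult_distrib)
  qed measurable
  thus ?thesis by (subst L2_borel_iff) auto
qed

lemma radial_dominated_convergence:
  fixes \<Psi> :: "nat \<Rightarrow> real \<Rightarrow> complex"
  assumes [measurable]: "\<And>n. \<Psi> n \<in> borel_measurable borel" "\<Phi> \<in> borel_measurable borel"
    and "c > 0" "u \<in> L2"
    and bound: "\<And>n t. t \<ge> 0 \<Longrightarrow> cmod (\<Psi> n t) \<le> C * exp (- c * sqrt t)"
    and lim: "\<And>t. t \<ge> 0 \<Longrightarrow> (\<lambda>n. \<Psi> n t) \<longlonglongrightarrow> \<Phi> t"
  shows "(\<lambda>n. LINT y|lebesgue. u y * \<Psi> n (sqdist y a)) \<longlonglongrightarrow> (LINT y|lebesgue. u y * \<Phi> (sqdist y a))"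
proof (rule integral_dominated_convergence)
  have bl: "f \<in> borel_measurable lebesgue" if "f \<in> borel_measurable borel" for f :: wave
    using that by (intro measurable_completion) simp
  show "(\<lambda>y. u y * \<Psi> n (sqdist y a)) \<in> borel_measurable lebesgue" for n
    by (intro borel_measurable_times L2_measurable[OF \<open>u \<in> L2\<close>] bl) measurable
  show "(\<lambda>y. u y * \<Phi> (sqdist y a)) \<in> borel_measurable lebesgue"
    by (intro borel_measurable_times L2_measurable[OF \<open>u \<in> L2\<close>] bl) measurable
  have "integrable lebesgue (\<lambda>y. cmod (u y * (of_real C * complex_of_real (exp (- c * norm (y - a))))))"
    by (intro integrable_norm L2_mult_integrable L2_cmult exp_decay_L2 assms)
  thus "integrable lebesgue (\<lambda>y. cmod (u y * (of_real C * complex_of_real (exp (- c * norm (y - a))))))" .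
  have "cmod (\<Psi> n (sqdist y a)) \<le> cmod (of_real C * complex_of_real (exp (- c * norm (y - a))))" for n y
    using bound[of "sqdist y a" n] order_trans[OF _ mult_right_mono[OF abs_ge_self[of C] exp_ge_zero]]
    by (simp add: norm_mult)
  thus "AE y in lebesgue. norm (u y * \<Psi> n (sqdist y a))
      \<le> cmod (u y * (of_real C * complex_of_real (exp (- c * norm (y - a)))))" for n
    unfolding norm_mult by (intro always_eventually allI mult_left_mono) auto
  show "AE y in lebesgue. (\<lambda>n. u y * \<Psi> n (sqdist y a)) \<longlonglongrightarrow> u y * \<Phi> (sqdist y a)"
    by (intro always_eventually allI tendsto_mult tendsto_const lim) simp
qed

subsection \<open>The regularised Green function as a test function\<close>

lemma scaled_cutoff_derivative:
  "((\<lambda>t. complex_of_real (cutoff n (t / R\<^sup>2))) has_vector_derivative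
     of_real (1 / R\<^sup>2) * (of_nat n * of_real (cutoff (n + 1) (t / R\<^sup>2)) - of_real (cutoff (n + 2) (t / R\<^sup>2)))) (at t)"
proof -
  have "((\<lambda>t. cutoff n (t / R\<^sup>2)) has_real_derivative
      (real n * cutoff (n + 1) (t / R\<^sup>2) - cutoff (n + 2) (t / R\<^sup>2)) * (1 / R\<^sup>2)) (at t)"
    by (rule DERIV_chain2[OF cutoff_derivative DERIV_cdivide[OF DERIV_ident]])
  hence "((\<lambda>t. complex_of_real (cutoff n (t / R\<^sup>2))) has_vector_derivative
      of_real ((real n * cutoff (n + 1) (t / R\<^sup>2) - cutoff (n + 2) (t / R\<^sup>2)) * (1 / R\<^sup>2))) (at t)"
    by (intro has_vector_derivative_of_real)
       (simp flip: has_real_derivative_iff_has_vector_derivative)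
  thus ?thesis
    by (rule has_vector_derivative_eq_rhs) simp
qed

lemma test_function_cutoff_yukawa:
  assumes "e > 0" "R > 0"
  shows "test_function (\<lambda>y. of_real (cutoff 0 (sqdist y a / R\<^sup>2)) * yukawa \<kappa> e 1 (sqdist y a))"
    (is "test_function ?\<phi>")
proof -
  have "C_k k ?\<phi>" for k
  proof (rule C_k_mult)
    show "C_k k (\<lambda>y. yukawa \<kappa> e 1 (sqdist y a))"
      by (rule C_k_radial) (rule yukawa_derivative[OF assms(1)])
    show "C_k k (\<lambda>y. complex_of_real (cutoff 0 (sqdist y a / R\<^sup>2)))"
    proof (rule C_k_radial[where F = "\<lambda>n t. complex_of_real (cutoff n (t / R\<^sup>2))"])
      show "((\<lambda>t. complex_of_real (cutoff n (t / R\<^sup>2))) has_vector_derivative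
          (of_real (real n / R\<^sup>2)) * of_real (cutoff (n + 1) (t / R\<^sup>2))
            + of_real (- 1 / R\<^sup>2) * of_real (cutoff (n + 2) (t / R\<^sup>2))) (at t)" for n t
        using scaled_cutoff_derivative[of n R t]
        by (rule has_vector_derivative_eq_rhs) (simp add: algebra_simps)
    qed
  qed
  moreover have "{y. ?\<phi> y \<noteq> 0} \<subseteq> cball a R"
  proof
    fix y assume "y \<in> {y. ?\<phi> y \<noteq> 0}"
    hence "sqdist y a < R\<^sup>2" using assms by (auto simp: cutoff_def split: if_splits)
    hence "norm (y - a) \<le> R" using assms by (simp add: power2_less_imp_less less_imp_le)
    thus "y \<in> cball a R" by (simp add: dist_norm norm_minus_commute)
  qed
  hence "compact (closure {y. ?\<phi> y \<noteq> 0})"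
    unfolding compact_closure by (rule bounded_subset[OF bounded_cball])
  ultimately show ?thesis by (simp add: test_function_def)
qed

text \<open>
  For \<open>g(s) = exp(-\<kappa> s)/s\<close> with \<open>s\<^sup>2 = |y - a|\<^sup>2 + e\<^sup>2\<close> the Laplacian in three dimensions is
  \<open>g'' + 2 g'/s = \<kappa>\<^sup>2 g\<close> plus a multiple of \<open>e\<^sup>2\<close>, which is (minus) the approximate identity.  Derivatives that
  fall on the cutoff carry a factor \<open>\<rho> = R\<^sup>-\<^sup>2\<close>; they are grouped so that each of them is
  \<open>\<rho>\<close> times a term that is bounded by a decaying exponential uniformly in \<open>R \<ge> 1\<close>.
\<close>

text \<open>
  What \<open>-\<Delta> + \<kappa>\<^sup>2\<close> makes of the cut-off Yukawa potential; only the first term survives as \<open>\<rho> = R\<^sup>-\<^sup>2\<close> tends to 0.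
\<close>

definition cutoff_profile :: "complex \<Rightarrow> real \<Rightarrow> real \<Rightarrow> real \<Rightarrow> complex" where
  "cutoff_profile \<kappa> e \<rho> t = of_real (cutoff 0 (t * \<rho>)) * delta_kernel \<kappa> e t
      + of_real \<rho> * (6 * of_real (cutoff 2 (t * \<rho>)) * yukawa \<kappa> e 1 t)
      + of_real \<rho> * (4 * of_real \<rho> * (2 * of_real (cutoff 3 (t * \<rho>)) - of_real (cutoff 4 (t * \<rho>))) * (of_real t * yukawa \<kappa> e 1 t))
      - of_real \<rho> * (4 * of_real (cutoff 2 (t * \<rho>)) * (of_real t * (\<kappa> * yukawa \<kappa> e 2 t + yukawa \<kappa> e 3 t)))"

lemma helmholtz_cutoff_yukawa:
  fixes y a :: "real^3" and \<kappa> :: complex and e R :: real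
  assumes "e > 0" "R > 0"
  defines "t \<equiv> sqdist y a" and "\<rho> \<equiv> 1 / R\<^sup>2"
  defines "\<phi> \<equiv> \<lambda>y. of_real (cutoff 0 (sqdist y a / R\<^sup>2)) * yukawa \<kappa> e 1 (sqdist y a)"
  shows "\<kappa>\<^sup>2 * \<phi> y - (\<Sum>i\<in>UNIV. partial i (partial i \<phi>) y)
    = cutoff_profile \<kappa> e \<rho> t"
proof -
  define c where "c n t = complex_of_real (cutoff n (t / R\<^sup>2))" for n t
  define Y where "Y n t = yukawa \<kappa> e n t" for n t
  have dc: "(c n has_vector_derivative of_real \<rho> * (of_nat n * c (n + 1) t - c (n + 2) t)) (at t)" for n t
    using scaled_cutoff_derivative[of n R t] unfolding c_def \<rho>_def
    by (rule has_vector_derivative_eq_rhs) simp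
  have dY: "(Y n has_vector_derivative - (\<kappa> / 2) * Y (n + 1) t - of_nat n / 2 * Y (n + 2) t) (at t)"
    if "t \<ge> 0" for n t
    using yukawa_derivative[OF assms(1) that, of \<kappa> n] by (simp add: Y_def[abs_def])
  define F' where "F' t = c 0 t * (- (\<kappa> / 2) * Y 2 t - 1 / 2 * Y 3 t) - of_real \<rho> * c 2 t * Y 1 t" for t
  define Y'' where "Y'' t = \<kappa>\<^sup>2 / 4 * Y 3 t + 3 * \<kappa> / 4 * Y 4 t + 3 / 4 * Y 5 t" for t
  define F'' where "F'' t = c 0 t * Y'' t - 2 * of_real \<rho> * c 2 t * (- (\<kappa> / 2) * Y 2 t - 1 / 2 * Y 3 t)
      - (of_real \<rho>)\<^sup>2 * (2 * c 3 t - c 4 t) * Y 1 t" for t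
  have n: "Suc 0 = 1" "1 + 1 = (2::nat)" "1 + 2 = (3::nat)" "2 + 1 = (3::nat)" "2 + 2 = (4::nat)"
    "3 + 1 = (4::nat)" "3 + 2 = (5::nat)" "0 + 2 = (2::nat)" by simp_all
  have F: "((\<lambda>t. c 0 t * Y 1 t) has_vector_derivative F' t) (at t)" if "t \<ge> 0" for t
    using has_vector_derivative_mult[OF dc[of 0 t] dY[OF that, of 1], unfolded n]
    by (rule has_vector_derivative_eq_rhs) (simp add: F'_def algebra_simps)
  have dY2: "((\<lambda>t. - (\<kappa> / 2) * Y 2 t - 1 / 2 * Y 3 t) has_vector_derivative Y'' t) (at t)" if "t \<ge> 0" for t
    using has_vector_derivative_diff[OF
        has_vector_derivative_mult_right[OF dY[OF that, of 2, unfolded n], of "- (\<kappa> / 2)"]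
        has_vector_derivative_mult_right[OF dY[OF that, of 3, unfolded n], of "1 / 2"]]
    by (rule has_vector_derivative_eq_rhs) (simp add: Y''_def algebra_simps power2_eq_square)
  have F': "(F' has_vector_derivative F'' t) (at t)" if "t \<ge> 0" for t
    unfolding F'_def[abs_def]
    using has_vector_derivative_diff[OF has_vector_derivative_mult[OF dc[of 0 t] dY2[OF that], unfolded n]
        has_vector_derivative_mult[OF has_vector_derivative_mult_right[OF dc[of 2 t, unfolded n], of "of_real \<rho>"] dY[OF that, of 1, unfolded n]]]
    by (rule has_vector_derivative_eq_rhs) (simp add: F''_def algebra_simps power2_eq_square)
  have "(\<Sum>i\<in>UNIV. partial i (partial i \<phi>) y) = 6 * F' t + 4 * of_real t * F'' t"
    using laplacian_radial[OF F F', of a y] by (simp add: \<phi>_def t_def c_def Y_def)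
  moreover have "\<kappa>\<^sup>2 * Y 1 t - 6 * (- (\<kappa> / 2) * Y 2 t - 1 / 2 * Y 3 t) - 4 * of_real t * Y'' t = delta_kernel \<kappa> e t"
  proof -
    define s where "s = sqrt (t + e\<^sup>2)"
    have "t \<ge> 0" by (simp add: t_def)
    have s: "s > 0" "s\<^sup>2 = t + e\<^sup>2"
      using assms(1) \<open>t \<ge> 0\<close> by (auto simp: s_def add_nonneg_pos)
    have ts: "of_real t = (of_real s)\<^sup>2 - (complex_of_real e)\<^sup>2"
      using s(2) by (metis add_diff_cancel_right' of_real_diff of_real_power)
    define w where "w = complex_of_real s"
    have w: "w \<noteq> 0" using s by (simp add: w_def)
    have YE: "Y n t = exp (- \<kappa> * w) / w ^ n" for n
      by (simp add: Y_def yukawa_def s_def w_def)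
    show ?thesis
      unfolding delta_kernel_def Y''_def Y_def[symmetric] YE ts w_def[symmetric]
      using w by (simp add: field_simps eval_nat_numeral)
  qed
  moreover have "\<phi> y = c 0 t * Y 1 t" by (simp add: \<phi>_def c_def Y_def t_def)
  ultimately have "\<kappa>\<^sup>2 * \<phi> y - (\<Sum>i\<in>UNIV. partial i (partial i \<phi>) y)
      = c 0 t * delta_kernel \<kappa> e t + of_real \<rho> * (6 * c 2 t * Y 1 t)
        + of_real \<rho> * (4 * of_real \<rho> * (2 * c 3 t - c 4 t) * (of_real t * Y 1 t))
        - of_real \<rho> * (4 * c 2 t * (of_real t * (\<kappa> * Y 2 t + Y 3 t)))"
    unfolding F'_def F''_def by (simp flip: \<open>_ = delta_kernel \<kappa> e t\<close>) (simp add: algebra_simps power2_eq_square)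
  thus ?thesis
    by (simp add: cutoff_profile_def c_def Y_def \<rho>_def)
qed

section \<open>The Green function represents solutions of the Helmholtz equation\<close>

lemma cutoff_measurable [measurable]: "cutoff n \<in> borel_measurable borel"
  by (intro borel_measurable_continuous_onI continuous_at_imp_continuous_on ballI DERIV_isCont[OF cutoff_derivative])

lemma cutoff_0: "cutoff n 0 = exp (- 1)"
  by (simp add: cutoff_def)

text \<open>
  The weak formulation of \<open>(-\<Delta> - z) u = g - z u\<close> is applied to the cut-off Yukawa potential.  As the radius \<open>R = n + 1\<close> of
  the cutoff tends to infinity, both sides converge by dominated convergence, with common factor \<open>exp (- 1)\<close>.
\<close>

lemma helmholtz_regularised:
  assumes ug: "(u, g) \<in> neg_laplacian" and \<kappa>: "Re \<kappa> > 0" "\<kappa>\<^sup>2 = - z" and e: "e > 0"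
  shows "(LINT y|lebesgue. u y * delta_kernel \<kappa> e (sqdist y a))
       = (LINT y|lebesgue. (g y - z * u y) * yukawa \<kappa> e 1 (sqdist y a))"
proof -
  have uL: "u \<in> L2" and gL: "g \<in> L2"
    using ug by (auto simp: neg_laplacian_def eval_nat_numeral)
  define f where "f = (\<lambda>y. g y - z * u y)"
  have fL: "f \<in> L2" unfolding f_def by (intro L2_diff L2_cmult uL gL)
  define \<rho> where "\<rho> n = 1 / (real (Suc n))\<^sup>2" for n
  define \<phi> where "\<phi> n = (\<lambda>y. of_real (cutoff 0 (sqdist y a / (real (Suc n))\<^sup>2)) * yukawa \<kappa> e 1 (sqdist y a))" for n
  define \<Psi> where "\<Psi> n = cutoff_profile \<kappa> e (\<rho> n)" for n
  have \<rho>: "0 \<le> \<rho> n" "\<rho> n \<le> 1" for n by (simp_all add: \<rho>_def)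
  have \<rho>_lim: "\<rho> \<longlonglongrightarrow> 0" unfolding \<rho>_def by real_asymp
  have test: "test_function (\<phi> n)" for n
    unfolding \<phi>_def by (rule test_function_cutoff_yukawa) (use e in auto)
  have eq: "\<kappa>\<^sup>2 * \<phi> n y - (\<Sum>i\<in>UNIV. partial i (partial i (\<phi> n)) y) = \<Psi> n (sqdist y a)" for n y
    unfolding \<Psi>_def \<phi>_def \<rho>_def by (rule helmholtz_cutoff_yukawa) (use e in auto)
  have step: "(LINT y|lebesgue. u y * \<Psi> n (sqdist y a)) = (LINT y|lebesgue. f y * \<phi> n y)" for n
  proof -
    have \<phi>L: "\<phi> n \<in> L2" using test by (rule test_function_L2)
    have LL: "(\<lambda>y. \<Sum>i\<in>UNIV. partial i (partial i (\<phi> n)) y) \<in> L2"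
      by (intro L2_sum test_function_L2 test_function_partial test)
    have "(LINT y|lebesgue. u y * \<Psi> n (sqdist y a))
        = (LINT y|lebesgue. \<kappa>\<^sup>2 * (u y * \<phi> n y) - u y * (\<Sum>i\<in>UNIV. partial i (partial i (\<phi> n)) y))"
      unfolding eq [symmetric] by (intro Bochner_Integration.integral_cong refl) (simp add: algebra_simps)
    also have "\<dots> = (LINT y|lebesgue. \<kappa>\<^sup>2 * (u y * \<phi> n y)) + (LINT y|lebesgue. g y * \<phi> n y)"
      using neg_laplacian_test[OF ug test[of n]]
      by (subst Bochner_Integration.integral_diff) (auto intro!: L2_mult_integrable integrable_mult_right uL \<phi>L LL)
    also have "\<dots> = (LINT y|lebesgue. \<kappa>\<^sup>2 * (u y * \<phi> n y) + g y * \<phi> n y)"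
      by (rule Bochner_Integration.integral_add [symmetric]) (auto intro!: L2_mult_integrable integrable_mult_right uL gL \<phi>L)
    also have "\<dots> = (LINT y|lebesgue. f y * \<phi> n y)"
      unfolding \<kappa>(2) f_def by (intro Bochner_Integration.integral_cong refl) (simp add: algebra_simps)
    finally show ?thesis .
  qed
  define c where "c = Re \<kappa> / 2"
  define E where "E t = exp (- c * sqrt t)" for t
  have c: "c > 0" using \<kappa> by (simp add: c_def)
  obtain C where C: "\<And>n. C n \<ge> 0" "\<And>n t. t \<ge> 0 \<Longrightarrow> \<bar>cutoff n t\<bar> \<le> C n"
    using choice[of "\<lambda>n C. C \<ge> 0 \<and> (\<forall>t\<ge>0. \<bar>cutoff n t\<bar> \<le> C)"] cutoff_bounded by metis
  have "\<forall>n. \<exists>K. K \<ge> 0 \<and> (\<forall>t\<ge>0. (1 + t) * cmod (yukawa \<kappa> e n t) \<le> K * E t)"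
    using yukawa_decay[OF \<kappa>(1) e] unfolding E_def c_def by blast
  from choice[OF this] obtain K where K: "\<And>n. K n \<ge> 0"
    "\<And>n t. t \<ge> 0 \<Longrightarrow> (1 + t) * cmod (yukawa \<kappa> e n t) \<le> K n * E t"
    by blast
  have E0: "E t \<ge> 0" for t by (simp add: E_def)
  have Y1: "cmod (yukawa \<kappa> e n t) \<le> K n * E t" and Y2: "t * cmod (yukawa \<kappa> e n t) \<le> K n * E t" if "t \<ge> 0" for n t
  proof -
    have "0 \<le> t * cmod (yukawa \<kappa> e n t)" using that by simp
    thus "cmod (yukawa \<kappa> e n t) \<le> K n * E t" "t * cmod (yukawa \<kappa> e n t) \<le> K n * E t"
      using K(2)[OF that, of n] norm_ge_zero[of "yukawa \<kappa> e n t"] unfolding distrib_right by linarith+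
  qed
  define D where "D = e\<^sup>2 * ((cmod \<kappa>)\<^sup>2 * K 3 + 3 * cmod \<kappa> * K 4 + 3 * K 5)"
  have D: "cmod (delta_kernel \<kappa> e t) \<le> D * E t" if t: "t \<ge> 0" for t
  proof -
    have "cmod (\<kappa>\<^sup>2 * yukawa \<kappa> e 3 t + 3 * \<kappa> * yukawa \<kappa> e 4 t + 3 * yukawa \<kappa> e 5 t)
        \<le> (cmod \<kappa>)\<^sup>2 * (K 3 * E t) + 3 * cmod \<kappa> * (K 4 * E t) + 3 * (K 5 * E t)"
      by (intro norm_triangle_mono) (auto simp: norm_mult norm_power intro!: mult_left_mono Y1 t)
    hence "e\<^sup>2 * cmod (\<kappa>\<^sup>2 * yukawa \<kappa> e 3 t + 3 * \<kappa> * yukawa \<kappa> e 4 t + 3 * yukawa \<kappa> e 5 t)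
        \<le> e\<^sup>2 * ((cmod \<kappa>)\<^sup>2 * (K 3 * E t) + 3 * cmod \<kappa> * (K 4 * E t) + 3 * (K 5 * E t))"
      by (rule mult_left_mono) simp
    moreover have "cmod (delta_kernel \<kappa> e t)
        = e\<^sup>2 * cmod (\<kappa>\<^sup>2 * yukawa \<kappa> e 3 t + 3 * \<kappa> * yukawa \<kappa> e 4 t + 3 * yukawa \<kappa> e 5 t)"
      unfolding delta_kernel_def norm_mult[of "of_real (e\<^sup>2)"] norm_of_real by simp
    ultimately show ?thesis by (simp add: D_def algebra_simps)
  qed
  have "D \<ge> 0" using K by (simp add: D_def)
  define M where "M = C 0 * D + 6 * C 2 * K 1 + 4 * (2 * C 3 + C 4) * K 1 + 4 * C 2 * (cmod \<kappa> * K 2 + K 3)"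
  have bound: "cmod (\<Psi> n t) \<le> M * exp (- c * sqrt t)" if t: "t \<ge> 0" for n t
  proof -
    have t\<rho>: "t * \<rho> n \<ge> 0" using t \<rho> by simp
    have small: "cmod (of_real (\<rho> n) * w) \<le> B" if "cmod w \<le> B" for w B
      using mult_left_le_one_le[OF norm_ge_zero \<rho>(1)[of n] \<rho>(2)[of n], of w] that \<rho>(1)[of n]
      by (simp add: norm_mult)
    have nm: "cmod (v * w) \<le> A * B" if "cmod v \<le> A" "cmod w \<le> B" for v w A B
      unfolding norm_mult using that by (intro mult_mono) (auto intro: order_trans[OF norm_ge_zero])
    have b1: "cmod (of_real (cutoff 0 (t * \<rho> n)) * delta_kernel \<kappa> e t) \<le> C 0 * (D * E t)"
      unfolding norm_mult norm_of_real by (intro mult_mono C D t\<rho> t) (auto simp: C)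
    have b2: "cmod (6 * of_real (cutoff 2 (t * \<rho> n)) * yukawa \<kappa> e 1 t) \<le> 6 * C 2 * (K 1 * E t)"
      unfolding norm_mult norm_of_real norm_numeral by (intro mult_mono C Y1 t\<rho> t order_refl) (auto simp: C)
    have b3: "cmod (4 * of_real (\<rho> n) * (2 * of_real (cutoff 3 (t * \<rho> n)) - of_real (cutoff 4 (t * \<rho> n))) * (of_real t * yukawa \<kappa> e 1 t))
        \<le> 4 * (2 * C 3 + C 4) * (K 1 * E t)"
    proof -
      have cc: "cmod (2 * of_real (cutoff 3 (t * \<rho> n)) - of_real (cutoff 4 (t * \<rho> n))) \<le> 2 * C 3 + C 4"
        using C(2)[OF t\<rho>, of 3] C(2)[OF t\<rho>, of 4]
          norm_triangle_ineq4[of "2 * complex_of_real (cutoff 3 (t * \<rho> n))" "of_real (cutoff 4 (t * \<rho> n))"]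
        by (simp add: norm_mult)
      have c\<rho>: "cmod (4 * of_real (\<rho> n)) \<le> 4" using \<rho>[of n] by (simp add: norm_mult)
      have "cmod (of_real t * yukawa \<kappa> e 1 t) \<le> K 1 * E t"
        using t Y2[OF t, of 1] by (simp add: norm_mult)
      from nm[OF nm[OF c\<rho> cc] this] show ?thesis .
    qed
    have b4: "cmod (4 * of_real (cutoff 2 (t * \<rho> n)) * (of_real t * (\<kappa> * yukawa \<kappa> e 2 t + yukawa \<kappa> e 3 t)))
        \<le> 4 * C 2 * ((cmod \<kappa> * K 2 + K 3) * E t)"
    proof -
      have "cmod (of_real t * (\<kappa> * yukawa \<kappa> e 2 t + yukawa \<kappa> e 3 t))
          \<le> cmod \<kappa> * (t * cmod (yukawa \<kappa> e 2 t)) + t * cmod (yukawa \<kappa> e 3 t)"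
        using t norm_triangle_ineq[of "of_real t * (\<kappa> * yukawa \<kappa> e 2 t)" "of_real t * yukawa \<kappa> e 3 t"]
        by (simp add: norm_mult algebra_simps)
      also have "\<dots> \<le> cmod \<kappa> * (K 2 * E t) + K 3 * E t"
        by (intro add_mono mult_left_mono Y2 t) auto
      finally have "cmod (of_real t * (\<kappa> * yukawa \<kappa> e 2 t + yukawa \<kappa> e 3 t)) \<le> (cmod \<kappa> * K 2 + K 3) * E t"
        by (simp add: algebra_simps)
      moreover have "cmod (4 * of_real (cutoff 2 (t * \<rho> n))) \<le> 4 * C 2"
        using C(2)[OF t\<rho>, of 2] by (simp add: norm_mult)
      ultimately show ?thesis
        by (subst norm_mult, intro mult_mono) (auto simp: C)
    qed
    have "cmod (\<Psi> n t) \<le> C 0 * (D * E t) + 6 * C 2 * (K 1 * E t) + 4 * (2 * C 3 + C 4) * (K 1 * E t)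
        + 4 * C 2 * ((cmod \<kappa> * K 2 + K 3) * E t)"
      unfolding \<Psi>_def cutoff_profile_def by (intro order_trans[OF norm_triangle_ineq4] add_mono norm_triangle_mono b1 small b2 b3 b4)
    thus ?thesis by (simp add: M_def E_def algebra_simps)
  qed
  have cut: "(\<lambda>n. complex_of_real (cutoff k (t * \<rho> n))) \<longlonglongrightarrow> of_real (exp (- 1))" for k t
  proof -
    have "(\<lambda>n. t * \<rho> n) \<longlonglongrightarrow> t * 0" by (intro tendsto_intros \<rho>_lim)
    hence "(\<lambda>n. cutoff k (t * \<rho> n)) \<longlonglongrightarrow> cutoff k 0"
      using isCont_tendsto_compose[OF DERIV_isCont[OF cutoff_derivative[of k 0]]] by simp
    thus ?thesis unfolding cutoff_0 by (rule tendsto_of_real)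
  qed
  have \<rho>c: "(\<lambda>n. complex_of_real (\<rho> n)) \<longlonglongrightarrow> 0"
    using tendsto_of_real[OF \<rho>_lim] by simp
  have lim: "(\<lambda>n. \<Psi> n t) \<longlonglongrightarrow> of_real (exp (- 1)) * delta_kernel \<kappa> e t" for t
  proof -
    have "(\<lambda>n. \<Psi> n t) \<longlonglongrightarrow> of_real (exp (- 1)) * delta_kernel \<kappa> e t
      + 0 * (6 * of_real (exp (- 1)) * yukawa \<kappa> e 1 t)
      + 0 * (4 * 0 * (2 * of_real (exp (- 1)) - of_real (exp (- 1))) * (of_real t * yukawa \<kappa> e 1 t))
      - 0 * (4 * of_real (exp (- 1)) * (of_real t * (\<kappa> * yukawa \<kappa> e 2 t + yukawa \<kappa> e 3 t)))"
      unfolding \<Psi>_def cutoff_profile_def by (intro tendsto_intros cut \<rho>c)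
    thus ?thesis by simp
  qed
  have "(\<lambda>n. LINT y|lebesgue. u y * \<Psi> n (sqdist y a))
      \<longlonglongrightarrow> (LINT y|lebesgue. u y * (of_real (exp (- 1)) * delta_kernel \<kappa> e (sqdist y a)))"
    by (rule radial_dominated_convergence[OF _ _ c uL bound lim]) (unfold \<Psi>_def cutoff_profile_def[abs_def], measurable)
  moreover have "(\<lambda>n. LINT y|lebesgue. f y * \<phi> n y)
      \<longlonglongrightarrow> (LINT y|lebesgue. f y * (of_real (exp (- 1)) * yukawa \<kappa> e 1 (sqdist y a)))"
    unfolding \<phi>_def
  proof (rule radial_dominated_convergence[OF _ _ c fL, where C = "C 0 * K 1"])
    show "cmod (of_real (cutoff 0 (t / (real (Suc n))\<^sup>2)) * yukawa \<kappa> e 1 t) \<le> C 0 * K 1 * exp (- c * sqrt t)"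
      if "t \<ge> 0" for n t
      unfolding norm_mult norm_of_real mult.assoc E_def[symmetric] using that
      by (intro mult_mono C Y1) (auto simp: C)
    show "(\<lambda>n. of_real (cutoff 0 (t / (real (Suc n))\<^sup>2)) * yukawa \<kappa> e 1 t)
        \<longlonglongrightarrow> of_real (exp (- 1)) * yukawa \<kappa> e 1 t" for t
      using cut[of 0 t] unfolding \<rho>_def times_divide_eq_right mult_1_right by (rule tendsto_mult) (rule tendsto_const)
  qed measurable
  ultimately have "(LINT y|lebesgue. u y * (of_real (exp (- 1)) * delta_kernel \<kappa> e (sqdist y a)))
      = (LINT y|lebesgue. f y * (of_real (exp (- 1)) * yukawa \<kappa> e 1 (sqdist y a)))"
    unfolding step by (rule LIMSEQ_unique)
  hence "of_real (exp (- 1)) * (LINT y|lebesgue. u y * delta_kernel \<kappa> e (sqdist y a))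
      = of_real (exp (- 1)) * (LINT y|lebesgue. f y * yukawa \<kappa> e 1 (sqdist y a))"
    unfolding mult.left_commute[of _ "of_real (exp (- 1))"] integral_mult_right_zero .
  thus ?thesis
    by (simp add: f_def)
qed

subsection \<open>Removing the regularisation\<close>

text \<open>
  This is \<open>4\<pi>\<close> times the Green function, written in terms of \<open>\<kappa>\<close> with \<open>\<kappa>\<^sup>2 = -z\<close>; division by zero
  makes both vanish at the pole.
\<close>

definition radial_green :: "complex \<Rightarrow> wave" where
  "radial_green \<kappa> y = exp (- \<kappa> * of_real (norm y)) / of_real (norm y)"

lemma radial_green_measurable [measurable]: "radial_green \<kappa> \<in> borel_measurable borel"
  unfolding radial_green_def[abs_def] by measurable

lemma norm_radial_green: "cmod (radial_green \<kappa> y) = exp (- Re \<kappa> * norm y) / norm y"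
  by (simp add: radial_green_def norm_divide)

lemma radial_green_L2:
  assumes "Re \<kappa> > 0"
  shows "radial_green \<kappa> \<in> L2"
proof -
  have "(\<lambda>y. (cmod (radial_green \<kappa> y))\<^sup>2) = (\<lambda>y. exp (- (2 * Re \<kappa>) * norm y) / (norm y)\<^sup>2)"
    unfolding norm_radial_green by (auto simp: power_divide simp flip: exp_double)
  thus ?thesis
    using integrable_exp_over_square[of "2 * Re \<kappa>"] assms by (subst L2_borel_iff) auto
qed

lemma radial_green_integrable:
  assumes "Re \<kappa> > 0"
  shows "integrable lborel (radial_green \<kappa>)"
proof (rule Bochner_Integration.integrable_bound)
  define \<mu> where "\<mu> = Re \<kappa>"
  have \<mu>: "\<mu> > 0" using assms by (simp add: \<mu>_def)
  show "integrable lborel (\<lambda>y::real^3. (2 / \<mu>) * (exp (- (\<mu> / 2) * norm y) / (norm y)\<^sup>2))"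
    using \<mu> by (intro integrable_mult_right integrable_exp_over_square) auto
  have "exp (- \<mu> * r) / r \<le> (2 / \<mu>) * (exp (- (\<mu> / 2) * r) / r\<^sup>2)" if r: "r \<ge> 0" for r :: real
  proof -
    have "(\<mu> * r / 2) * exp (- \<mu> * r) \<le> exp (\<mu> * r / 2) * exp (- \<mu> * r)"
      using linear_le_exp[of "\<mu> / 2" r] \<mu> by (intro mult_right_mono) (auto simp: field_simps)
    also have "\<dots> = exp (- (\<mu> / 2) * r)" by (simp flip: exp_add)
    finally show ?thesis
      using \<mu> r by (cases "r = 0") (auto simp: field_simps power2_eq_square)
  qed
  thus "AE y in lborel. norm (radial_green \<kappa> y) \<le> norm ((2 / \<mu>) * (exp (- (\<mu> / 2) * norm y) / (norm y)\<^sup>2))"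
    unfolding norm_radial_green using \<mu> by (auto simp: \<mu>_def abs_mult)
qed measurable

lemma L2_pairing_bound:
  assumes "f \<in> L2" "h \<in> L2"
  shows "(cmod (LINT y|lebesgue. f y * h y))\<^sup>2 \<le> (L2_norm f)\<^sup>2 * (L2_norm h)\<^sup>2"
  using L2_Cauchy_Schwarz[OF assms(1) L2_cnj[OF assms(2)]] by (simp add: L2_inner_def L2_norm_def)

lemma yukawa_le_radial_green:
  assumes "Re \<kappa> > 0" "e > 0" "y \<noteq> 0"
  shows "cmod (yukawa \<kappa> e 1 ((norm y)\<^sup>2)) \<le> cmod (radial_green \<kappa> y)"
proof -
  have s: "norm y \<le> sqrt ((norm y)\<^sup>2 + e\<^sup>2)" by (rule real_le_rsqrt) simp
  have "exp (- Re \<kappa> * sqrt ((norm y)\<^sup>2 + e\<^sup>2)) / sqrt ((norm y)\<^sup>2 + e\<^sup>2) \<le> exp (- Re \<kappa> * norm y) / norm y"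
    using s assms by (intro frac_le) auto
  thus ?thesis
    using norm_yukawa[OF assms(2), of "(norm y)\<^sup>2" \<kappa> 1] by (simp add: norm_radial_green)
qed

lemma yukawa_L2:
  assumes "Re \<kappa> > 0" "e > 0"
  shows "(\<lambda>y. yukawa \<kappa> e n (sqdist y a)) \<in> L2"
proof -
  obtain C where C: "\<And>t. t \<ge> 0 \<Longrightarrow> (1 + t) * cmod (yukawa \<kappa> e n t) \<le> C * exp (- (Re \<kappa> / 2) * sqrt t)"
    using yukawa_decay[OF assms] by blast
  have "cmod (yukawa \<kappa> e n t) \<le> C * exp (- (Re \<kappa> / 2) * sqrt t)" if "t \<ge> 0" for t
    using C[OF that] mult_right_mono[of 1 "1 + t" "cmod (yukawa \<kappa> e n t)"] that by simp
  thus ?thesis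
    using assms by (intro radial_L2[of _ "Re \<kappa> / 2" C]) auto
qed

lemma yukawa_tendsto_radial_green:
  assumes "Re \<kappa> > 0"
  shows "(\<lambda>n. (L2_norm (\<lambda>y. yukawa \<kappa> (1 / real (Suc n)) 1 ((norm y)\<^sup>2) - radial_green \<kappa> y))\<^sup>2) \<longlonglongrightarrow> 0"
proof -
  define \<epsilon> where "\<epsilon> n = 1 / real (Suc n)" for n
  let ?Y = "\<lambda>n y. yukawa \<kappa> (\<epsilon> n) 1 ((norm (y::real^3))\<^sup>2)"
  have \<epsilon>: "\<epsilon> n > 0" for n by (simp add: \<epsilon>_def)
  have "(\<lambda>n. LINT y|lborel. (cmod (?Y n y - radial_green \<kappa> y))\<^sup>2)
      \<longlonglongrightarrow> (LINT y|(lborel :: (real^3) measure). (0::real))"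
  proof (rule integral_dominated_convergence)
    show "integrable lborel (\<lambda>y. 4 * (cmod (radial_green \<kappa> y))\<^sup>2)"
      using radial_green_L2[OF assms] by (simp add: L2_borel_iff)
    have ne: "AE y in lborel. (y::real^3) \<noteq> 0" by (rule AE_lborel_singleton)
    show "AE y in lborel. norm ((cmod (?Y n y - radial_green \<kappa> y))\<^sup>2)
        \<le> 4 * (cmod (radial_green \<kappa> y))\<^sup>2" for n
      using ne
    proof eventually_elim
      case (elim y)
      have "cmod (?Y n y - radial_green \<kappa> y) \<le> 2 * cmod (radial_green \<kappa> y)"
        using norm_triangle_ineq4[of "?Y n y" "radial_green \<kappa> y"]
          yukawa_le_radial_green[OF assms \<epsilon>[of n] elim] by linarith
      hence "(cmod (?Y n y - radial_green \<kappa> y))\<^sup>2 \<le> (2 * cmod (radial_green \<kappa> y))\<^sup>2"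
        by (intro power_mono) auto
      thus ?case by (simp add: power_mult_distrib)
    qed
    show "AE y in lborel. (\<lambda>n. (cmod (?Y n y - radial_green \<kappa> y))\<^sup>2) \<longlonglongrightarrow> 0"
      using ne
    proof eventually_elim
      case (elim y)
      have "\<epsilon> \<longlonglongrightarrow> 0" unfolding \<epsilon>_def by real_asymp
      hence "(\<lambda>n. sqrt ((norm y)\<^sup>2 + (\<epsilon> n)\<^sup>2)) \<longlonglongrightarrow> sqrt ((norm y)\<^sup>2 + 0\<^sup>2)"
        by (intro tendsto_intros)
      hence s: "(\<lambda>n. complex_of_real (sqrt ((norm y)\<^sup>2 + (\<epsilon> n)\<^sup>2))) \<longlonglongrightarrow> of_real (norm y)"
        by (intro tendsto_of_real) simp
      have "(\<lambda>n. ?Y n y) \<longlonglongrightarrow> exp (- \<kappa> * of_real (norm y)) / of_real (norm y) ^ 1"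
        unfolding yukawa_def by (intro tendsto_intros s) (use elim in auto)
      hence "(\<lambda>n. ?Y n y) \<longlonglongrightarrow> radial_green \<kappa> y"
        by (simp add: radial_green_def)
      from tendsto_power[OF tendsto_norm[OF tendsto_diff[OF this tendsto_const[of "radial_green \<kappa> y"]]], of 2]
      show ?case by simp
    qed
  qed measurable
  moreover have "(LINT y|lborel. (cmod (?Y n y - radial_green \<kappa> y))\<^sup>2)
      = (L2_norm (\<lambda>y. ?Y n y - radial_green \<kappa> y))\<^sup>2" for n
    unfolding L2_norm_sq by (rule integral_completion [symmetric]) measurable
  ultimately show ?thesis by (simp add: \<epsilon>_def)
qed

text \<open>
  By the Cauchy--Schwarz inequality and translation invariance, the error at each \<open>a\<close> is at most
  \<open>\<parallel>f\<parallel>\<close> times the distance of the two kernels in \<open>L\<^sup>2\<close>.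
\<close>

lemma green_convolution_uniform_limit:
  assumes \<kappa>: "Re \<kappa> > 0" and fL: "f \<in> L2"
  shows "uniform_limit UNIV (\<lambda>n a. LINT y|lebesgue. f y * yukawa \<kappa> (1 / real (Suc n)) 1 (sqdist y a))
    (\<lambda>a. LINT y|lebesgue. f y * radial_green \<kappa> (y - a)) sequentially"
proof -
  define \<epsilon> where "\<epsilon> n = 1 / real (Suc n)" for n
  let ?V = "\<lambda>n a. LINT y|lebesgue. f y * yukawa \<kappa> (\<epsilon> n) 1 (sqdist y a)"
  let ?v = "\<lambda>a. LINT y|lebesgue. f y * radial_green \<kappa> (y - a)"
  have \<epsilon>: "\<epsilon> n > 0" for n by (simp add: \<epsilon>_def)
  define N where "N n = (L2_norm f)\<^sup>2 * (L2_norm (\<lambda>y. yukawa \<kappa> (\<epsilon> n) 1 ((norm y)\<^sup>2) - radial_green \<kappa> y))\<^sup>2" for n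
  have N: "N \<longlonglongrightarrow> 0"
    using tendsto_mult_left[OF yukawa_tendsto_radial_green[OF \<kappa>], of "(L2_norm f)\<^sup>2"]
    unfolding N_def[abs_def] \<epsilon>_def by simp
  have bound: "(cmod (?V n a - ?v a))\<^sup>2 \<le> N n" for n a
  proof -
    have L: "(\<lambda>y. yukawa \<kappa> (\<epsilon> n) 1 ((norm y)\<^sup>2) - radial_green \<kappa> y) \<in> L2"
      using yukawa_L2[OF \<kappa> \<epsilon>, of n 1 0] by (intro L2_diff radial_green_L2 \<kappa>) simp
    have m: "(\<lambda>y. yukawa \<kappa> (\<epsilon> n) 1 ((norm (y::real^3))\<^sup>2) - radial_green \<kappa> y) \<in> borel_measurable borel"
      by measurable
    have "?V n a - ?v a
        = (LINT y|lebesgue. f y * (yukawa \<kappa> (\<epsilon> n) 1 (sqdist y a) - radial_green \<kappa> (y - a)))"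
      unfolding right_diff_distrib
      by (intro Bochner_Integration.integral_diff [symmetric] L2_mult_integrable fL yukawa_L2 \<kappa> \<epsilon>
          L2_translate(1)[OF radial_green_measurable radial_green_L2[OF \<kappa>]])
    thus ?thesis
      using L2_pairing_bound[OF fL L2_translate(1)[OF m L, of a]] L2_translate(2)[OF m L, of a]
      by (simp add: N_def)
  qed
  show ?thesis
    unfolding \<epsilon>_def[symmetric]
  proof (rule uniform_limitI)
    fix e :: real assume "e > 0"
    hence "eventually (\<lambda>n. N n < e\<^sup>2) sequentially"
      by (intro order_tendstoD(2)[OF N]) simp
    thus "\<forall>\<^sub>F n in sequentially. \<forall>a\<in>UNIV.
        dist (?V n a) (?v a) < e"
    proof eventually_elim
      case (elim n)
      show ?case
      proof
        fix a
        show "dist (?V n a) (?v a) < e"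
          unfolding dist_norm
          using le_less_trans[OF bound[of n a] elim] less_imp_le[OF \<open>e > 0\<close>] by (rule power2_less_imp_less)
      qed
    qed
  qed
qed

lemma yukawa_convolution_continuous:
  assumes \<kappa>: "Re \<kappa> > 0" and e: "e > 0" and fL: "f \<in> L2"
  shows "continuous_on UNIV (\<lambda>a. LINT y|lebesgue. f y * yukawa \<kappa> e n (sqdist y a))"
proof (intro continuous_at_imp_continuous_on ballI)
  fix a :: "real^3"
  let ?Y = "\<lambda>b y. yukawa \<kappa> e n (sqdist y b)"
  define c where "c = Re \<kappa> / 2"
  have c: "c > 0" using \<kappa> by (simp add: c_def)
  obtain C where C: "\<And>t. t \<ge> 0 \<Longrightarrow> (1 + t) * cmod (yukawa \<kappa> e n t) \<le> C * exp (- c * sqrt t)" "C \<ge> 0"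
    using yukawa_decay[OF \<kappa> e] unfolding c_def by blast
  have Y: "cmod (yukawa \<kappa> e n t) \<le> C * exp (- c * sqrt t)" if "t \<ge> 0" for t
    using C(1)[OF that] mult_right_mono[of 1 "1 + t" "cmod (yukawa \<kappa> e n t)"] that by simp
  show "isCont (\<lambda>a. LINT y|lebesgue. f y * ?Y a y) a"
    unfolding continuous_at_sequentially
  proof (intro allI impI)
    fix b assume b: "b \<longlonglongrightarrow> a"
    have "Bseq (\<lambda>i. b i - a)"
      using b by (intro convergent_imp_Bseq) (auto simp: convergent_def intro!: exI[of _ "a - a"] tendsto_diff)
    then obtain M where M: "\<And>i. norm (b i - a) \<le> M"
      unfolding Bseq_def by blast
    have "(\<lambda>i. LINT y|lebesgue. f y * ?Y (b i) y) \<longlonglongrightarrow> (LINT y|lebesgue. f y * ?Y a y)"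
    proof (rule integral_dominated_convergence)
      show "(\<lambda>y. f y * ?Y a y) \<in> borel_measurable lebesgue" for a
        by (intro borel_measurable_integrable L2_mult_integrable fL yukawa_L2 \<kappa> e)
      thus "(\<lambda>y. f y * ?Y (b i) y) \<in> borel_measurable lebesgue" for i .
      show "integrable lebesgue (\<lambda>y. cmod (f y * (of_real (C * exp (c * M)) * complex_of_real (exp (- c * norm (y - a))))))"
        by (intro integrable_norm L2_mult_integrable L2_cmult exp_decay_L2 fL c)
      have "cmod (?Y (b i) y) \<le> cmod (of_real (C * exp (c * M)) * complex_of_real (exp (- c * norm (y - a))))" for y i
      proof -
        have "norm (y - a) \<le> norm (y - b i) + norm (b i - a)"
          using norm_triangle_ineq[of "y - b i" "b i - a"] by simp
        hence "- norm (y - b i) \<le> M + - norm (y - a)"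
          using M[of i] by linarith
        hence "c * (- norm (y - b i)) \<le> c * (M + - norm (y - a))"
          using c by (intro mult_left_mono) auto
        hence "exp (- c * norm (y - b i)) \<le> exp (c * M) * exp (- c * norm (y - a))"
          unfolding exp_add [symmetric] by (simp add: algebra_simps)
        hence "C * exp (- c * norm (y - b i)) \<le> C * (exp (c * M) * exp (- c * norm (y - a)))"
          using C(2) by (rule mult_left_mono)
        thus ?thesis
          using Y[of "(norm (y - b i))\<^sup>2"] C(2) by (simp add: norm_mult mult.assoc)
      qed
      thus "AE y in lebesgue. norm (f y * ?Y (b i) y)
          \<le> cmod (f y * (of_real (C * exp (c * M)) * complex_of_real (exp (- c * norm (y - a)))))" for i
        unfolding norm_mult[of "f _"] by (intro always_eventually allI mult_left_mono) auto
      have "isCont (yukawa \<kappa> e n) t" if "t \<ge> 0" for t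
        using has_vector_derivative_continuous[OF yukawa_derivative[OF e that]] .
      hence "(\<lambda>i. ?Y (b i) y) \<longlonglongrightarrow> ?Y a y" for y
        by (rule isCont_tendsto_compose) (auto intro!: tendsto_intros b)
      thus "AE y in lebesgue. (\<lambda>i. f y * ?Y (b i) y) \<longlonglongrightarrow> f y * ?Y a y"
        by (intro always_eventually allI tendsto_intros)
    qed
    thus "((\<lambda>a. LINT y|lebesgue. f y * ?Y a y) \<circ> b) \<longlonglongrightarrow> (LINT y|lebesgue. f y * ?Y a y)"
      by (simp add: o_def)
  qed
qed

lemma green_convolution_continuous:
  assumes "Re \<kappa> > 0" "f \<in> L2"
  shows "continuous_on UNIV (\<lambda>a. LINT y|lebesgue. f y * radial_green \<kappa> (y - a))"
  by (rule uniform_limit_theorem[OF _ green_convolution_uniform_limit[OF assms]])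
     (use assms in \<open>auto intro!: always_eventually yukawa_convolution_continuous\<close>)

subsection \<open>The approximate identity\<close>

lemma L2_indicator_integrable:
  assumes "u \<in> borel_measurable borel" "u \<in> L2" "S \<in> sets borel" "emeasure lborel S < \<infinity>"
  shows "integrable lborel (\<lambda>y. indicator S y *\<^sub>R u y)"
    and "(LINT y|lborel. cmod (indicator S y *\<^sub>R u y)) \<le> measure lborel S + (LINT y|lborel. (cmod (u y))\<^sup>2)"
proof -
  note [measurable] = assms(1,3)
  have iS: "integrable lborel (indicator S :: _ \<Rightarrow> real)" using assms by simp
  have iu: "integrable lborel (\<lambda>y. (cmod (u y))\<^sup>2)" using assms by (simp add: L2_borel_iff)
  have le: "cmod (indicator S y *\<^sub>R u y) \<le> indicator S y + (cmod (u y))\<^sup>2" for y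
    using two_mult_le_squares[of 1 "cmod (u y)"] by (auto simp: indicator_def)
  show i: "integrable lborel (\<lambda>y. indicator S y *\<^sub>R u y)"
    by (rule Bochner_Integration.integrable_bound[OF Bochner_Integration.integrable_add[OF iS iu]])
       (use le in \<open>auto intro!: always_eventually\<close>)
  have "(LINT y|lborel. cmod (indicator S y *\<^sub>R u y)) \<le> (LINT y|lborel. indicator S y + (cmod (u y))\<^sup>2)"
    by (intro integral_mono integrable_norm[OF i] Bochner_Integration.integrable_add iS iu le)
  also have "\<dots> = measure lborel S + (LINT y|lborel. (cmod (u y))\<^sup>2)"
    using iS iu by (subst Bochner_Integration.integral_add) auto
  finally show "(LINT y|lborel. cmod (indicator S y *\<^sub>R u y)) \<le> measure lborel S + (LINT y|lborel. (cmod (u y))\<^sup>2)" .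
qed

lemma box_integral_translate:
  assumes [measurable]: "u \<in> borel_measurable borel" and uL: "u \<in> L2"
  shows "integrable lborel (\<lambda>a. indicator (box l h) a *\<^sub>R u (a + \<tau>))"
    and "(LINT a|lborel. cmod (indicator (box l h) a *\<^sub>R u (a + \<tau>)))
      \<le> measure lborel (box l h) + (LINT y|lborel. (cmod (u y))\<^sup>2)"
    and "(LINT a|lborel. indicator (box l h) a *\<^sub>R u (a + \<tau>)) = (LINT y|lborel. indicator (box l h) (y - \<tau>) *\<^sub>R u y)"
proof -
  have [measurable]: "(\<lambda>a. u (a + \<tau>)) \<in> borel_measurable borel" by measurable
  have L: "(\<lambda>a. u (a + \<tau>)) \<in> L2" using L2_translate(1)[OF assms, of "- \<tau>"] by simp
  have n: "(LINT y|lborel. (cmod (u (y + \<tau>)))\<^sup>2) = (LINT y|lborel. (cmod (u y))\<^sup>2)"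
    using lborel_integral_translate(1)[of "\<lambda>y. (cmod (u y))\<^sup>2" "- \<tau>"] by simp
  show "integrable lborel (\<lambda>a. indicator (box l h) a *\<^sub>R u (a + \<tau>))"
    by (rule L2_indicator_integrable(1)[OF _ L _ emeasure_bounded_finite[OF bounded_box]]) auto
  show "(LINT a|lborel. cmod (indicator (box l h) a *\<^sub>R u (a + \<tau>)))
      \<le> measure lborel (box l h) + (LINT y|lborel. (cmod (u y))\<^sup>2)"
    using L2_indicator_integrable(2)[OF _ L _ emeasure_bounded_finite[OF bounded_box[of l h]]] by (simp add: n)
  show "(LINT a|lborel. indicator (box l h) a *\<^sub>R u (a + \<tau>)) = (LINT y|lborel. indicator (box l h) (y - \<tau>) *\<^sub>R u y)"
    using lborel_integral_translate(1)[of "\<lambda>a. indicator (box l h) a *\<^sub>R u (a + \<tau>)" \<tau>] by simp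
qed

lemma AE_indicator_box_translate_tendsto:
  fixes l h :: "real^3"
  assumes "\<tau> \<longlonglongrightarrow> 0"
  shows "AE y in lborel. (\<lambda>n. indicator (box l h) (y - \<tau> n)) \<longlonglongrightarrow> (indicator (box l h) y :: real)"
proof -
  have "cbox l h - box l h \<in> null_sets lborel"
    using negligible_frontier_interval[of l h] by (simp add: negligible_iff_null_sets null_sets_completion_iff)
  hence "AE y in lborel. y \<notin> cbox l h - box l h" by (rule AE_not_in)
  thus ?thesis
  proof eventually_elim
    case (elim y)
    have lim: "(\<lambda>n. y - \<tau> n) \<longlonglongrightarrow> y" using tendsto_diff[OF tendsto_const[of y] assms] by simp
    consider "y \<in> box l h" | "y \<in> - cbox l h" using elim by auto
    thus ?case
    proof cases
      case 1
      have "eventually (\<lambda>n. y - \<tau> n \<in> box l h) sequentially"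
        using topological_tendstoD[OF lim open_box 1] .
      thus ?thesis using 1 by (intro tendsto_eventually) (auto elim!: eventually_mono)
    next
      case 2
      have "eventually (\<lambda>n. y - \<tau> n \<in> - cbox l h) sequentially"
        using topological_tendstoD[OF lim _ 2] by (simp add: closed_cbox open_Compl)
      thus ?thesis using 2 box_subset_cbox[of l h]
        by (intro tendsto_eventually) (auto elim!: eventually_mono simp: indicator_def)
    qed
  qed
qed

text \<open>
  After the translation is moved to the box, dominated convergence applies, as the boundary of a box is
  a null set.
\<close>

lemma box_integral_translate_tendsto:
  fixes l h :: "real^3"
  assumes [measurable]: "u \<in> borel_measurable borel" and uL: "u \<in> L2" and \<tau>: "\<tau> \<longlonglongrightarrow> 0"
  shows "(\<lambda>n. LINT a|lborel. indicator (box l h) a *\<^sub>R u (a + \<tau> n)) \<longlonglongrightarrow> (LINT a|lborel. indicator (box l h) a *\<^sub>R u a)"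
proof -
  obtain M where M: "\<And>n. norm (\<tau> n) \<le> M"
    using convergent_imp_Bseq[of \<tau>] \<tau> by (auto simp: convergent_def Bseq_def)
  obtain r where r: "\<And>y. y \<in> box l h \<Longrightarrow> norm y \<le> r"
    using bounded_box[of l h] by (auto simp: bounded_iff)
  show ?thesis
    unfolding box_integral_translate(3)[OF assms(1,2)]
  proof (rule integral_dominated_convergence)
    show "integrable lborel (\<lambda>y. cmod (indicator (cball 0 (r + M)) y *\<^sub>R u y))"
      by (intro integrable_norm L2_indicator_integrable(1) uL emeasure_bounded_finite bounded_cball) auto
    have "indicator (box l h) (y - \<tau> n) \<le> (indicator (cball 0 (r + M)) y :: real)" for y n
    proof -
      have "y \<in> cball 0 (r + M)" if "y - \<tau> n \<in> box l h"
      proof -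
        have "norm (y - \<tau> n) \<le> r" using that by (rule r)
        thus ?thesis using norm_triangle_ineq[of "y - \<tau> n" "\<tau> n"] M[of n] by simp
      qed
      thus ?thesis by (auto simp: indicator_def)
    qed
    thus "AE y in lborel. norm (indicator (box l h) (y - \<tau> n) *\<^sub>R u y) \<le> cmod (indicator (cball 0 (r + M)) y *\<^sub>R u y)" for n
      by (auto intro!: always_eventually mult_right_mono)
    show "AE y in lborel. (\<lambda>n. indicator (box l h) (y - \<tau> n) *\<^sub>R u y) \<longlonglongrightarrow> indicator (box l h) y *\<^sub>R u y"
      using AE_indicator_box_translate_tendsto[OF \<tau>, of l h] by eventually_elim (intro tendsto_intros)
  qed measurable
qed

text \<open>
  The approximate identity after rescaling to unit width, see \<open>delta_kernel_scale\<close>.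
\<close>

definition delta_profile :: "complex \<Rightarrow> real \<Rightarrow> real^3 \<Rightarrow> complex" where
  "delta_profile \<kappa> e t = (let \<sigma> = sqrt (1 + (norm t)\<^sup>2); w = \<kappa> * of_real (e * \<sigma>)
     in (w\<^sup>2 + 3 * w + 3) * exp (- w) / of_real (\<sigma> ^ 5))"

lemma delta_profile_measurable [measurable]: "delta_profile \<kappa> e \<in> borel_measurable borel"
  unfolding delta_profile_def[abs_def] Let_def by measurable

lemma delta_kernel_scale:
  assumes "e > 0"
  shows "of_real (e ^ 3) * delta_kernel \<kappa> e ((norm (e *\<^sub>R t))\<^sup>2) = delta_profile \<kappa> e t"
proof -
  define \<sigma> where "\<sigma> = sqrt (1 + (norm t)\<^sup>2)"
  have \<sigma>: "\<sigma> > 0" by (simp add: \<sigma>_def add_pos_nonneg)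
  have "sqrt ((norm (e *\<^sub>R t))\<^sup>2 + e\<^sup>2) = sqrt (e\<^sup>2 * (1 + (norm t)\<^sup>2))"
    by (simp add: power_mult_distrib algebra_simps)
  also have "\<dots> = e * \<sigma>" using assms by (simp add: real_sqrt_mult \<sigma>_def)
  finally have s: "sqrt ((norm (e *\<^sub>R t))\<^sup>2 + e\<^sup>2) = e * \<sigma>" .
  define E S where "E = complex_of_real e" and "S = complex_of_real \<sigma>"
  have "E \<noteq> 0" "S \<noteq> 0" using assms \<sigma> by (auto simp: E_def S_def)
  thus ?thesis
    unfolding delta_kernel_def yukawa_def s delta_profile_def Let_def \<sigma>_def[symmetric] of_real_mult of_real_power
      E_def[symmetric] S_def[symmetric]
    by (simp add: field_simps eval_nat_numeral)
qed

lemma delta_profile_bound: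
  assumes \<kappa>: "Re \<kappa> > 0"
  shows "\<exists>C\<ge>0. \<forall>e>0. \<forall>t. cmod (delta_profile \<kappa> e t) \<le> C * (1 / sqrt (1 + (norm t)\<^sup>2) ^ 5)"
proof -
  define \<mu> where "\<mu> = Re \<kappa>"
  define C where "C = (cmod \<kappa>)\<^sup>2 * (2 / \<mu>)\<^sup>2 + 3 * cmod \<kappa> * (1 / \<mu>) + 3"
  have \<mu>: "\<mu> > 0" using \<kappa> by (simp add: \<mu>_def)
  have "cmod (delta_profile \<kappa> e t) \<le> C * (1 / sqrt (1 + (norm t)\<^sup>2) ^ 5)" if e: "e > 0" for e t
  proof -
    define \<sigma> where "\<sigma> = sqrt (1 + (norm t)\<^sup>2)"
    have \<sigma>: "\<sigma> > 0" by (simp add: \<sigma>_def add_pos_nonneg)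
    define x where "x = e * \<sigma>"
    have x: "x > 0" using e \<sigma> by (simp add: x_def)
    have 1: "x \<le> (1 / \<mu>) * exp (\<mu> * x)" by (rule linear_le_exp[OF \<mu>])
    have 2: "x\<^sup>2 \<le> (2 / \<mu>)\<^sup>2 * exp (\<mu> * x)" using square_le_exp[OF \<mu>] x by simp
    have 3: "1 \<le> exp (\<mu> * x)" using \<mu> x by simp
    define w where "w = \<kappa> * of_real x"
    have cw: "cmod w = cmod \<kappa> * x" using x by (simp add: w_def norm_mult)
    have "cmod (w\<^sup>2 + 3 * w + 3) \<le> (cmod \<kappa>)\<^sup>2 * x\<^sup>2 + 3 * cmod \<kappa> * x + 3 * 1"
      by (intro norm_triangle_mono) (auto simp: norm_mult norm_power cw power_mult_distrib)
    also have "\<dots> \<le> (cmod \<kappa>)\<^sup>2 * ((2 / \<mu>)\<^sup>2 * exp (\<mu> * x)) + 3 * cmod \<kappa> * ((1 / \<mu>) * exp (\<mu> * x)) + 3 * exp (\<mu> * x)"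
      by (intro add_mono mult_left_mono 1 2 3) auto
    also have "\<dots> = C * exp (\<mu> * x)" by (simp add: C_def algebra_simps)
    finally have "cmod (w\<^sup>2 + 3 * w + 3) * exp (- (\<mu> * x)) \<le> C * exp (\<mu> * x) * exp (- (\<mu> * x))"
      by (rule mult_right_mono) simp
    also have "\<dots> = C" by (simp add: exp_minus)
    finally have "cmod (w\<^sup>2 + 3 * w + 3) * exp (- (\<mu> * x)) / \<sigma> ^ 5 \<le> C / \<sigma> ^ 5"
      using \<sigma> by (intro divide_right_mono) auto
    moreover have "cmod (delta_profile \<kappa> e t) = cmod (w\<^sup>2 + 3 * w + 3) * exp (- (\<mu> * x)) / \<sigma> ^ 5"
    proof -
      have [simp]: "Re w = \<mu> * x" by (simp add: w_def \<mu>_def)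
      show ?thesis
        unfolding delta_profile_def Let_def \<sigma>_def[symmetric] x_def[symmetric] w_def[symmetric]
        using \<sigma> by (simp add: norm_mult norm_divide norm_power)
    qed
    ultimately show ?thesis by (simp add: \<sigma>_def)
  qed
  moreover have "C \<ge> 0" using \<mu> by (simp add: C_def)
  ultimately show ?thesis by blast
qed

lemma delta_profile_tendsto:
  assumes "\<epsilon> \<longlonglongrightarrow> 0"
  shows "(\<lambda>n. delta_profile \<kappa> (\<epsilon> n) t) \<longlonglongrightarrow> of_real (3 * (1 / sqrt (1 + (norm t)\<^sup>2) ^ 5))"
proof -
  define \<sigma> where "\<sigma> = sqrt (1 + (norm t)\<^sup>2)"
  have \<sigma>: "\<sigma> > 0" by (simp add: \<sigma>_def add_pos_nonneg)
  have "(\<lambda>n. complex_of_real (\<epsilon> n * \<sigma>)) \<longlonglongrightarrow> of_real (0 * \<sigma>)"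
    by (intro tendsto_of_real tendsto_intros assms)
  hence w: "(\<lambda>n. \<kappa> * of_real (\<epsilon> n * \<sigma>)) \<longlonglongrightarrow> 0"
    using tendsto_mult[OF tendsto_const[of \<kappa>]] by fastforce
  have "(\<lambda>n. ((W n)\<^sup>2 + 3 * W n + 3) * exp (- W n) / of_real (\<sigma> ^ 5))
      \<longlonglongrightarrow> (0\<^sup>2 + 3 * 0 + 3) * exp (- 0) / complex_of_real (\<sigma> ^ 5)" if "W \<longlonglongrightarrow> 0" for W
    using that \<sigma> by (intro tendsto_intros) auto
  from this[OF w] have "(\<lambda>n. delta_profile \<kappa> (\<epsilon> n) t) \<longlonglongrightarrow> (0\<^sup>2 + 3 * 0 + 3) * exp (- 0) / of_real (\<sigma> ^ 5)"
    unfolding delta_profile_def Let_def \<sigma>_def[symmetric] .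
  thus ?thesis by (simp add: \<sigma>_def)
qed

text \<open>
  Substituting \<open>y = a + \<epsilon> t\<close> and exchanging the integrals leaves the profile at \<open>t\<close> times the integral of \<open>u\<close> over the
  box shifted by \<open>\<epsilon> t\<close>.  The first factor tends to \<open>3 (1 + |t|\<^sup>2)\<^bsup>-5/2\<^esup>\<close>, of mass \<open>4\<pi>\<close>, and is
  dominated by a multiple of it; the second is bounded and tends to the integral over the box itself.
\<close>

lemma box_integral_delta_kernel:
  fixes l h :: "real^3"
  assumes \<kappa>: "Re \<kappa> > 0" and [measurable]: "u \<in> borel_measurable borel" and uL: "u \<in> L2"
    and \<epsilon>: "\<epsilon> \<longlonglongrightarrow> 0" "\<And>n. \<epsilon> n > 0"
  shows "(\<lambda>n. LINT a|lborel. indicator (box l h) a *\<^sub>R (LINT y|lborel. u y * delta_kernel \<kappa> (\<epsilon> n) (sqdist y a)))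
    \<longlonglongrightarrow> of_real (4 * pi) * (LINT a|lborel. indicator (box l h) a *\<^sub>R u a)"
proof -
  let ?w = "\<lambda>e t a. indicator (box l h) a *\<^sub>R u (a + e *\<^sub>R t)"
  let ?U = "\<lambda>e a. LINT y|lborel. u y * delta_kernel \<kappa> e (sqdist y a)"
  define A where "A \<tau> = (LINT a|lborel. indicator (box l h) a *\<^sub>R u (a + \<tau>))" for \<tau>
  define M where "M = measure lborel (box l h) + (LINT y|lborel. (cmod (u y))\<^sup>2)"
  define W where "W t = 1 / sqrt (1 + (norm t)\<^sup>2) ^ 5" for t :: "real^3"
  obtain C where C: "C \<ge> 0" "\<And>e t. e > 0 \<Longrightarrow> cmod (delta_profile \<kappa> e t) \<le> C * W t"
    using delta_profile_bound[OF \<kappa>] unfolding W_def by blast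
  have iW: "integrable lborel W" and vW: "(LINT t|lborel. W t) = 4 / 3 * pi"
    using integral_inverse_sqrt_power5 unfolding W_def[abs_def] by (auto simp: has_bochner_integral_iff)
  have W0: "W t \<ge> 0" for t by (simp add: W_def)
  have [measurable]: "W \<in> borel_measurable borel" unfolding W_def[abs_def] by measurable
  have A_bound: "cmod (A \<tau>) \<le> M" for \<tau>
  proof -
    have "cmod (A \<tau>) \<le> (LINT a|lborel. cmod (indicator (box l h) a *\<^sub>R u (a + \<tau>)))"
      unfolding A_def by (rule integral_norm_bound)
    also have "\<dots> \<le> M"
      unfolding M_def by (rule box_integral_translate(2)[OF assms(2) uL])
    finally show ?thesis .
  qed
  have M0: "M \<ge> 0" using order_trans[OF norm_ge_zero A_bound] .
  have [measurable]: "A \<in> borel_measurable borel" unfolding A_def[abs_def] by measurable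
  have k: "integrable lborel (delta_profile \<kappa> e)" if "e > 0" for e
    by (rule Bochner_Integration.integrable_bound[OF integrable_mult_right[OF iW, of C]])
       (use C that W0 in \<open>auto simp: abs_mult\<close>)
  have eq: "(LINT a|lborel. indicator (box l h) a *\<^sub>R ?U e a)
      = (LINT t|lborel. delta_profile \<kappa> e t * A (e *\<^sub>R t))" if e: "e > 0" for e
  proof -
    have inner: "?U e a = (LINT t|lborel. u (a + e *\<^sub>R t) * delta_profile \<kappa> e t)" for a
    proof -
      have "?U e a
          = (LINT t|lborel. e ^ 3 *\<^sub>R (u (a + e *\<^sub>R t) * delta_kernel \<kappa> e ((norm (e *\<^sub>R t))\<^sup>2)))"
        using lborel_integral_scale[OF _ e, of "\<lambda>y. u y * delta_kernel \<kappa> e (sqdist y a)" a] by simp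
      also have "\<dots> = (LINT t|lborel. u (a + e *\<^sub>R t) * delta_profile \<kappa> e t)"
        unfolding delta_kernel_scale[OF e, symmetric]
        by (intro Bochner_Integration.integral_cong refl) (simp add: scaleR_conv_of_real)
      finally show ?thesis .
    qed
    have int: "integrable (lborel \<Otimes>\<^sub>M lborel) (\<lambda>(t, a). delta_profile \<kappa> e t * (?w e t a))"
    proof (rule lborel_pair.Fubini_integrable)
      have i: "integrable lborel (\<lambda>a. ?w e t a)" for t
        by (rule box_integral_translate(1)[OF assms(2) uL])
      show "AE t in lborel. integrable lborel (\<lambda>a. case (t, a) of (t, a) \<Rightarrow> delta_profile \<kappa> e t * (?w e t a))"
        unfolding prod.case by (intro always_eventually allI integrable_mult_right i)
      have eq: "(LINT a|lborel. norm (delta_profile \<kappa> e t * (?w e t a)))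
          = cmod (delta_profile \<kappa> e t) * (LINT a|lborel. cmod (?w e t a))" for t
        unfolding norm_mult by simp
      have "integrable lborel (\<lambda>t. cmod (delta_profile \<kappa> e t) * (LINT a|lborel. cmod (?w e t a)))"
      proof (rule Bochner_Integration.integrable_bound)
        show "integrable lborel (\<lambda>t. cmod (delta_profile \<kappa> e t) * M)"
          by (intro integrable_mult_left integrable_norm k e)
        have "(LINT a|lborel. cmod (?w e t a)) \<le> M" for t
          unfolding M_def by (rule box_integral_translate(2)[OF assms(2) uL])
        thus "AE t in lborel. norm (cmod (delta_profile \<kappa> e t) * (LINT a|lborel. cmod (?w e t a)))
            \<le> norm (cmod (delta_profile \<kappa> e t) * M)"
          using M0 by (intro always_eventually allI) (simp add: abs_mult mult_left_mono del: norm_scaleR)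
      qed measurable
      thus "integrable lborel (\<lambda>t. LINT a|lborel. norm (case (t, a) of (t, a) \<Rightarrow> delta_profile \<kappa> e t * (?w e t a)))"
        unfolding prod.case eq .
    qed measurable
    have "(LINT a|lborel. indicator (box l h) a *\<^sub>R ?U e a)
        = (LINT a|lborel. LINT t|lborel. delta_profile \<kappa> e t * (?w e t a))"
      unfolding inner by (simp flip: integral_scaleR_right add: mult.commute)
    also have "\<dots> = (LINT t|lborel. LINT a|lborel. delta_profile \<kappa> e t * (?w e t a))"
      by (rule lborel_pair.Fubini_integral[OF int])
    also have "\<dots> = (LINT t|lborel. delta_profile \<kappa> e t * A (e *\<^sub>R t))"
      unfolding A_def integral_mult_right_zero ..
    finally show ?thesis .
  qed
  have "(\<lambda>n. LINT t|lborel. delta_profile \<kappa> (\<epsilon> n) t * A (\<epsilon> n *\<^sub>R t)) \<longlonglongrightarrow> (LINT t|lborel. of_real (3 * W t) * A 0)"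
  proof (rule integral_dominated_convergence)
    show "integrable lborel (\<lambda>t. C * W t * M)"
      by (intro integrable_mult_left integrable_mult_right iW)
    show "AE t in lborel. norm (delta_profile \<kappa> (\<epsilon> n) t * A (\<epsilon> n *\<^sub>R t)) \<le> C * W t * M" for n
      unfolding norm_mult using C W0 \<epsilon>(2)
      by (intro always_eventually allI mult_mono A_bound) auto
    show "AE t in lborel. (\<lambda>n. delta_profile \<kappa> (\<epsilon> n) t * A (\<epsilon> n *\<^sub>R t)) \<longlonglongrightarrow> of_real (3 * W t) * A 0"
    proof (intro always_eventually allI tendsto_mult)
      fix t
      show "(\<lambda>n. delta_profile \<kappa> (\<epsilon> n) t) \<longlonglongrightarrow> of_real (3 * W t)"
        unfolding W_def by (rule delta_profile_tendsto[OF \<epsilon>(1)])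
      have "(\<lambda>n. \<epsilon> n *\<^sub>R t) \<longlonglongrightarrow> 0" using tendsto_scaleR[OF \<epsilon>(1) tendsto_const[of t]] by simp
      thus "(\<lambda>n. A (\<epsilon> n *\<^sub>R t)) \<longlonglongrightarrow> A 0"
        using box_integral_translate_tendsto[OF assms(2) uL] unfolding A_def by simp
    qed
  qed measurable
  moreover have "(LINT t|lborel. of_real (3 * W t) * A 0) = of_real (4 * pi) * A 0"
    unfolding integral_mult_left_zero integral_complex_of_real integral_mult_right_zero vW by simp
  ultimately show ?thesis
    unfolding eq[OF \<epsilon>(2)] by (simp only: A_def add_0_right)
qed

text \<open>
  As \<open>\<epsilon> \<rightarrow> 0\<close> the right-hand side of \<open>helmholtz_regularised\<close> converges uniformly in \<open>a\<close>.  The left-hand side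
  converges only in a weak sense, so both are compared through their integrals over boxes.
\<close>

theorem green_representation:
  assumes ug: "(u, g) \<in> neg_laplacian" and \<kappa>: "Re \<kappa> > 0" "\<kappa>\<^sup>2 = - z"
  shows "AE a in lebesgue. of_real (4 * pi) * u a = (LINT y|lebesgue. (g y - z * u y) * radial_green \<kappa> (y - a))"
proof -
  let ?B = "\<lambda>l h. indicator (box l h) :: real^3 \<Rightarrow> real"
  have uL: "u \<in> L2" and gL: "g \<in> L2"
    using ug by (auto simp: neg_laplacian_def eval_nat_numeral)
  define f where "f = (\<lambda>y. g y - z * u y)"
  have fL: "f \<in> L2" unfolding f_def by (intro L2_diff L2_cmult uL gL)
  obtain u' where u': "u' \<in> borel_measurable borel" "u' \<in> L2" "AE y in lebesgue. u y = u' y"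
    using L2_borel_representative[OF uL] .
  note [measurable] = u'(1)
  define \<epsilon> where "\<epsilon> n = 1 / real (Suc n)" for n
  have \<epsilon>: "\<epsilon> n > 0" for n by (simp add: \<epsilon>_def)
  have \<epsilon>0: "\<epsilon> \<longlonglongrightarrow> 0" unfolding \<epsilon>_def by real_asymp
  define V where "V n a = (LINT y|lebesgue. f y * yukawa \<kappa> (\<epsilon> n) 1 (sqdist y a))" for n a
  define v where "v a = (LINT y|lebesgue. f y * radial_green \<kappa> (y - a))" for a
  have VU: "V n a = (LINT y|lborel. u' y * delta_kernel \<kappa> (\<epsilon> n) (sqdist y a))" for n a
  proof -
    have "V n a = (LINT y|lebesgue. delta_kernel \<kappa> (\<epsilon> n) (sqdist y a) * u y)"
      using helmholtz_regularised[OF ug \<kappa> \<epsilon>, of n a] by (simp add: V_def f_def mult.commute)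
    also have "\<dots> = (LINT y|lborel. delta_kernel \<kappa> (\<epsilon> n) (sqdist y a) * u' y)"
      by (rule integral_borel_representative[OF _ uL u'(1,3)]) measurable
    finally show ?thesis by (simp add: mult.commute)
  qed
  have unif: "uniform_limit UNIV V v sequentially"
    using green_convolution_uniform_limit[OF \<kappa>(1) fL] unfolding V_def[abs_def] v_def[abs_def] \<epsilon>_def .
  have Vc: "continuous_on UNIV (V n)" for n
    unfolding V_def[abs_def] by (rule yukawa_convolution_continuous[OF \<kappa>(1) \<epsilon> fL])
  have vc: "continuous_on UNIV v"
    unfolding v_def[abs_def] by (rule green_convolution_continuous[OF \<kappa>(1) fL])
  have [measurable]: "V n \<in> borel_measurable borel" for n by (rule borel_measurable_continuous_onI[OF Vc])
  have [measurable]: "v \<in> borel_measurable borel" by (rule borel_measurable_continuous_onI[OF vc])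
  have ic: "integrable lborel (\<lambda>a. ?B l h a *\<^sub>R w a)" if "continuous_on UNIV w"
    for l h :: "real^3" and w :: "real^3 \<Rightarrow> 'b::{banach, second_countable_topology}"
  proof -
    have [measurable]: "w \<in> borel_measurable borel" by (rule borel_measurable_continuous_onI[OF that])
    have "integrable lborel (\<lambda>a. indicator (cbox l h) a *\<^sub>R w a)"
      by (intro borel_integrable_compact compact_cbox continuous_on_subset[OF that]) auto
    thus ?thesis
      by (rule Bochner_Integration.integrable_bound)
         (use box_subset_cbox[of l h] in \<open>auto simp: indicator_def intro!: always_eventually\<close>)
  qed
  have box_lim: "(\<lambda>n. LINT a|lborel. ?B l h a *\<^sub>R V n a) \<longlonglongrightarrow> (LINT a|lborel. ?B l h a *\<^sub>R v a)" for l h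
  proof -
    obtain N where N: "\<And>n a. n \<ge> N \<Longrightarrow> dist (V n a) (v a) < 1"
      using uniform_limitD[OF unif, of 1] by (auto simp: eventually_sequentially)
    have "(\<lambda>n. LINT a|lborel. ?B l h a *\<^sub>R V (n + N) a) \<longlonglongrightarrow> (LINT a|lborel. ?B l h a *\<^sub>R v a)"
    proof (rule integral_dominated_convergence)
      show "integrable lborel (\<lambda>a. ?B l h a *\<^sub>R (cmod (v a) + 1))"
        by (intro ic continuous_intros vc)
      have "cmod (V (n + N) a) \<le> cmod (v a) + 1" for n a
        using N[of "n + N" a] norm_triangle_ineq2[of "V (n + N) a" "v a"] by (simp add: dist_norm)
      thus "AE a in lborel. norm (?B l h a *\<^sub>R V (n + N) a) \<le> ?B l h a *\<^sub>R (cmod (v a) + 1)" for n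
        by (auto intro!: always_eventually mult_left_mono)
      show "AE a in lborel. (\<lambda>n. ?B l h a *\<^sub>R V (n + N) a) \<longlonglongrightarrow> ?B l h a *\<^sub>R v a"
        by (intro always_eventually allI tendsto_intros LIMSEQ_ignore_initial_segment tendsto_uniform_limitI[OF unif]) auto
    qed measurable
    thus ?thesis by (rule LIMSEQ_offset)
  qed
  have iu: "integrable lborel (\<lambda>a. ?B l h a *\<^sub>R u' a)" for l h
    by (rule L2_indicator_integrable(1)[OF u'(1,2) _ emeasure_bounded_finite[OF bounded_box]]) auto
  have "AE a in lborel. of_real (4 * pi) * u' a - v a = 0"
  proof (rule AE_zero_of_boxes)
    fix l h :: "real^3"
    have i1: "integrable lborel (\<lambda>a. ?B l h a *\<^sub>R (of_real (4 * pi) * u' a))"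
      using integrable_mult_right[OF iu[of l h], of "of_real (4 * pi)"] by (simp add: scaleR_conv_of_real mult_ac)
    have i2: "integrable lborel (\<lambda>a. ?B l h a *\<^sub>R v a)" by (rule ic[OF vc])
    show "set_integrable lborel (box l h) (\<lambda>a. of_real (4 * pi) * u' a - v a)"
      unfolding set_integrable_def scaleR_diff_right by (intro Bochner_Integration.integrable_diff i1 i2)
    have "(\<lambda>n. LINT a|lborel. ?B l h a *\<^sub>R V n a) \<longlonglongrightarrow> of_real (4 * pi) * (LINT a|lborel. ?B l h a *\<^sub>R u' a)"
      unfolding VU by (rule box_integral_delta_kernel[OF \<kappa>(1) u'(1,2) \<epsilon>0 \<epsilon>])
    from LIMSEQ_unique[OF this box_lim]
    have "of_real (4 * pi) * (LINT a|lborel. ?B l h a *\<^sub>R u' a) = (LINT a|lborel. ?B l h a *\<^sub>R v a)" .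
    moreover have "(LINT a|lborel. ?B l h a *\<^sub>R (of_real (4 * pi) * u' a))
        = of_real (4 * pi) * (LINT a|lborel. ?B l h a *\<^sub>R u' a)"
      by (subst integral_mult_right_zero [symmetric])
         (intro Bochner_Integration.integral_cong refl, simp add: scaleR_conv_of_real mult_ac)
    ultimately show "set_lebesgue_integral lborel (box l h) (\<lambda>a. of_real (4 * pi) * u' a - v a) = 0"
      unfolding set_lebesgue_integral_def scaleR_diff_right
      by (subst Bochner_Integration.integral_diff[OF i1 i2]) simp
  qed
  hence "AE a in lebesgue. of_real (4 * pi) * u' a - v a = 0" by (rule AE_completion)
  with u'(3) show ?thesis
    by eventually_elim (simp add: v_def f_def)
qed

section \<open>The free resolvent\<close>

subsection \<open>The Green function off the positive half-line\<close>

abbreviation off_halfline :: "complex \<Rightarrow> bool" where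
  "off_halfline z \<equiv> z \<notin> complex_of_real ` {0..}"

lemma csqrt_minus_Re_pos:
  assumes "off_halfline z"
  shows "Re (csqrt (- z)) > 0"
proof (rule ccontr)
  assume "\<not> ?thesis"
  hence "Re (csqrt (- z)) = 0" using csqrt_principal[of "- z"] by auto
  hence "csqrt (- z) = \<i> * of_real (Im (csqrt (- z)))" by (simp add: complex_eq_iff)
  hence "(csqrt (- z))\<^sup>2 = (\<i> * of_real (Im (csqrt (- z))))\<^sup>2" by simp
  hence "z = of_real ((Im (csqrt (- z)))\<^sup>2)" by (simp add: power_mult_distrib)
  moreover have "(Im (csqrt (- z)))\<^sup>2 \<in> {0..}" by simp
  ultimately show False using assms by blast
qed

lemma green_eq_radial_green:
  "green (sqrt_up z) y = radial_green (csqrt (- z)) y / of_real (4 * pi)"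
proof -
  have "\<i> * sqrt_up z = - csqrt (- z)" by (simp add: sqrt_up_def)
  thus ?thesis by (simp add: green_def radial_green_def)
qed

lemma green_minus: "green k (- y) = green k y"
  by (simp add: green_def)

lemma sqrt_up_cnj:
  assumes "off_halfline z"
  shows "sqrt_up (cnj z) = - cnj (sqrt_up z)"
proof -
  have "csqrt (- cnj z) = cnj (csqrt (- z))"
    by (rule csqrt_unique) (use csqrt_minus_Re_pos[OF assms] in \<open>auto simp flip: complex_cnj_power\<close>)
  thus ?thesis by (simp add: sqrt_up_def)
qed

lemma cnj_green:
  assumes "off_halfline z"
  shows "cnj (green (sqrt_up z) y) = green (sqrt_up (cnj z)) y"
  unfolding sqrt_up_cnj[OF assms] by (simp add: green_def exp_cnj)

lemma green_L2:
  assumes "off_halfline z"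
  shows "(\<lambda>y. green (sqrt_up z) (y - a)) \<in> L2"
  using L2_cmult[OF L2_translate(1)[OF radial_green_measurable radial_green_L2[OF csqrt_minus_Re_pos[OF assms]]], of "1 / of_real (4 * pi)" a]
  by (simp add: green_eq_radial_green)

lemma green_integrable:
  assumes "off_halfline z"
  shows "green (sqrt_up z) \<in> borel_measurable borel" "integrable lborel (green (sqrt_up z))"
proof -
  have *: "green (sqrt_up z) = (\<lambda>y. radial_green (csqrt (- z)) y / of_real (4 * pi))"
    using green_eq_radial_green by blast
  show "green (sqrt_up z) \<in> borel_measurable borel" unfolding * by measurable
  show "integrable lborel (green (sqrt_up z))"
    unfolding * by (intro integrable_divide radial_green_integrable csqrt_minus_Re_pos assms)
qed

lemma isCont_green: "y \<noteq> 0 \<Longrightarrow> isCont (green k) y"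
  unfolding green_def[abs_def] by (intro continuous_intros) auto

subsection \<open>Continuous representatives\<close>

lemma open_null_set_empty:
  fixes S :: "(real^3) set"
  assumes "open S" "S \<in> null_sets lebesgue"
  shows "S = {}"
proof (rule ccontr)
  assume "S \<noteq> {}"
  then obtain a r where r: "r > 0" "ball a r \<subseteq> S"
    using \<open>open S\<close> by (meson equals0I open_contains_ball)
  have "ball a r \<in> null_sets lebesgue"
    using assms(2) r(2) by (rule null_sets_completion_subset[rotated])
  hence "emeasure lborel (ball a r) = 0" by (simp add: null_sets_completion_iff null_sets_def)
  moreover have "unit_ball_vol 3 * r ^ 3 > 0" using r(1) by simp
  ultimately show False using r(1) by (simp add: emeasure_ball)
qed

lemma continuous_AE_eq:
  fixes f g :: wave
  assumes "continuous_on UNIV f" "continuous_on UNIV g" "AE y in lebesgue. f y = g y"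
  shows "f = g"
proof -
  have op: "open {y. f y \<noteq> g y}" by (intro open_Collect_neq assms)
  obtain N where N: "N \<in> null_sets lebesgue" "{y \<in> space lebesgue. f y \<noteq> g y} \<subseteq> N"
    using assms(3) unfolding eventually_ae_filter by blast
  have "{y. f y \<noteq> g y} \<in> null_sets lebesgue"
    using null_sets_completion_subset[of _ N] N by simp
  from open_null_set_empty[OF op this] show ?thesis by auto
qed

text \<open>
  For \<open>h \<in> L\<^sup>2\<close> this is the continuous representative of the free resolvent applied to \<open>h\<close>; the point values in the
  resolvent formula are its values at the centres.
\<close>

definition green_potential :: "complex \<Rightarrow> wave \<Rightarrow> wave" where
  "green_potential z h a = (LINT w|lebesgue. green (sqrt_up z) (w - a) * h w)"

lemma green_potential_continuous:
  assumes "off_halfline z" "h \<in> L2"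
  shows "continuous_on UNIV (green_potential z h)"
proof -
  have "green_potential z h = (\<lambda>a. (LINT w|lebesgue. h w * radial_green (csqrt (- z)) (w - a)) / of_real (4 * pi))"
    by (auto simp: green_potential_def green_eq_radial_green mult.commute simp flip: integral_divide_zero)
  thus ?thesis
    using green_convolution_continuous[OF csqrt_minus_Re_pos[OF assms(1)] assms(2)]
    by (simp add: continuous_on_divide)
qed

lemma neg_laplacian_L2: "(u, g) \<in> neg_laplacian \<Longrightarrow> u \<in> L2 \<and> g \<in> L2"
  by (auto simp: neg_laplacian_def eval_nat_numeral)

lemma free_resolventE:
  assumes "(h, u) \<in> resolvent neg_laplacian z"
  obtains g where "(u, g) \<in> neg_laplacian" "AE y in lebesgue. h y = g y - z * u y" "h \<in> L2" "u \<in> L2" "g \<in> L2"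
proof -
  obtain g where g: "h \<in> L2" "(u, g) \<in> neg_laplacian" "AE y in lebesgue. h y = g y - z * u y"
    using assms unfolding resolvent_def by blast
  thus ?thesis using neg_laplacian_L2[OF g(2)] that by blast
qed

lemma free_resolvent_green_potential:
  assumes z: "off_halfline z" and hu: "(h, u) \<in> resolvent neg_laplacian z"
  shows "AE y in lebesgue. u y = green_potential z h y"
proof -
  obtain g where g: "(u, g) \<in> neg_laplacian" "AE y in lebesgue. h y = g y - z * u y" and L: "h \<in> L2" "u \<in> L2" "g \<in> L2"
    using free_resolventE[OF hu] .
  have \<kappa>: "Re (csqrt (- z)) > 0" by (rule csqrt_minus_Re_pos[OF z])
  have eq: "(LINT y|lebesgue. (g y - z * u y) * radial_green (csqrt (- z)) (y - a)) = of_real (4 * pi) * green_potential z h a" for a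
  proof -
    have m: "(\<lambda>y. radial_green (csqrt (- z)) (y - a)) \<in> L2"
      by (intro L2_translate(1) radial_green_measurable radial_green_L2 \<kappa>)
    have gu: "(\<lambda>y. g y - z * u y) \<in> L2" by (intro L2_diff L2_cmult L)
    have "(LINT y|lebesgue. (g y - z * u y) * radial_green (csqrt (- z)) (y - a)) = (LINT y|lebesgue. h y * radial_green (csqrt (- z)) (y - a))"
      using g(2) by (intro integral_cong_AE borel_measurable_times L2_measurable m gu L) (auto elim: eventually_mono)
    also have "\<dots> = of_real (4 * pi) * green_potential z h a"
      unfolding green_potential_def
      by (subst integral_mult_right_zero [symmetric], intro Bochner_Integration.integral_cong refl)
         (simp add: green_eq_radial_green)
    finally show ?thesis .
  qed
  have "AE a in lebesgue. of_real (4 * pi) * u a = of_real (4 * pi) * green_potential z h a"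
    using green_representation[OF g(1) \<kappa>, of z] unfolding eq by simp
  thus ?thesis by eventually_elim simp
qed

lemma L2_inner_green:
  assumes "off_halfline z"
  shows "L2_inner h (\<lambda>y. green (sqrt_up z) (y - a)) = green_potential (cnj z) h a"
  unfolding L2_inner_def green_potential_def cnj_green[OF assms] by (simp add: mult.commute)

text \<open>
  Both resolvents are convolutions, with kernels that are even and complex conjugate to each
  other; Fubini's theorem exchanges them.
\<close>

lemma free_resolvent_symmetric:
  assumes z: "off_halfline z"
    and hu: "(h, u) \<in> resolvent neg_laplacian z" and kv: "(k, v) \<in> resolvent neg_laplacian (cnj z)"
  shows "L2_inner k u = L2_inner v h"
proof -
  have z': "off_halfline (cnj z)"
  proof
    assume "cnj z \<in> complex_of_real ` {0..}"
    then obtain t where "t \<ge> 0" "cnj z = of_real t" by auto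
    hence "z = of_real t" by (metis complex_cnj_cnj complex_cnj_complex_of_real)
    thus False using z \<open>t \<ge> 0\<close> by auto
  qed
  have L: "h \<in> L2" "u \<in> L2" "k \<in> L2" "v \<in> L2"
    using hu kv by (auto elim!: free_resolventE)
  let ?K = "green (sqrt_up (cnj z))"
  have ml: "f \<in> borel_measurable lebesgue" if "continuous_on UNIV f" for f :: wave
    by (intro measurable_completion) (use borel_measurable_continuous_onI[OF that] in simp)
  have "L2_inner k u = (LINT a|lebesgue. k a * cnj (green_potential z h a))"
    unfolding L2_inner_def using free_resolvent_green_potential[OF z hu]
    by (intro integral_cong_AE borel_measurable_times L2_measurable[OF L(3)] L2_measurable[OF L2_cnj[OF L(2)]]
        ml continuous_on_cnj green_potential_continuous z L) (auto elim: eventually_mono)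
  also have "\<dots> = (LINT a|lebesgue. k a * (LINT y|lebesgue. ?K (y - a) * cnj (h y)))"
    unfolding green_potential_def by (simp flip: Bochner_Integration.integral_cnj add: cnj_green[OF z])
  also have "\<dots> = (LINT y|lebesgue. cnj (h y) * (LINT a|lebesgue. ?K (y - a) * k a))"
    by (rule kernel_Fubini[OF green_integrable[OF z'] L(3) L2_cnj[OF L(1)]])
  also have "\<dots> = (LINT y|lebesgue. cnj (h y) * green_potential (cnj z) k y)"
    unfolding green_potential_def by (subst green_minus [symmetric]) simp
  also have "\<dots> = L2_inner v h"
    unfolding L2_inner_def using free_resolvent_green_potential[OF z' kv]
    by (intro integral_cong_AE borel_measurable_times L2_measurable[OF L(4)] L2_measurable[OF L2_cnj[OF L(1)]]
        ml green_potential_continuous z' L) (auto elim!: eventually_mono simp: mult.commute)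
  finally show ?thesis .
qed

section \<open>The adjoint of the minimal operator\<close>

text \<open>
  The point values of \<open>u\<close> in the definition of \<open>H_min\<close> are those of the potential, since two
  continuous functions that agree almost everywhere are equal.
\<close>

lemma H_min_green_potential_zero:
  assumes z: "off_halfline z" and uv: "(u, v) \<in> H_min x"
  shows "((\<lambda>y. v y - z * u y), u) \<in> resolvent neg_laplacian z"
    and "green_potential z (\<lambda>y. v y - z * u y) (x j) = 0"
proof -
  obtain c where uv': "(u, v) \<in> neg_laplacian" and c: "continuous_on UNIV c" "AE y in lebesgue. u y = c y" "\<And>j. c (x j) = 0"
    using uv unfolding H_min_def by blast
  have L: "u \<in> L2" "v \<in> L2" using neg_laplacian_L2[OF uv'] by auto
  have hL: "(\<lambda>y. v y - z * u y) \<in> L2" by (intro L2_diff L2_cmult L)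
  show r: "((\<lambda>y. v y - z * u y), u) \<in> resolvent neg_laplacian z"
    using uv' hL unfolding resolvent_def by auto
  have "AE y in lebesgue. c y = green_potential z (\<lambda>y. v y - z * u y) y"
    using c(2) free_resolvent_green_potential[OF z r] by eventually_elim simp
  hence "c = green_potential z (\<lambda>y. v y - z * u y)"
    by (intro continuous_AE_eq c(1) green_potential_continuous z hL)
  thus "green_potential z (\<lambda>y. v y - z * u y) (x j) = 0" using c(3) by metis
qed

lemma H_min_intro:
  assumes z: "off_halfline z" and hu: "(h, u) \<in> resolvent neg_laplacian z"
    and zero: "\<And>j. green_potential z h (x j) = 0"
  obtains v where "(u, v) \<in> H_min x" "AE y in lebesgue. h y = v y - z * u y"
proof -
  obtain v where v: "(u, v) \<in> neg_laplacian" "AE y in lebesgue. h y = v y - z * u y" "h \<in> L2"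
    using free_resolventE[OF hu] by blast
  have "(u, v) \<in> H_min x"
    unfolding H_min_def using v(1) free_resolvent_green_potential[OF z hu] zero green_potential_continuous[OF z v(3)]
    by blast
  thus ?thesis using that v(2) by blast
qed

subsection \<open>Finite-dimensional subspaces\<close>

text \<open>
  One step of the Gram--Schmidt process; \<open>Q\<close> is the part of the new function that is orthogonal to the old ones.  If \<open>Q\<close>
  vanishes almost everywhere, then \<open>t = 0\<close> by division by zero, and this is the right coefficient.
\<close>

lemma L2_projection_exists:
  fixes G :: "'i \<Rightarrow> wave"
  assumes "finite S" "\<And>i. i \<in> S \<Longrightarrow> G i \<in> L2" "\<phi> \<in> L2"
  shows "\<exists>c. \<forall>i\<in>S. L2_inner (\<lambda>y. \<phi> y - (\<Sum>j\<in>S. c j * G j y)) (G i) = 0"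
  using assms
proof (induction S arbitrary: \<phi> rule: finite_induct)
  case empty
  show ?case by simp
next
  case (insert k S)
  have GL: "G i \<in> L2" if "i \<in> insert k S" for i using insert.prems that by auto
  obtain c where c: "\<And>i. i \<in> S \<Longrightarrow> L2_inner (\<lambda>y. \<phi> y - (\<Sum>j\<in>S. c j * G j y)) (G i) = 0"
    using insert.IH[of \<phi>] insert.prems by auto
  obtain d where d: "\<And>i. i \<in> S \<Longrightarrow> L2_inner (\<lambda>y. G k y - (\<Sum>j\<in>S. d j * G j y)) (G i) = 0"
    using insert.IH[of "G k"] insert.prems by auto
  define P where "P = (\<lambda>y. \<phi> y - (\<Sum>j\<in>S. c j * G j y))"
  define Q where "Q = (\<lambda>y. G k y - (\<Sum>j\<in>S. d j * G j y))"
  have PL: "P \<in> L2" and QL: "Q \<in> L2"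
    unfolding P_def Q_def using GL insert.prems by (auto intro!: L2_diff L2_sum L2_cmult)
  define t where "t = L2_inner P Q / L2_inner Q Q"
  have tQ: "t * L2_inner Q Q = L2_inner P Q"
    using L2_Cauchy_Schwarz[OF PL QL] by (cases "L2_norm Q = 0") (auto simp: t_def L2_inner_self)
  define b where "b j = (if j = k then t else c j - t * d j)" for j
  have eq: "(\<lambda>y. \<phi> y - (\<Sum>j\<in>insert k S. b j * G j y)) = (\<lambda>y. P y - t * Q y)"
  proof
    fix y
    have "(\<Sum>j\<in>S. b j * G j y) = (\<Sum>j\<in>S. c j * G j y - t * (d j * G j y))"
      using insert.hyps(2) by (intro sum.cong) (auto simp: b_def algebra_simps)
    thus "\<phi> y - (\<Sum>j\<in>insert k S. b j * G j y) = P y - t * Q y"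
      using insert.hyps by (simp add: b_def P_def Q_def sum_subtractf sum_distrib_left algebra_simps)
  qed
  have RL: "(\<lambda>y. P y - t * Q y) \<in> L2" by (intro L2_diff L2_cmult PL QL)
  have S: "L2_inner (\<lambda>y. P y - t * Q y) (G i) = 0" if "i \<in> S" for i
    using that c d PL QL GL unfolding P_def[symmetric] Q_def[symmetric]
    by (simp add: L2_inner_diff_left L2_cmult L2_inner_cmult_left)
  have "G k = (\<lambda>y. Q y + (\<Sum>j\<in>S. d j * G j y))" by (simp add: Q_def)
  hence "L2_inner (\<lambda>y. P y - t * Q y) (G k)
      = L2_inner (\<lambda>y. P y - t * Q y) Q + (\<Sum>j\<in>S. cnj (d j) * L2_inner (\<lambda>y. P y - t * Q y) (G j))"
    using RL QL GL by (simp add: L2_inner_add_right L2_inner_sum_right L2_sum L2_cmult L2_inner_cmult_right)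
  also have "\<dots> = 0"
    using S PL QL tQ by (simp add: L2_inner_diff_left L2_cmult L2_inner_cmult_left)
  finally have "L2_inner (\<lambda>y. P y - t * Q y) (G k) = 0" .
  thus ?case using S eq by (intro exI[of _ b]) auto
qed

lemma L2_double_orthogonal_in_span:
  fixes G :: "'i::finite \<Rightarrow> wave"
  assumes GL: "\<And>i. G i \<in> L2" and \<phi>L: "\<phi> \<in> L2"
    and orth: "\<And>h. h \<in> L2 \<Longrightarrow> (\<And>i. L2_inner h (G i) = 0) \<Longrightarrow> L2_inner h \<phi> = 0"
  shows "\<exists>c. AE y in lebesgue. \<phi> y = (\<Sum>j\<in>UNIV. c j * G j y)"
proof -
  obtain c where c: "\<And>i. L2_inner (\<lambda>y. \<phi> y - (\<Sum>j\<in>UNIV. c j * G j y)) (G i) = 0"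
    using L2_projection_exists[of UNIV G \<phi>] GL \<phi>L by auto
  define h where "h = (\<lambda>y. \<phi> y - (\<Sum>j\<in>UNIV. c j * G j y))"
  have sL: "(\<lambda>y. \<Sum>j\<in>UNIV. c j * G j y) \<in> L2" by (intro L2_sum L2_cmult GL)
  have hL: "h \<in> L2" unfolding h_def by (intro L2_diff \<phi>L sL)
  have "L2_inner h h = L2_inner h \<phi> - (\<Sum>j\<in>UNIV. cnj (c j) * L2_inner h (G j))"
    using hL \<phi>L sL GL by (subst (2) h_def) (simp add: L2_inner_diff_right L2_inner_sum_right L2_cmult L2_inner_cmult_right)
  also have "\<dots> = 0" using orth[OF hL] c by (simp add: h_def)
  finally have "L2_norm h = 0" by (simp add: L2_inner_self)
  hence "AE y in lebesgue. h y = 0" by (rule L2_norm_eq_0_AE[OF hL])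
  thus ?thesis unfolding h_def by (intro exI[of _ c]) (auto elim: eventually_mono)
qed

subsection \<open>Decomposition of the domain of the adjoint\<close>

text \<open>
  The counterpart, for the spectral parameter \<open>z\<close>, of the decomposition
  \<open>f = f\<^sub>H + \<Sum>\<^sub>j (\<xi>\<^sub>0\<^sub>j e\<^bsup>-r\<^esup>/r + \<xi>\<^sub>1\<^sub>j e\<^bsup>-r\<^esup>)\<close> (with \<open>r = |x - x\<^sub>j|\<close>): here the regular part \<open>u\<close> need not vanish at the centres, and \<open>c\<close> collects the
  coefficients of the singular part.
\<close>

definition green_form :: "('m::finite \<Rightarrow> real^3) \<Rightarrow> complex \<Rightarrow> wave \<Rightarrow> wave \<Rightarrow> complex^'m \<Rightarrow> bool" where
  "green_form x z f h c \<longleftrightarrow> f \<in> L2 \<and> (\<exists>u. (h, u) \<in> resolvent neg_laplacian z \<and>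
     (AE y in lebesgue. f y = u y + (\<Sum>j\<in>UNIV. c $ j * green (sqrt_up z) (y - x j))))"

text \<open>
  The adjoint maps \<open>f\<close> to \<open>h + z f\<close>: the Green functions are orthogonal to the range of \<open>H_min x - cnj z\<close>, and for the
  regular part the claim is the symmetry of the free resolvent.
\<close>

lemma green_form_in_adjoint:
  assumes z: "off_halfline z" "off_halfline (cnj z)" and f: "green_form x z f h c"
  shows "f \<in> Domain (adjoint_op (H_min x))"
proof -
  obtain u where fL: "f \<in> L2" and hu: "(h, u) \<in> resolvent neg_laplacian z"
    and fe: "AE y in lebesgue. f y = u y + (\<Sum>j\<in>UNIV. c $ j * green (sqrt_up z) (y - x j))"
    using f unfolding green_form_def by blast
  have L: "h \<in> L2" "u \<in> L2" using hu by (auto elim!: free_resolventE)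
  have sL: "(\<lambda>y. \<Sum>j\<in>UNIV. c $ j * green (sqrt_up z) (y - x j)) \<in> L2"
    by (intro L2_sum L2_cmult green_L2 z)
  have "(f, \<lambda>y. h y + z * f y) \<in> adjoint_op (H_min x)"
  proof (rule adjoint_opI[OF fL])
    show "(\<lambda>y. h y + z * f y) \<in> L2" by (intro L2_add L2_cmult L fL)
    fix w v assume wv: "(w, v) \<in> H_min x"
    define k where "k = (\<lambda>y. v y - cnj z * w y)"
    have kw: "(k, w) \<in> resolvent neg_laplacian (cnj z)" and k0: "green_potential (cnj z) k (x j) = 0" for j
      using H_min_green_potential_zero[OF z(2) wv] by (simp_all add: k_def)
    have wvL: "w \<in> L2" "v \<in> L2" using wv neg_laplacian_L2 by (auto simp: H_min_def)
    have kL: "k \<in> L2" unfolding k_def by (intro L2_diff L2_cmult wvL)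
    have "L2_inner k f = L2_inner k (\<lambda>y. u y + (\<Sum>j\<in>UNIV. c $ j * green (sqrt_up z) (y - x j)))"
      by (intro L2_inner_cong_AE fe fL kL L2_add L sL) simp
    also have "\<dots> = L2_inner k u"
      using kL L sL k0 by (simp add: L2_inner_add_right L2_inner_sum_right L2_cmult green_L2 z L2_inner_cmult_right L2_inner_green)
    also have "\<dots> = L2_inner w h" by (rule free_resolvent_symmetric[OF z(1) hu kw])
    finally have "L2_inner v f - cnj z * L2_inner w f = L2_inner w h"
      using wvL fL by (simp add: k_def L2_inner_diff_left L2_cmult L2_inner_cmult_left)
    thus "L2_inner v f = L2_inner w (\<lambda>y. h y + z * f y)"
      using wvL L fL by (simp add: L2_inner_add_right L2_cmult L2_inner_cmult_right algebra_simps)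
  qed
  thus ?thesis by blast
qed

text \<open>
  Subtracting the solution \<open>u\<close> of \<open>(-\<Delta> - z) u = (H\<^sup>* - z) f\<close> from \<open>f\<close> leaves an element of the kernel of \<open>H\<^sup>* - z\<close>.  Any \<open>k\<close> that is
  orthogonal to all Green functions lies in the range of \<open>H - cnj z\<close> up to a null function, because \<open>(-\<Delta> - cnj z) w = k\<close> can be
  solved and \<open>w\<close> then vanishes at the centres; so \<open>k\<close> is orthogonal to that kernel element.  Hence the kernel
  element lies in the span of the Green functions.
\<close>

lemma adjoint_green_form:
  assumes z: "off_halfline z" "off_halfline (cnj z)"
    and surj: "\<And>h. h \<in> L2 \<Longrightarrow> \<exists>u. (h, u) \<in> resolvent neg_laplacian z"
    and surj': "\<And>h. h \<in> L2 \<Longrightarrow> \<exists>u. (h, u) \<in> resolvent neg_laplacian (cnj z)"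
    and f: "f \<in> Domain (adjoint_op (H_min x))"
  shows "\<exists>h c. green_form x z f h c"
proof -
  obtain g where fg: "(f, g) \<in> adjoint_op (H_min x)" using f by blast
  note adj = adjoint_opD[OF fg]
  define h where "h = (\<lambda>y. g y - z * f y)"
  have hL: "h \<in> L2" unfolding h_def by (intro L2_diff L2_cmult adj)
  obtain u where hu: "(h, u) \<in> resolvent neg_laplacian z" using surj[OF hL] by blast
  have uL: "u \<in> L2" using hu by (auto elim!: free_resolventE)
  have orth: "L2_inner k (\<lambda>y. f y - u y) = 0"
    if kL: "k \<in> L2" and k0: "\<And>j. L2_inner k (\<lambda>y. green (sqrt_up z) (y - x j)) = 0" for k
  proof -
    obtain w where kw: "(k, w) \<in> resolvent neg_laplacian (cnj z)" using surj'[OF kL] by blast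
    obtain v where wv: "(w, v) \<in> H_min x" "AE y in lebesgue. k y = v y - cnj z * w y"
      using H_min_intro[OF z(2) kw] k0 unfolding L2_inner_green[OF z(1)] by blast
    have wvL: "w \<in> L2" "v \<in> L2" using wv neg_laplacian_L2 by (auto simp: H_min_def)
    have "L2_inner k f = L2_inner (\<lambda>y. v y - cnj z * w y) f"
      by (intro L2_inner_cong_AE wv kL L2_diff L2_cmult wvL adj) simp
    also have "\<dots> = L2_inner w g - cnj z * L2_inner w f"
      using wvL adj by (simp add: L2_inner_diff_left L2_cmult L2_inner_cmult_left adj(3)[OF wv(1)])
    also have "\<dots> = L2_inner w h"
      using wvL adj by (simp add: h_def L2_inner_diff_right L2_cmult L2_inner_cmult_right)
    also have "\<dots> = L2_inner k u"
      by (rule free_resolvent_symmetric[OF z(1) hu kw, symmetric])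
    finally show ?thesis
      using kL adj uL by (simp add: L2_inner_diff_right)
  qed
  obtain c where "AE y in lebesgue. f y - u y = (\<Sum>j\<in>UNIV. c j * green (sqrt_up z) (y - x j))"
    using L2_double_orthogonal_in_span[of "\<lambda>j y. green (sqrt_up z) (y - x j)" "\<lambda>y. f y - u y"]
      orth green_L2[OF z(1)] L2_diff[OF adj(1) uL] by blast
  hence "AE y in lebesgue. f y = u y + (\<Sum>j\<in>UNIV. (\<chi> j. c j) $ j * green (sqrt_up z) (y - x j))"
    by eventually_elim (simp add: algebra_simps)
  thus ?thesis unfolding green_form_def using adj(1) hu by blast
qed

section \<open>Boundary values\<close>

text \<open>
  Disregarding null sets leaves enough points near \<open>a\<close> for the limit to be unique, since a punctured
  neighbourhood is not a null set.
\<close>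

lemma lim_at_eqI:
  assumes "AE y in lebesgue. f y = g y" "(g \<longlongrightarrow> l) (at a)"
  shows "lim_at a f = l"
  unfolding lim_at_def
proof (rule tendsto_Lim)
  show "\<not> trivial_limit (inf (at a) (ae_filter lebesgue))"
  proof
    assume "inf (at a) (ae_filter lebesgue) = bot"
    hence "eventually (\<lambda>_. False) (inf (at a) (ae_filter lebesgue))" by simp
    then obtain Q R where Q: "eventually Q (at a)" and R: "AE y in lebesgue. R y" and QR: "\<And>y. \<not> (Q y \<and> R y)"
      unfolding eventually_inf by blast
    obtain S where S: "open S" "a \<in> S" "\<And>y. y \<in> S \<Longrightarrow> y \<noteq> a \<Longrightarrow> Q y"
      using Q unfolding eventually_at_topological by blast
    obtain N where N: "N \<in> null_sets lebesgue" "{y \<in> space lebesgue. \<not> R y} \<subseteq> N"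
      using R unfolding eventually_ae_filter by blast
    have "S - {a} \<subseteq> N" using S(3) QR N(2) by auto
    hence "S - {a} \<in> null_sets lebesgue" using N(1) by (rule null_sets_completion_subset)
    moreover have "open (S - {a})" using S(1) by (simp add: open_delete)
    ultimately have "S = {a}" using open_null_set_empty[of "S - {a}"] S(2) by auto
    thus False using S(1) not_open_singleton[of a] by simp
  qed
  have "(g \<longlongrightarrow> l) (inf (at a) (ae_filter lebesgue))"
    using assms(2) by (rule tendsto_mono[rotated]) simp
  moreover have "eventually (\<lambda>y. g y = f y) (inf (at a) (ae_filter lebesgue))"
    using assms(1) by (intro filter_leD[OF inf_le2]) (auto elim: eventually_mono)
  ultimately show "(f \<longlongrightarrow> l) (inf (at a) (ae_filter lebesgue))"
    by (rule Lim_transform_eventually)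
qed

lemma tendsto_norm_diff_at: "((\<lambda>y. complex_of_real (norm (y - a))) \<longlongrightarrow> 0) (at a)"
proof -
  have "((\<lambda>y. complex_of_real (norm (y - a))) \<longlongrightarrow> of_real (norm (a - a))) (at a)"
    by (intro tendsto_of_real tendsto_intros)
  thus ?thesis by simp
qed

lemma green_pole:
  "((\<lambda>y. green k (y - a) * of_real (norm (y - a))) \<longlongrightarrow> 1 / of_real (4 * pi)) (at a)"
proof (rule Lim_transform_eventually)
  show "((\<lambda>y. exp (\<i> * k * complex_of_real (norm (y - a))) / of_real (4 * pi)) \<longlongrightarrow> 1 / of_real (4 * pi)) (at a)"
    using tendsto_divide[OF tendsto_exp[OF tendsto_mult[OF tendsto_const[of "\<i> * k"] tendsto_norm_diff_at[of a]]] tendsto_const[of "of_real (4 * pi)"]]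
    by simp
  show "eventually (\<lambda>y. exp (\<i> * k * complex_of_real (norm (y - a))) / of_real (4 * pi) = green k (y - a) * of_real (norm (y - a))) (at a)"
    by (auto simp: eventually_at_filter green_def)
qed

lemma green_regular_part:
  "((\<lambda>y. green k (y - a) - 1 / of_real (4 * pi) / of_real (norm (y - a))) \<longlongrightarrow> \<i> * k / of_real (4 * pi)) (at a)"
proof (rule Lim_transform_eventually)
  have "((\<lambda>w. exp (\<i> * k * w)) has_field_derivative \<i> * k) (at 0)"
    by (auto intro!: derivative_eq_intros)
  hence "((\<lambda>w. (exp (\<i> * k * w) - 1) / w) \<longlongrightarrow> \<i> * k) (at 0)"
    by (simp add: has_field_derivative_iff)
  moreover have "filterlim (\<lambda>y. complex_of_real (norm (y - a))) (at 0) (at a)"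
    using tendsto_norm_diff_at[of a] by (auto simp: filterlim_at eventually_at_filter)
  ultimately have "((\<lambda>y. (exp (\<i> * k * complex_of_real (norm (y - a))) - 1) / of_real (norm (y - a))) \<longlongrightarrow> \<i> * k) (at a)"
    by (rule filterlim_compose)
  thus "((\<lambda>y. (exp (\<i> * k * complex_of_real (norm (y - a))) - 1) / of_real (norm (y - a)) / of_real (4 * pi)) \<longlongrightarrow> \<i> * k / of_real (4 * pi)) (at a)"
    by (intro tendsto_divide tendsto_const) auto
  show "eventually (\<lambda>y. (exp (\<i> * k * complex_of_real (norm (y - a))) - 1) / of_real (norm (y - a)) / of_real (4 * pi)
      = green k (y - a) - 1 / of_real (4 * pi) / of_real (norm (y - a))) (at a)"
    by (auto simp: eventually_at_filter green_def field_simps)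
qed

text \<open>
  At \<open>x\<^sub>k\<close> only the Green function with pole \<open>x\<^sub>k\<close> is singular.  Its regular part \<open>\<i> sqrt z/(4\<pi>)\<close> and the values
  of the other Green functions are, up to sign, the entries of \<open>\<Gamma>_mat\<close> without the \<open>\<alpha>\<close>, which explains the matrix
  difference.
\<close>

lemma green_form_boundary_values:
  fixes x :: "'m::finite \<Rightarrow> real^3"
  assumes z: "off_halfline z" and x: "inj x" and f: "green_form x z f h c"
  shows "\<Gamma>0 x f = c"
    and "\<Gamma>1 x f = (\<chi> j. green_potential z h (x j)) + (diag_mat \<alpha> *v c - \<Gamma>_mat x \<alpha> z *v c)"
proof -
  obtain u where hu: "(h, u) \<in> resolvent neg_laplacian z"
    and fe: "AE y in lebesgue. f y = u y + (\<Sum>j\<in>UNIV. c $ j * green (sqrt_up z) (y - x j))"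
    using f unfolding green_form_def by blast
  have hL: "h \<in> L2" using hu by (auto elim!: free_resolventE)
  let ?p = "green_potential z h"
  let ?G = "\<lambda>j y. green (sqrt_up z) (y - x j)"
  have pot: "(?p \<longlongrightarrow> ?p a) (at a)" for a
    using green_potential_continuous[OF z hL] by (simp add: continuous_on_def)
  have other: "((\<lambda>y. \<Sum>j\<in>UNIV - {k}. c $ j * ?G j y) \<longlongrightarrow> (\<Sum>j\<in>UNIV - {k}. c $ j * ?G j (x k))) (at (x k))" for k
  proof (intro tendsto_sum tendsto_mult tendsto_const)
    fix j assume "j \<in> UNIV - {k}"
    hence "x k - x j \<noteq> 0" using x by (auto dest: injD)
    hence "isCont (green (sqrt_up z)) (x k - x j)" by (rule isCont_green)
    moreover have "((\<lambda>y. y - x j) \<longlongrightarrow> x k - x j) (at (x k))" by (intro tendsto_intros)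
    ultimately show "((\<lambda>y. ?G j y) \<longlongrightarrow> ?G j (x k)) (at (x k))" by (rule isCont_tendsto_compose)
  qed
  define P where "P k y = ?p y + (\<Sum>j\<in>UNIV - {k}. c $ j * ?G j y)" for k y
  have P: "(P k \<longlongrightarrow> P k (x k)) (at (x k))" for k
    unfolding P_def by (intro tendsto_add pot other)
  have fP: "AE y in lebesgue. f y = P k y + c $ k * ?G k y" for k
    using fe free_resolvent_green_potential[OF z hu]
  proof eventually_elim
    case (elim y)
    thus ?case by (simp add: P_def sum.remove[of UNIV k])
  qed
  have \<xi>: "\<xi>0 x f k = c $ k / of_real (4 * pi)" for k
    unfolding \<xi>0_def
  proof (rule lim_at_eqI)
    show "AE y in lebesgue. f y * of_real (norm (y - x k)) = P k y * of_real (norm (y - x k)) + c $ k * (?G k y * of_real (norm (y - x k)))"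
      using fP[of k] by eventually_elim (simp add: algebra_simps)
    have "((\<lambda>y. P k y * of_real (norm (y - x k)) + c $ k * (?G k y * of_real (norm (y - x k))))
        \<longlongrightarrow> P k (x k) * 0 + c $ k * (1 / of_real (4 * pi))) (at (x k))"
      by (intro tendsto_add tendsto_mult P tendsto_norm_diff_at tendsto_const green_pole)
    thus "((\<lambda>y. P k y * of_real (norm (y - x k)) + c $ k * (?G k y * of_real (norm (y - x k))))
        \<longlongrightarrow> c $ k / of_real (4 * pi)) (at (x k))"
      by simp
  qed
  show "\<Gamma>0 x f = c"
    by (simp add: \<Gamma>0_def \<xi> vec_eq_iff)
  have 1: "\<Gamma>1 x f $ k = P k (x k) + c $ k * (\<i> * sqrt_up z / of_real (4 * pi))" for k
    unfolding \<Gamma>1_def vec_lambda_beta \<xi>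
  proof (rule lim_at_eqI)
    show "AE y in lebesgue. f y - c $ k / of_real (4 * pi) / of_real (norm (y - x k))
        = P k y + c $ k * (?G k y - 1 / of_real (4 * pi) / of_real (norm (y - x k)))"
      using fP[of k] by eventually_elim (simp add: algebra_simps)
    show "((\<lambda>y. P k y + c $ k * (?G k y - 1 / of_real (4 * pi) / of_real (norm (y - x k))))
        \<longlongrightarrow> P k (x k) + c $ k * (\<i> * sqrt_up z / of_real (4 * pi))) (at (x k))"
      by (intro tendsto_add tendsto_mult P tendsto_const green_regular_part)
  qed
  have d: "(diag_mat \<alpha> *v c) $ k = of_real (\<alpha> $ k) * c $ k" for k
    by (simp add: matrix_vector_mult_def diag_mat_def if_distrib[of "\<lambda>w. w * _"] cong: if_cong)
  have g: "(\<Gamma>_mat x \<alpha> z *v c) $ k = (of_real (\<alpha> $ k) - \<i> * sqrt_up z / of_real (4 * pi)) * c $ k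
      - (\<Sum>j\<in>UNIV - {k}. c $ j * ?G j (x k))" for k
  proof -
    have "(\<Gamma>_mat x \<alpha> z *v c) $ k = \<Gamma>_mat x \<alpha> z $ k $ k * c $ k + (\<Sum>j\<in>UNIV - {k}. \<Gamma>_mat x \<alpha> z $ k $ j * c $ j)"
      by (simp add: matrix_vector_mult_def sum.remove[of UNIV k])
    also have "(\<Sum>j\<in>UNIV - {k}. \<Gamma>_mat x \<alpha> z $ k $ j * c $ j) = (\<Sum>j\<in>UNIV - {k}. - (c $ j * ?G j (x k)))"
      using x by (intro sum.cong refl) (auto simp: \<Gamma>_mat_def green_tilde_def dest: injD)
    finally show ?thesis
      by (simp add: \<Gamma>_mat_def green_tilde_def sum_negf)
  qed
  show "\<Gamma>1 x f = (\<chi> j. green_potential z h (x j)) + (diag_mat \<alpha> *v c - \<Gamma>_mat x \<alpha> z *v c)"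
    by (simp add: vec_eq_iff 1 d g P_def algebra_simps)
qed

section \<open>The domain of the Schr\<ouml>dinger operator\<close>

lemma matrix_inv_both:
  fixes A :: "complex^'m^'m"
  assumes "invertible A"
  shows "A ** matrix_inv A = mat 1" "matrix_inv A ** A = mat 1"
  using someI_ex[OF assms[unfolded invertible_def]] unfolding matrix_inv_def by blast+

text \<open>
  The domain of \<open>T\<close> is the range of its resolvent, and the coefficients in the resolvent formula solve a
  linear system with matrix \<open>\<Gamma>_mat\<close>.
\<close>

lemma point_interaction_domain_iff:
  fixes x :: "'m::finite \<Rightarrow> real^3"
  assumes T: "point_interaction x \<alpha> T" and z: "z \<in> resolvent_set T - complex_of_real ` {0..}"
  shows "f \<in> Domain T \<longleftrightarrow> (\<exists>h c. green_form x z f h c \<and> \<Gamma>_mat x \<alpha> z *v c = (\<chi> j. green_potential z h (x j)))"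
proof -
  have inv: "invertible (\<Gamma>_mat x \<alpha> z)"
    and res: "resolvent T z = {(f, u). f \<in> L2 \<and> u \<in> L2 \<and>
          (\<exists>u\<^sub>0. (f, u\<^sub>0) \<in> resolvent neg_laplacian z \<and>
             (AE y in lebesgue. u y = u\<^sub>0 y +
                (\<Sum>j\<in>UNIV. \<Sum>k\<in>UNIV. matrix_inv (\<Gamma>_mat x \<alpha> z) $ j $ k *
                   (LINT w|lebesgue. green (sqrt_up z) (w - x k) * f w) *
                   green (sqrt_up z) (y - x j))))}"
    using T z unfolding point_interaction_def by blast+
  have adj: "adjoint_op T = T" using T by (simp add: point_interaction_def self_adjoint_def)
  have form: "(h, f) \<in> resolvent T z \<longleftrightarrow> green_form x z f h (matrix_inv (\<Gamma>_mat x \<alpha> z) *v (\<chi> j. green_potential z h (x j)))" for h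
  proof -
    have "(matrix_inv (\<Gamma>_mat x \<alpha> z) *v (\<chi> j. green_potential z h (x j))) $ j * w
        = (\<Sum>k\<in>UNIV. matrix_inv (\<Gamma>_mat x \<alpha> z) $ j $ k * (LINT w|lebesgue. green (sqrt_up z) (w - x k) * h w) * w)" for j w
      by (simp add: matrix_vector_mult_def green_potential_def sum_distrib_right)
    moreover have "h \<in> L2" if "(h, u) \<in> resolvent neg_laplacian z" for u
      using that by (auto elim!: free_resolventE)
    ultimately show ?thesis
      unfolding res green_form_def by auto
  qed
  have "f \<in> Domain T \<longleftrightarrow> (\<exists>h. (h, f) \<in> resolvent T z)"
  proof
    assume "f \<in> Domain T"
    then obtain g where fg: "(f, g) \<in> T" by blast
    have "(f, g) \<in> adjoint_op T" using fg adj by simp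
    hence "(\<lambda>y. g y - z * f y) \<in> L2" by (intro L2_diff L2_cmult) (auto dest: adjoint_opD)
    hence "((\<lambda>y. g y - z * f y), f) \<in> resolvent T z" using fg unfolding resolvent_def by auto
    thus "\<exists>h. (h, f) \<in> resolvent T z" by blast
  next
    assume "\<exists>h. (h, f) \<in> resolvent T z"
    thus "f \<in> Domain T" unfolding resolvent_def by blast
  qed
  also have "\<dots> \<longleftrightarrow> (\<exists>h c. green_form x z f h c \<and> \<Gamma>_mat x \<alpha> z *v c = (\<chi> j. green_potential z h (x j)))"
  proof -
    have "\<Gamma>_mat x \<alpha> z *v c = p \<longleftrightarrow> c = matrix_inv (\<Gamma>_mat x \<alpha> z) *v p" for c p
      using matrix_inv_both[OF inv] by (metis matrix_vector_mul_assoc matrix_vector_mul_lid)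
    thus ?thesis unfolding form by auto
  qed
  finally show ?thesis .
qed

theorem proposition4p5:
  fixes x :: "'m::finite \<Rightarrow> real^3" and \<alpha> :: "real^'m" and T :: operator
  assumes "inj x"
    and "point_interaction x \<alpha> T"
  shows "Domain T = {f \<in> Domain (adjoint_op (H_min x)). \<Gamma>1 x f - diag_mat \<alpha> *v \<Gamma>0 x f = 0}
       \<and> Domain T = {f \<in> Domain (adjoint_op (H_min x)). \<Gamma>1 x f = diag_mat \<alpha> *v \<Gamma>0 x f}"
proof -
  interpret selfadjoint_op T
    using assms(2) by unfold_locales (simp add: point_interaction_def self_adjoint_def)
  have nr: "off_halfline \<i>" "off_halfline (- \<i>)"
    by (auto simp: complex_eq_iff)
  have z: "w \<in> resolvent_set T - complex_of_real ` {0..}" if "w = \<i> \<or> w = - \<i>" for w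
    using imaginary_unit_in_resolvent_set[OF that] that nr by (metis DiffI)
  \<comment> \<open>The first summand of the resolvent formula solves the free equation.\<close>
  have surj: "\<exists>u. (h, u) \<in> resolvent neg_laplacian w" if "w = \<i> \<or> w = - \<i>" "h \<in> L2" for w h
  proof -
    have "\<exists>f. (h, f) \<in> resolvent T w"
      using z[OF that(1)] that(2) unfolding resolvent_set_def by blast
    moreover have "resolvent T w \<subseteq> {(h, f). \<exists>u. (h, u) \<in> resolvent neg_laplacian w}"
      using assms(2) z[OF that(1)] unfolding point_interaction_def by auto
    ultimately show ?thesis by blast
  qed
  have "f \<in> Domain T \<longleftrightarrow> f \<in> Domain (adjoint_op (H_min x)) \<and> \<Gamma>1 x f = diag_mat \<alpha> *v \<Gamma>0 x f" for f
  proof -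
    have bc: "\<Gamma>1 x f = diag_mat \<alpha> *v \<Gamma>0 x f \<longleftrightarrow> \<Gamma>_mat x \<alpha> \<i> *v c = (\<chi> j. green_potential \<i> h (x j))"
      if "green_form x \<i> f h c" for h c
      unfolding green_form_boundary_values(1)[OF nr(1) assms(1) that]
        green_form_boundary_values(2)[OF nr(1) assms(1) that, of \<alpha>]
      by (auto simp: algebra_simps)
    have "f \<in> Domain (adjoint_op (H_min x)) \<longleftrightarrow> (\<exists>h c. green_form x \<i> f h c)"
      using adjoint_green_form[OF nr(1) _ surj, of f x] green_form_in_adjoint[OF nr(1), of x f] nr(2) surj by auto
    thus ?thesis
      unfolding point_interaction_domain_iff[OF assms(2) z[OF disjI1[OF refl]]] using bc by blast
  qed
  thus ?thesis by auto
qed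

end
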